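(* Let $f:X\to\mathbb{D}_1$ be an $M$-fibration with $\mathrm{Crit}(f)=S_1\sqcup\cdots\sqcup S_n$, normalized as in the context, let $\mathcal{P}:\widetilde{X}\to X$ be the orientation double covering, and $\widetilde{f}=f\circ\mathcal{P}$. Let $k\in\{1,\dots,n\}$, let $\epsilon>0$ be sufficiently small, and let $C_1,C_2\subset\widetilde{f}^{-1}(\partial\mathbb{D}_{1/2-\epsilon})$ be the attaching circles, given in the context, of the two $2$-handles of $\widetilde{X}$ arising from $\widetilde{S}_k=\mathcal{P}^{-1}(S_k)$. Then each of $C_1$ and $C_2$ can be isotoped in $\widetilde{f}^{-1}(\partial\mathbb{D}_{1/2-\epsilon})$ so that both circles are contained in a single fiber of $\widetilde{f}$. After the isotopy, their configuration in this fiber is (up to isotopy of the fiber) the standard configuration described in the context. Moreover, the framing of each of the two $2$-handles agrees with the fiber framing (the framing of the isotoped circle given by a normal vector field tangent to the fiber).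
   Context: All manifolds are smooth and connected. $\mathrm{Crit}(f)$ is the set of critical points; $\mathbb{D}_r\subset\mathbb{C}$ is the closed disk of radius $r$ centered at $0$; $z=x+\sqrt{-1}y$ on $\mathbb{C}$. Local models. $M$ is the quotient of $\mathbb{R}^2$ by the $\mathbb{Z}$-action $n\cdot(r,s)=((-1)^nr,s+n)$, with classes $[r,s]_m$; $A$ is the quotient of $\mathbb{R}^2$ by $n\cdot(r,s)=(r,s+n)$, with classes $[r,s]_a$. $\pi:A\to M$, $\pi([r,s]_a)=[r,2s]_m$, is the orientation double covering. $F_m:M\times\mathbb{C}\to\mathbb{C}$, $F_m([r,s]_m,z)=r\exp(\pi\sqrt{-1}s)+z^2$; $F_a=F_m\circ(\pi\times\mathrm{id}):A\times\mathbb{C}\to\mathbb{C}$, $F_a([r,s]_a,z)=r\exp(2\pi\sqrt{-1}s)+z^2$. A component $S$ of the critical set of a smooth map from a $4$-manifold to a surface is an $M$-singularity if it is an embedded circle mapped to one point $q$ and, in suitable coordinates on a tubular neighborhood $\nu S\cong M\times\mathbb{C}$ and a complex chart around $q$, the map is $F_m$. An $M$-fibration is a smooth map $f:X\to Z$ from a compact $4$-manifold to a compact surface with $\partial X=f^{-1}(\partial Z)$, whose critical set lies in $\mathrm{Int}\,X$ and consists of $M$-singularities, each fiber containing at most one component of $\mathrm{Crit}(f)$. Normalization. $f(S_k)=\{q_k\}$ with $q_k=\frac12\exp(2\pi\sqrt{-1}k/n)$, and with $h(z)=|z|$ on $\mathbb{D}_1$ there are a diffeomorphism $\Phi_k$ from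 a tubular neighborhood $\nu S_k$ onto an open neighborhood of $\{([0,s]_m,0)\}$ in $M\times\mathbb{C}$ and a complex chart $\psi_k$ around $q_k$ with $\psi_k(q_k)=0$, $\psi_k\circ f\circ\Phi_k^{-1}=F_m$ and $h\circ\psi_k^{-1}(z)=-\mathrm{Re}(z)+1/2$. Let $\widetilde\Phi_k$, defined on $\nu\widetilde S_k=\mathcal{P}^{-1}(\nu S_k)$ with values in $A\times\mathbb{C}$, be a lift of $\Phi_k\circ\mathcal{P}$ through $\pi\times\mathrm{id}_{\mathbb{C}}$, so $\psi_k\circ\widetilde f\circ\widetilde\Phi_k^{-1}=F_a$. The $2$-handles. On $\widetilde X\setminus\widetilde f^{-1}(0)$ the function $h\circ\widetilde f$ is Morse with exactly two critical points in each $\nu\widetilde S_k$, namely $\widetilde\Phi_k^{-1}([0,1/4]_a,0)$ and $\widetilde\Phi_k^{-1}([0,3/4]_a,0)$, both of index $2$. The corresponding $2$-handles attached to $\widetilde f^{-1}(\mathbb{D}_{1/2-\epsilon})$ have attaching circles $$C_1=\widetilde\Phi_k^{-1}\{([\cos(2\pi s),s]_a,x)\mid x\in\mathbb{R},\ s\in(0,1/2),\ x^2+\cos^2(2\pi s)=\epsilon\},$$ $$C_2=\widetilde\Phi_k^{-1}\{([\cos(2\pi s),s]_a,x)\mid x\in\mathbb{R},\ s\in(1/2,1),\ x^2+\cos^2(2\pi s)=\epsilon\}.$$ Standard configuration. The projection $\widetilde\alpha:F_a^{-1}(\epsilon)\to A$ to the first factor is a double branched covering branched over the two points $b_1=[\epsilon,0]_a$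 and $b_2=[-\epsilon,1/2]_a$ (its total space is a genus-one surface with two ends). Consider the two arcs in $A$ joining $b_1$ and $b_2$, $$\beta_1=\{[\epsilon\cos(2\pi s),s]_a\mid 0\le s\le 1/2\},\qquad \beta_2=\{[\epsilon\cos(2\pi s),s]_a\mid 1/2\le s\le 1\},$$ whose interiors are disjoint and whose union is a simple closed curve isotopic to the core $\{r=0\}$ of $A$. The standard configuration in the fiber $\widetilde f^{-1}(\psi_k^{-1}(\epsilon))$ is the pair of simple closed curves $\widetilde\Phi_k^{-1}(\widetilde\alpha^{-1}(\beta_1))$ (the position of $C_1$) and $\widetilde\Phi_k^{-1}(\widetilde\alpha^{-1}(\beta_2))$ (the position of $C_2$), which, after a small perturbation, meet transversely at exactly two points (over $b_1$ and $b_2$). *)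

theory Defs
  imports "HOL-Analysis.Analysis"
begin

section \<open>Smooth maps between subsets of Euclidean spaces\<close>

primrec Ck_on :: "nat \<Rightarrow> ('a::euclidean_space \<Rightarrow> 'b::euclidean_space) \<Rightarrow> 'a set \<Rightarrow> bool" where
  "Ck_on 0 f U \<longleftrightarrow> continuous_on U f"
| "Ck_on (Suc k) f U \<longleftrightarrow> f differentiable_on U \<and>
     (\<forall>i\<in>Basis. Ck_on k (\<lambda>x. frechet_derivative f (at x) i) U)"

text \<open>\<^const>\<open>Ck_on\<close> is only used on open sets. On an arbitrary set, smooth means
  locally the restriction of a smooth map defined on an open set; this is what is needed
  at boundary points of manifolds.\<close>

definition smooth_on :: "'a::euclidean_space set \<Rightarrow> ('a \<Rightarrow> 'b::euclidean_space) \<Rightarrow> bool" where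
  "smooth_on S f \<longleftrightarrow> (\<forall>x\<in>S. \<exists>U g. open U \<and> x \<in> U \<and> (\<forall>k. Ck_on k g U) \<and> (\<forall>y\<in>S \<inter> U. g y = f y))"

section \<open>Manifolds\<close>

text \<open>A manifold is given by an atlas alone; the topology is the one induced by the charts.
  The model space is a Euclidean space, whose dimension is the dimension of the manifold.\<close>

type_synonym ('a, 'e) chart = "'a set \<times> ('a \<Rightarrow> 'e)"
type_synonym ('a, 'e) atlas = "('a, 'e) chart set"

definition carr :: "('a, 'e) atlas \<Rightarrow> 'a set" where
  "carr X = (\<Union>c\<in>X. fst c)"

definition mtop :: "('a, 'e::euclidean_space) atlas \<Rightarrow> 'a topology" where
  "mtop X = topology (\<lambda>W. W \<subseteq> carr X \<and> (\<forall>c\<in>X. \<exists>T. open T \<and> W \<inter> fst c = fst c \<inter> snd c -` T))"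

lemma openin_mtop:
  "openin (mtop X) W \<longleftrightarrow> W \<subseteq> carr X \<and> (\<forall>c\<in>X. \<exists>T. open T \<and> W \<inter> fst c = fst c \<inter> snd c -` T)"
proof -
  let ?P = "\<lambda>W c. \<exists>T. open T \<and> W \<inter> fst c = fst c \<inter> snd c -` T"
  have Int: "?P (A \<inter> B) c" if A: "?P A c" and B: "?P B c" for A B and c :: "('a, 'b) chart"
  proof -
    obtain S T where S: "open S" "A \<inter> fst c = fst c \<inter> snd c -` S"
      and T: "open T" "B \<inter> fst c = fst c \<inter> snd c -` T" using A B by auto
    have "(A \<inter> B) \<inter> fst c = (A \<inter> fst c) \<inter> (B \<inter> fst c)" by auto
    also have "\<dots> = fst c \<inter> snd c -` (S \<inter> T)" unfolding S T by auto
    finally show ?thesis using open_Int[OF S(1) T(1)] by metis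
  qed
  have Un: "?P (\<Union>K) c" if K: "\<forall>A\<in>K. ?P A c" for K and c :: "('a, 'b) chart"
  proof -
    obtain T where T: "\<forall>A\<in>K. open (T A) \<and> A \<inter> fst c = fst c \<inter> snd c -` T A"
      using bchoice[OF K] by auto
    have "\<Union>K \<inter> fst c = (\<Union>A\<in>K. A \<inter> fst c)" by auto
    also have "\<dots> = (\<Union>A\<in>K. fst c \<inter> snd c -` T A)" using T by simp
    also have "\<dots> = fst c \<inter> snd c -` (\<Union>A\<in>K. T A)" by auto
    finally show ?thesis using T by (intro exI[of _ "\<Union>A\<in>K. T A"]) auto
  qed
  have "istopology (\<lambda>W. W \<subseteq> carr X \<and> (\<forall>c\<in>X. ?P W c))"
    unfolding istopology_def
  proof (intro conjI allI impI)
    fix A B assume "A \<subseteq> carr X \<and> (\<forall>c\<in>X. ?P A c)" "B \<subseteq> carr X \<and> (\<forall>c\<in>X. ?P B c)"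
    then show "A \<inter> B \<subseteq> carr X" "\<forall>c\<in>X. ?P (A \<inter> B) c" using Int by (simp_all add: le_infI1)
  next
    fix K assume K: "\<forall>W\<in>K. W \<subseteq> carr X \<and> (\<forall>c\<in>X. ?P W c)"
    then show "\<Union>K \<subseteq> carr X" by (simp add: Sup_le_iff)
    show "\<forall>c\<in>X. ?P (\<Union>K) c"
    proof
      fix c assume "c \<in> X"
      then have "\<forall>A\<in>K. ?P A c" using K by simp
      then show "?P (\<Union>K) c" by (rule Un)
    qed
  qed
  then show ?thesis unfolding mtop_def by (simp only: topology_inverse')
qed

text \<open>Transition maps, and more generally \<open>g\<close> read in the chart \<open>c\<close>.\<close>

definition in_chart :: "('a, 'e) chart \<Rightarrow> ('a \<Rightarrow> 'b) \<Rightarrow> 'e \<Rightarrow> 'b" where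
  "in_chart c g = g \<circ> inv_into (fst c) (snd c)"

text \<open>Smooth manifolds with (possibly empty) boundary. The choice \<open>v = 0\<close> gives charts onto open
  subsets of the model space, \<open>v \<noteq> 0\<close> charts onto relatively open subsets of a closed half-space.\<close>

definition smooth_manifold :: "('a, 'e::euclidean_space) atlas \<Rightarrow> bool" where
  "smooth_manifold X \<longleftrightarrow>
     (\<forall>c\<in>X. inj_on (snd c) (fst c) \<and> openin (mtop X) (fst c) \<and>
        (\<exists>v. openin (top_of_set {x. 0 \<le> x \<bullet> v}) (snd c ` fst c))) \<and>
     (\<forall>c\<in>X. \<forall>d\<in>X. smooth_on (snd c ` (fst c \<inter> fst d)) (in_chart c (snd d))) \<and>
     Hausdorff_space (mtop X) \<and> second_countable (mtop X)"

definition mboundary :: "('a, 'e::euclidean_space) atlas \<Rightarrow> 'a set" where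
  "mboundary X = {p. \<exists>c\<in>X. p \<in> fst c \<and> snd c p \<notin> interior (snd c ` fst c)}"

definition smooth_map ::
  "('a, 'e::euclidean_space) atlas \<Rightarrow> ('b, 'f::euclidean_space) atlas \<Rightarrow> ('a \<Rightarrow> 'b) \<Rightarrow> bool" where
  "smooth_map X Y f \<longleftrightarrow> continuous_map (mtop X) (mtop Y) f \<and>
     (\<forall>c\<in>X. \<forall>d\<in>Y. smooth_on (snd c ` (fst c \<inter> f -` fst d)) (in_chart c (snd d \<circ> f)))"

definition diffeo ::
  "('a, 'e::euclidean_space) atlas \<Rightarrow> ('b, 'f::euclidean_space) atlas \<Rightarrow> ('a \<Rightarrow> 'b) \<Rightarrow> bool" where
  "diffeo X Y f \<longleftrightarrow> bij_betw f (carr X) (carr Y) \<and> smooth_map X Y f \<and>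
     smooth_map Y X (inv_into (carr X) f)"

text \<open>\<open>sub X S\<close> is used for open submanifolds, and also for embedded submanifolds \<open>S\<close>:
  its charts need not have open images, but because of the local extensions in
  \<^const>\<open>smooth_on\<close> the smooth maps from and to \<open>sub X S\<close> are those of the submanifold.
  Likewise for \<open>euclid S\<close>, e.g. with \<open>S\<close> the closed unit disk or \<open>[0,1]\<close>.\<close>

definition sub :: "('a, 'e) atlas \<Rightarrow> 'a set \<Rightarrow> ('a, 'e) atlas" where
  "sub X S = (\<lambda>c. (fst c \<inter> S, snd c)) ` X"

definition euclid :: "'e set \<Rightarrow> ('e, 'e) atlas" where
  "euclid S = {(S, id)}"

definition prod_mfd :: "('a, 'e) atlas \<Rightarrow> ('b, 'f) atlas \<Rightarrow> ('a \<times> 'b, 'e \<times> 'f) atlas" where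
  "prod_mfd X Y = {(fst c \<times> fst d, map_prod (snd c) (snd d)) | c d. c \<in> X \<and> d \<in> Y}"

subsection \<open>Differentials and tangent vectors\<close>

text \<open>The differential at \<open>p\<close> of \<open>g\<close>, read in the chart \<open>c\<close> at \<open>p\<close>.\<close>

definition chart_deriv ::
  "('a, 'e::euclidean_space) chart \<Rightarrow> ('a \<Rightarrow> 'b::euclidean_space) \<Rightarrow> 'a \<Rightarrow> 'e \<Rightarrow> 'b" where
  "chart_deriv c g p = frechet_derivative (in_chart c g) (at (snd c p) within (snd c ` fst c))"

text \<open>A tangent vector at \<open>p\<close> assigns to each chart at \<open>p\<close> its coordinate vector, compatibly with
  the transition maps. Values at charts not containing \<open>p\<close> are irrelevant.\<close>

type_synonym ('a, 'e) tvec = "('a, 'e) chart \<Rightarrow> 'e"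

definition tangent_vec :: "('a, 'e::euclidean_space) atlas \<Rightarrow> 'a \<Rightarrow> ('a, 'e) tvec \<Rightarrow> bool" where
  "tangent_vec X p v \<longleftrightarrow>
     (\<forall>c\<in>X. \<forall>d\<in>X. p \<in> fst c \<inter> fst d \<longrightarrow> v d = chart_deriv c (snd d) p (v c))"

text \<open>\<open>dg\<^sub>p v = 0\<close>. For a regular level set of \<open>g\<close> through \<open>p\<close> this says that \<open>v\<close> is tangent to it.\<close>

definition in_ker :: "('a, 'e::euclidean_space) atlas \<Rightarrow> ('a \<Rightarrow> 'b::euclidean_space) \<Rightarrow> 'a \<Rightarrow>
    ('a, 'e) tvec \<Rightarrow> bool" where
  "in_ker X g p v \<longleftrightarrow> (\<forall>c\<in>X. p \<in> fst c \<longrightarrow> chart_deriv c g p (v c) = 0)"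

definition Crit :: "('a, 'e::euclidean_space) atlas \<Rightarrow> ('a \<Rightarrow> 'b::euclidean_space) \<Rightarrow> 'a set" where
  "Crit X g = {p. \<exists>c\<in>X. p \<in> fst c \<and> \<not> surj (chart_deriv c g p)}"

subsection \<open>Circles and isotopies\<close>

text \<open>Embedded circles are 1-periodic parametrized curves.\<close>

definition embedded_circle :: "('a, 'e::euclidean_space) atlas \<Rightarrow> (real \<Rightarrow> 'a) \<Rightarrow> bool" where
  "embedded_circle X \<gamma> \<longleftrightarrow> smooth_map (euclid UNIV) X \<gamma> \<and> (\<forall>t. \<gamma> (t + 1) = \<gamma> t) \<and>
     inj_on \<gamma> {0..<1} \<and>
     (\<forall>t. \<forall>c\<in>X. \<gamma> t \<in> fst c \<longrightarrow> vector_derivative (snd c \<circ> \<gamma>) (at t) \<noteq> 0)"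

definition circle_isotopy ::
  "('a, 'e::euclidean_space) atlas \<Rightarrow> 'a set \<Rightarrow> (real \<Rightarrow> real \<Rightarrow> 'a) \<Rightarrow> bool" where
  "circle_isotopy X Y H \<longleftrightarrow>
     smooth_map (euclid ({0..1} \<times> UNIV)) X (\<lambda>(\<tau>, t). H \<tau> t) \<and>
     (\<forall>\<tau>\<in>{0..1}. embedded_circle X (H \<tau>) \<and> range (H \<tau>) \<subseteq> Y)"

definition ambient_isotopy ::
  "('a, 'e::euclidean_space) atlas \<Rightarrow> 'a set \<Rightarrow> (real \<Rightarrow> 'a \<Rightarrow> 'a) \<Rightarrow> bool" where
  "ambient_isotopy X F G \<longleftrightarrow>
     smooth_map (prod_mfd (euclid {0..1}) (sub X F)) (sub X F) (\<lambda>(\<tau>, x). G \<tau> x) \<and>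
     (\<forall>\<tau>\<in>{0..1}. diffeo (sub X F) (sub X F) (G \<tau>)) \<and> (\<forall>x\<in>F. G 0 x = x)"

subsection \<open>The orientation double covering\<close>

text \<open>An orientation of the tangent space at \<open>p\<close> assigns a sign to each chart at \<open>p\<close>, namely
  whether the chart preserves orientation; it is \<open>0\<close> off the charts at \<open>p\<close> to make it unique.\<close>

definition orientation_at :: "('a, real^'m) atlas \<Rightarrow> 'a \<Rightarrow> (('a, real^'m) chart \<Rightarrow> real) \<Rightarrow> bool" where
  "orientation_at X p \<sigma> \<longleftrightarrow>
     (\<forall>c. if c \<in> X \<and> p \<in> fst c then \<sigma> c \<in> {1, -1} else \<sigma> c = 0) \<and>
     (\<forall>c\<in>X. \<forall>d\<in>X. p \<in> fst c \<inter> fst d \<longrightarrow>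
        \<sigma> d = sgn (det (matrix (chart_deriv c (snd d) p))) * \<sigma> c)"

type_synonym ('a, 'e) opoint = "'a \<times> (('a, 'e) chart \<Rightarrow> real)"

text \<open>Points are pairs of a point and an orientation at it, and the covering map is \<^const>\<open>fst\<close>.
  Each chart \<open>c\<close> lifts to its two sheets.\<close>

definition orient_cover :: "('a, real^'m) atlas \<Rightarrow> (('a, real^'m) opoint, real^'m) atlas" where
  "orient_cover X = {({(p, \<sigma>). p \<in> fst c \<and> orientation_at X p \<sigma> \<and> \<sigma> c = s}, snd c \<circ> fst)
     | c s. c \<in> X \<and> s \<in> {1, -1}}"

section \<open>Local models\<close>

text \<open>Points of the Moebius band and of the annulus are orbits in the plane.\<close>

definition M_class :: "real \<Rightarrow> real \<Rightarrow> (real \<times> real) set" where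
  "M_class r s = {((-1) powi n * r, s + of_int n) | n::int. True}"

definition A_class :: "real \<Rightarrow> real \<Rightarrow> (real \<times> real) set" where
  "A_class r s = {(r, s + of_int n) | n::int. True}"

text \<open>The charts of the quotient are the local inverses of the projection \<open>q\<close>.\<close>

definition quotient_mfd :: "('e::euclidean_space \<Rightarrow> 'a) \<Rightarrow> ('a, 'e) atlas" where
  "quotient_mfd q = {(q ` U, inv_into U q) | U. open U \<and> inj_on q U}"

definition Moebius :: "((real \<times> real) set, real \<times> real) atlas" where
  "Moebius = quotient_mfd (\<lambda>(r, s). M_class r s)"

definition Annulus :: "((real \<times> real) set, real \<times> real) atlas" where
  "Annulus = quotient_mfd (\<lambda>(r, s). A_class r s)"

type_synonym model_pt = "(real \<times> real) set \<times> complex"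

definition MC :: "(model_pt, (real \<times> real) \<times> complex) atlas" where
  "MC = prod_mfd Moebius (euclid UNIV)"

definition AC :: "(model_pt, (real \<times> real) \<times> complex) atlas" where
  "AC = prod_mfd Annulus (euclid UNIV)"

definition M_core :: "model_pt set" where
  "M_core = {(M_class 0 s, 0) | s. True}"

definition \<pi>_AM :: "(real \<times> real) set \<Rightarrow> (real \<times> real) set" where
  "\<pi>_AM u = (case SOME x. x \<in> u of (r, s) \<Rightarrow> M_class r (2 * s))"

definition F_m :: "model_pt \<Rightarrow> complex" where
  "F_m = (\<lambda>(u, z). (case SOME x. x \<in> u of (r, s) \<Rightarrow> of_real r * exp (of_real (pi * s) * \<i>)) + z\<^sup>2)"

definition F_a :: "model_pt \<Rightarrow> complex" where
  "F_a = F_m \<circ> map_prod \<pi>_AM id"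

text \<open>The definitions by representatives do what they should.\<close>

lemma exp_pi_int: "exp (of_real (pi * of_int n) * \<i>) = (of_real ((-1) powi n) :: complex)"
proof -
  have "exp (of_real (pi * of_int n) * \<i>) = cis (pi * of_int n)"
    by (simp add: cis_conv_exp mult.commute)
  also have "\<dots> = of_real ((-1) powi n)"
    by (rule complex_eqI) (simp_all add: cos_npi_int sin_npi_int power_int_minus_left)
  finally show ?thesis .
qed

lemma F_m_class: "F_m (M_class r s, z) = of_real r * exp (of_real (pi * s) * \<i>) + z\<^sup>2"
proof -
  have "(SOME x. x \<in> M_class r s) \<in> M_class r s"
    by (rule someI[of _ "((-1) powi 0 * r, s + of_int 0)"]) (auto simp: M_class_def intro!: exI[of _ 0])
  then obtain n :: int where n: "(SOME x. x \<in> M_class r s) = ((-1) powi n * r, s + of_int n)"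
    by (auto simp: M_class_def)
  have *: "(of_real ((-1) powi n) :: complex) * of_real ((-1) powi n) = 1"
    by (simp add: power_int_minus_left)
  have "of_real (pi * (s + of_int n)) * \<i>
      = of_real (pi * s) * \<i> + (of_real (pi * of_int n) * \<i> :: complex)"
    by (simp add: algebra_simps)
  then have "exp (of_real (pi * (s + of_int n)) * \<i>)
      = (exp (of_real (pi * s) * \<i>) * of_real ((-1) powi n) :: complex)"
    by (simp only: exp_add exp_pi_int)
  then have "of_real ((-1) powi n * r) * exp (of_real (pi * (s + of_int n)) * \<i>)
      = of_real r * exp (of_real (pi * s) * \<i>)
          * ((of_real ((-1) powi n) :: complex) * of_real ((-1) powi n))"
    by (simp only: of_real_mult mult_ac)
  then have "of_real ((-1) powi n * r) * exp (of_real (pi * (s + of_int n)) * \<i>)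
      = of_real r * exp (of_real (pi * s) * \<i> :: complex)"
    by (simp only: * mult_1_right)
  then show ?thesis unfolding F_m_def by (simp only: n prod.case)
qed

lemma M_class_shift: "M_class ((-1) powi m * r) (s + of_int m) = M_class r s"
proof (intro set_eqI iffI)
  have mul: "(-1::real) powi a * ((-1) powi b * r) = (-1) powi (a + b) * r" for a b :: int
    by (simp add: power_int_add)
  fix x
  show "x \<in> M_class r s" if x: "x \<in> M_class ((-1) powi m * r) (s + of_int m)"
  proof -
    obtain n where "x = ((-1) powi n * ((-1) powi m * r), (s + of_int m) + of_int n)"
      using x unfolding M_class_def by blast
    then have "x = ((-1) powi (n + m) * r, s + of_int (n + m))"
      by (simp only: mul of_int_add add_ac)
    then show ?thesis by (auto simp: M_class_def)
  qed
  show "x \<in> M_class ((-1) powi m * r) (s + of_int m)" if x: "x \<in> M_class r s"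
  proof -
    obtain n where "x = ((-1) powi ((n - m) + m) * r, (s + of_int m) + of_int (n - m))"
      using x by (auto simp: M_class_def)
    then have "x = ((-1) powi (n - m) * ((-1) powi m * r), (s + of_int m) + of_int (n - m))"
      by (simp only: mul)
    then show ?thesis unfolding M_class_def by blast
  qed
qed

lemma \<pi>_AM_class: "\<pi>_AM (A_class r s) = M_class r (2 * s)"
proof -
  have "(SOME x. x \<in> A_class r s) \<in> A_class r s"
    by (rule someI[of _ "(r, s + of_int 0)"]) (auto simp: A_class_def intro!: exI[of _ 0])
  then obtain n :: int where "(SOME x. x \<in> A_class r s) = (r, s + of_int n)"
    by (auto simp: A_class_def)
  then have "\<pi>_AM (A_class r s) = M_class r (2 * s + of_int (2 * n))"
    by (simp add: \<pi>_AM_def algebra_simps)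
  moreover have "(-1::real) powi (2 * n) = 1" by (simp add: power_int_minus_left)
  ultimately show ?thesis using M_class_shift[of "2 * n" r "2 * s"] by simp
qed

lemma F_a_class: "F_a (A_class r s, z) = of_real r * exp (of_real (2 * pi * s) * \<i>) + z\<^sup>2"
proof -
  have "pi * (2 * s) = 2 * pi * s" by simp
  then show ?thesis by (simp only: F_a_def comp_apply map_prod_simp id_apply \<pi>_AM_class F_m_class)
qed

section \<open>M-fibrations over the unit disk\<close>

text \<open>Tubular neighborhoods of circles whose normal bundle is \<open>M \<times> \<complex>\<close> over the core.\<close>

definition tubular_nbhd :: "('a, 'e::euclidean_space) atlas \<Rightarrow> 'a set \<Rightarrow> 'a set \<Rightarrow> bool" where
  "tubular_nbhd X S N \<longleftrightarrow> openin (mtop X) N \<and> S \<subseteq> N \<and>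
     (\<exists>\<Theta>. diffeo (sub X N) MC \<Theta> \<and> \<Theta> ` S = M_core)"

text \<open>A complex chart is a smooth chart of the disk with values in \<open>\<complex>\<close>; it is not required to be
  holomorphic. It is only used around interior points.\<close>

definition complex_chart :: "complex \<Rightarrow> complex set \<Rightarrow> (complex \<Rightarrow> complex) \<Rightarrow> bool" where
  "complex_chart q V \<psi> \<longleftrightarrow> open V \<and> q \<in> V \<and> V \<subseteq> cball 0 1 \<and> open (\<psi> ` V) \<and>
     diffeo (euclid V) (euclid (\<psi> ` V)) \<psi>"

definition M_singularity :: "('a, 'e::euclidean_space) atlas \<Rightarrow> ('a \<Rightarrow> complex) \<Rightarrow> 'a set \<Rightarrow> bool" where
  "M_singularity X f S \<longleftrightarrow> (\<exists>\<gamma>. embedded_circle X \<gamma> \<and> range \<gamma> = S) \<and>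
     (\<exists>q N V \<Phi> \<psi>. f ` S = {q} \<and> tubular_nbhd X S N \<and> diffeo (sub X N) MC \<Phi> \<and> \<Phi> ` S = M_core \<and>
        complex_chart q V \<psi> \<and> f ` N \<subseteq> V \<and> (\<forall>p\<in>N. \<psi> (f p) = F_m (\<Phi> p)))"

definition crit_components :: "('a, 'e::euclidean_space) atlas \<Rightarrow> ('a \<Rightarrow> complex) \<Rightarrow> 'a set set" where
  "crit_components X f = connected_components_of (subtopology (mtop X) (Crit X f))"

definition M_fibration :: "('a, real^4) atlas \<Rightarrow> ('a \<Rightarrow> complex) \<Rightarrow> bool" where
  "M_fibration X f \<longleftrightarrow>
     smooth_manifold X \<and> connected_space (mtop X) \<and> compact_space (mtop X) \<and>
     smooth_map X (euclid (cball 0 1)) f \<and>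
     mboundary X = {p \<in> carr X. cmod (f p) = 1} \<and>
     Crit X f \<inter> mboundary X = {} \<and>
     (\<forall>S\<in>crit_components X f. M_singularity X f S) \<and>
     (\<forall>S\<in>crit_components X f. \<forall>S'\<in>crit_components X f. f ` S = f ` S' \<longrightarrow> S = S')"

text \<open>The normalization of an M-fibration with critical circles \<open>S\<^sub>1, \<dots>, S\<^sub>n\<close>,
  tubular neighborhoods \<open>N\<^sub>k\<close> and chart domains \<open>V\<^sub>k\<close>.\<close>

definition normalized :: "('a, real^4) atlas \<Rightarrow> ('a \<Rightarrow> complex) \<Rightarrow> nat \<Rightarrow> (nat \<Rightarrow> 'a set) \<Rightarrow>
    (nat \<Rightarrow> 'a set) \<Rightarrow> (nat \<Rightarrow> 'a \<Rightarrow> model_pt) \<Rightarrow> (nat \<Rightarrow> complex set) \<Rightarrow>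
    (nat \<Rightarrow> complex \<Rightarrow> complex) \<Rightarrow> bool" where
  "normalized X f n S N \<Phi> V \<psi> \<longleftrightarrow>
     bij_betw S {1..n} (crit_components X f) \<and>
     (\<forall>k\<in>{1..n}. let q = exp (2 * of_real pi * \<i> * of_nat k / of_nat n) / 2 in
        f ` S k = {q} \<and> tubular_nbhd X (S k) (N k) \<and>
        M_core \<subseteq> \<Phi> k ` N k \<and> openin (mtop MC) (\<Phi> k ` N k) \<and>
        diffeo (sub X (N k)) (sub MC (\<Phi> k ` N k)) (\<Phi> k) \<and>
        complex_chart q (V k) (\<psi> k) \<and> \<psi> k q = 0 \<and> f ` N k \<subseteq> V k \<and>
        (\<forall>p\<in>N k. \<psi> k (f p) = F_m (\<Phi> k p)) \<and>
        (\<forall>w\<in>V k. cmod w = - Re (\<psi> k w) + 1 / 2))"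

section \<open>The double covering near a critical circle\<close>

definition lift_nbhd :: "('a, real^4) atlas \<Rightarrow> 'a set \<Rightarrow> ('a, real^4) opoint set" where
  "lift_nbhd X N = {x \<in> carr (orient_cover X). fst x \<in> N}"

definition is_lift :: "('a, real^4) atlas \<Rightarrow> 'a set \<Rightarrow> ('a \<Rightarrow> model_pt) \<Rightarrow>
    (('a, real^4) opoint \<Rightarrow> model_pt) \<Rightarrow> bool" where
  "is_lift X N \<Phi> \<Phi>' \<longleftrightarrow>
     continuous_map (mtop (sub (orient_cover X) (lift_nbhd X N))) (mtop AC) \<Phi>' \<and>
     (\<forall>x\<in>lift_nbhd X N. map_prod \<pi>_AM id (\<Phi>' x) = \<Phi> (fst x))"

text \<open>In the next definitions \<open>N\<close> is the neighborhood upstairs, \<open>\<Phi>\<close> the lifted chart,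
  and \<open>(a, b)\<close> is \<open>(0, 1/2)\<close> or \<open>(1/2, 1)\<close>. The core disk is the descending disk of the critical
  point of the Morse function; the attaching circle is its boundary.\<close>

definition attaching_circle :: "'x set \<Rightarrow> ('x \<Rightarrow> model_pt) \<Rightarrow> real \<Rightarrow> real \<Rightarrow> real \<Rightarrow> 'x set" where
  "attaching_circle N \<Phi> \<epsilon> a b = {p \<in> N. \<exists>x s :: real. a < s \<and> s < b \<and>
     x\<^sup>2 + (cos (2 * pi * s))\<^sup>2 = \<epsilon> \<and> \<Phi> p = (A_class (cos (2 * pi * s)) s, of_real x)}"

definition core_disk :: "'x set \<Rightarrow> ('x \<Rightarrow> model_pt) \<Rightarrow> real \<Rightarrow> real \<Rightarrow> real \<Rightarrow> 'x set" where
  "core_disk N \<Phi> \<epsilon> a b = {p \<in> N. \<exists>x s :: real. a < s \<and> s < b \<and>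
     x\<^sup>2 + (cos (2 * pi * s))\<^sup>2 \<le> \<epsilon> \<and> \<Phi> p = (A_class (cos (2 * pi * s)) s, of_real x)}"

definition handle_centre :: "'x set \<Rightarrow> ('x \<Rightarrow> model_pt) \<Rightarrow> real \<Rightarrow> real \<Rightarrow> 'x" where
  "handle_centre N \<Phi> a b = inv_into N \<Phi> (A_class 0 ((a + b) / 2), 0)"

definition arc :: "real \<Rightarrow> real \<Rightarrow> real \<Rightarrow> (real \<times> real) set set" where
  "arc \<epsilon> a b = {A_class (\<epsilon> * cos (2 * pi * s)) s | s. a \<le> s \<and> s \<le> b}"

text \<open>The preimage of the arc under the double branched covering \<open>F\<^sub>a\<^sup>-\<^sup>1(\<epsilon>) \<rightarrow> A\<close>, seen in the fiber.\<close>

definition standard_curve :: "'x set \<Rightarrow> ('x \<Rightarrow> model_pt) \<Rightarrow> real \<Rightarrow> real \<Rightarrow> real \<Rightarrow> 'x set" where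
  "standard_curve N \<Phi> \<epsilon> a b = {p \<in> N. F_a (\<Phi> p) = of_real \<epsilon> \<and> fst (\<Phi> p) \<in> arc \<epsilon> a b}"

section \<open>Handles and framings\<close>

text \<open>\<open>(Q, \<kappa>)\<close> is a Morse chart at the index-2 critical point \<open>p\<close> of \<open>g\<close>, in which the
  2-handle passing the level \<open>g p\<close> from below has core \<open>D\<close> and attaching circle \<open>C\<close> at
  level \<open>g p - \<epsilon>\<close>.\<close>

definition handle_chart :: "('x, 'e::euclidean_space) atlas \<Rightarrow> ('x \<Rightarrow> real) \<Rightarrow> 'x \<Rightarrow> real \<Rightarrow> 'x set \<Rightarrow>
    'x set \<Rightarrow> 'x set \<Rightarrow> ('x \<Rightarrow> complex \<times> complex) \<Rightarrow> bool" where
  "handle_chart X g p \<epsilon> D C Q \<kappa> \<longleftrightarrow>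
     openin (mtop X) Q \<and> p \<in> Q \<and> \<kappa> p = 0 \<and>
     open (\<kappa> ` Q) \<and> diffeo (sub X Q) (euclid (\<kappa> ` Q)) \<kappa> \<and>
     (\<forall>x\<in>Q. g x = g p - (cmod (fst (\<kappa> x)))\<^sup>2 + (cmod (snd (\<kappa> x)))\<^sup>2) \<and>
     {(u, 0) | u. (cmod u)\<^sup>2 \<le> \<epsilon>} \<subseteq> \<kappa> ` Q \<and>
     D = {x \<in> Q. snd (\<kappa> x) = 0 \<and> (cmod (fst (\<kappa> x)))\<^sup>2 \<le> \<epsilon>} \<and>
     C = {x \<in> Q. snd (\<kappa> x) = 0 \<and> (cmod (fst (\<kappa> x)))\<^sup>2 = \<epsilon>}"

text \<open>The framing of the handle, as the first vector of the constant frame of the cocore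
  directions. In an oriented 3-manifold one normal field determines the framing.\<close>

definition handle_framing ::
  "'x set \<Rightarrow> ('x \<Rightarrow> complex \<times> complex) \<Rightarrow> 'x \<Rightarrow> ('x, 'e::euclidean_space) tvec" where
  "handle_framing Q \<kappa> x = (\<lambda>c. frechet_derivative (snd c \<circ> inv_into Q \<kappa>) (at (\<kappa> x)) (0, 1))"

text \<open>\<open>v\<close> is tangent at \<open>\<gamma> t\<close> to the level set of \<open>g\<close> and is not tangent to the curve \<open>\<gamma>\<close>.\<close>

definition normal_vec :: "('x, 'e::euclidean_space) atlas \<Rightarrow> ('x \<Rightarrow> real) \<Rightarrow> (real \<Rightarrow> 'x) \<Rightarrow> real \<Rightarrow>
    ('x, 'e) tvec \<Rightarrow> bool" where
  "normal_vec X g \<gamma> t v \<longleftrightarrow> tangent_vec X (\<gamma> t) v \<and> in_ker X g (\<gamma> t) v \<and>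
     (\<forall>c\<in>X. \<gamma> t \<in> fst c \<longrightarrow> v c \<notin> span {vector_derivative (snd c \<circ> \<gamma>) (at t)})"

text \<open>The framing \<open>v\<close> of the circle \<open>H\<^sub>0\<close> in the level set of \<open>g\<close>, transported along the isotopy \<open>H\<close>,
  is the fiber framing of \<open>H\<^sub>1\<close>: it is joined through normal fields \<open>W\<^sub>\<tau>\<close> of the circles \<open>H\<^sub>\<tau>\<close>
  to a normal field of \<open>H\<^sub>1\<close> tangent to the fiber of \<open>f\<close>.\<close>

definition transports_to_fiber_framing :: "('x, 'e::euclidean_space) atlas \<Rightarrow> ('x \<Rightarrow> real) \<Rightarrow>
    ('x \<Rightarrow> complex) \<Rightarrow> (real \<Rightarrow> real \<Rightarrow> 'x) \<Rightarrow> ('x \<Rightarrow> ('x, 'e) tvec) \<Rightarrow> bool" where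
  "transports_to_fiber_framing X g f H v \<longleftrightarrow>
     (\<exists>W :: real \<Rightarrow> real \<Rightarrow> ('x, 'e) tvec.
        (\<forall>c\<in>X. continuous_on {(\<tau>, t). \<tau> \<in> {0..1} \<and> H \<tau> t \<in> fst c} (\<lambda>(\<tau>, t). W \<tau> t c)) \<and>
        (\<forall>\<tau>\<in>{0..1}. \<forall>t. normal_vec X g (H \<tau>) t (W \<tau> t) \<and> 
           (\<forall>c\<in>X. H \<tau> t \<in> fst c \<longrightarrow> W \<tau> (t + 1) c = W \<tau> t c)) \<and>
        (\<forall>t. \<forall>c\<in>X. H 0 t \<in> fst c \<longrightarrow> W 0 t c = v (H 0 t) c) \<and>
        (\<forall>t. in_ker X f (H 1 t) (W 1 t)))"

text \<open>The framing of the 2-handle with the given data is well defined, since a handle chart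
  exists, and every handle chart gives a framing that is transported to the fiber framing.\<close>

definition handle_framing_is_fiber_framing :: "('x, 'e::euclidean_space) atlas \<Rightarrow> ('x \<Rightarrow> complex) \<Rightarrow>
    'x \<Rightarrow> real \<Rightarrow> 'x set \<Rightarrow> 'x set \<Rightarrow> (real \<Rightarrow> real \<Rightarrow> 'x) \<Rightarrow> bool" where
  "handle_framing_is_fiber_framing X f p \<epsilon> D C H \<longleftrightarrow>
     (let g = (\<lambda>x. cmod (f x)) in
        (\<exists>Q \<kappa>. handle_chart X g p \<epsilon> D C Q \<kappa>) \<and>
        (\<forall>Q \<kappa>. handle_chart X g p \<epsilon> D C Q \<kappa> \<longrightarrow>
           transports_to_fiber_framing X g f H (handle_framing Q \<kappa>)))"

end

theory Submission
  imports Defs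
begin

text \<open>Everything happens near the core of the lifted tubular neighborhood, where the lifted chart is
  inverted by a map from a tube in the universal covering \<open>\<real>\<^sup>2 \<times> \<complex>\<close> of \<open>A \<times> \<complex>\<close>. The base chart
  has two lifts to the orientation covering, interchanged by the orientation reversing deck
  transformation \<open>(r, s, z) \<mapsto> (- r, s + 1/2, z)\<close>; by connectedness one of them is an inverse.

  In these coordinates both isotopies are given by one explicit family of circles in the level set
  \<open>Re F\<^sub>a = \<epsilon>\<close>, starting at the attaching circle and ending exactly at the standard curve, so
  that the ambient isotopy can be taken constant.

  For the framings, the circles carry a continuous normal frame whose first vector ends tangent to
  the fiber. The framing of an arbitrary handle chart extends without zeros over the core disk,
  hence its coordinates in the normal frame are null-homotopic in the punctured plane: they can be
  contracted along the disk and rotated to the first vector while the circle moves.\<close>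

section \<open>Calculus of smooth functions\<close>

text \<open>The two circles live at different scales: the attaching circle projects to a short arc
  around the handle centre with \<open>r = cos (2 * pi * s)\<close>, the standard curve to an arc
  half way round the annulus with \<open>r = \<epsilon> * cos (2 * pi * s)\<close>. The parameter
  \<open>\<sigma>\<close> of the family governs the length of the arc; at its ends
  \<open>z = 0\<close>, and the level equation there forces the factor
  \<open>\<epsilon> / (4 * \<sigma>\<^sup>2 * (1 - \<sigma>\<^sup>2))\<close> between
  \<open>r\<close> and the cosine. Keeping \<open>z\<close> real all the way would fail, since at
  \<open>\<sigma>\<^sup>2 = 1/2\<close> the curve stops being immersed over the ends. Hence a second
  parameter \<open>\<kappa>\<close>, which turns \<open>z\<close> off the real axis while
  \<open>\<sigma>\<close> grows. The framing cannot be computed from one convenient Morse chart,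
  because the claim quantifies over all handle charts. What they share is that the core disk is
  given by the vanishing of the second coordinate and that the function is quadratic; the former
  makes the cocore vector of the chart transverse to the disk, the latter makes it tangent to the
  level sets.\<close>

lemma Ck_on_cong:
  assumes "open U" "\<And>x. x \<in> U \<Longrightarrow> f x = g x" "Ck_on k f U"
  shows "Ck_on k g U"
  using assms(2,3)
proof (induction k arbitrary: f g)
  case 0
  then show ?case by (auto cong: continuous_on_cong)
next
  case (Suc k)
  have d: "frechet_derivative f (at x) = frechet_derivative g (at x)" if "x \<in> U" for x
  proof (rule frechet_derivative_transform_within_open[OF _ assms(1) that])
    show "f differentiable at x"
      using Suc.prems(2) that assms(1) by (auto simp: differentiable_on_eq_differentiable_at)
    show "\<And>x. x \<in> U \<Longrightarrow> f x = g x" using Suc.prems(1) by auto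
  qed
  have "g differentiable_on U"
    using Suc.prems unfolding differentiable_on_def
    by (metis Ck_on.simps(2) differentiable_on_def differentiable_transform_within zero_less_one)
  moreover have "Ck_on k (\<lambda>x. frechet_derivative g (at x) i) U" if "i \<in> Basis" for i
    by (rule Suc.IH[of "\<lambda>x. frechet_derivative f (at x) i"]) (use d Suc.prems that in auto)
  ultimately show ?case by simp
qed

lemma Ck_on_subset: "Ck_on k f U \<Longrightarrow> V \<subseteq> U \<Longrightarrow> Ck_on k f V"
  by (induction k arbitrary: f) (auto intro: continuous_on_subset differentiable_on_subset)

lemma Ck_on_Suc_imp: "Ck_on (Suc k) f U \<Longrightarrow> Ck_on k f U"
  by (induction k arbitrary: f) (auto intro: differentiable_imp_continuous_on)

lemma Ck_on_SucI:
  assumes "open U" "\<And>x. x \<in> U \<Longrightarrow> (f has_derivative f' x) (at x)"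
    and "\<And>i. i \<in> Basis \<Longrightarrow> Ck_on k (\<lambda>x. f' x i) U"
  shows "Ck_on (Suc k) f U"
proof -
  have "f differentiable_on U"
    using assms(1,2) by (auto simp: differentiable_on_eq_differentiable_at differentiable_def)
  moreover have "Ck_on k (\<lambda>x. frechet_derivative f (at x) i) U" if "i \<in> Basis" for i
    by (rule Ck_on_cong[OF assms(1) _ assms(3)[OF that]])
      (use frechet_derivative_at[OF assms(2)] in auto)
  ultimately show ?thesis by simp
qed

lemma Ck_on_has_derivative:
  assumes "open U" "Ck_on (Suc k) f U" "x \<in> U"
  shows "(f has_derivative frechet_derivative f (at x)) (at x)"
  using assms by (auto simp: differentiable_on_eq_differentiable_at frechet_derivative_works)

lemma Ck_on_const: "open U \<Longrightarrow> Ck_on k (\<lambda>x. c) U"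
proof (induction k arbitrary: c)
  case (Suc k)
  show ?case by (rule Ck_on_SucI[where f' = "\<lambda>x i. 0"]) (use Suc in auto)
qed simp

lemma Ck_on_linear: "open U \<Longrightarrow> bounded_linear f \<Longrightarrow> Ck_on k f U"
proof (cases k)
  case (Suc j)
  assume "open U" "bounded_linear f"
  then show ?thesis unfolding Suc
    by (intro Ck_on_SucI[where f' = "\<lambda>x i. f i"])
      (auto intro: bounded_linear_imp_has_derivative Ck_on_const)
qed (simp add: linear_continuous_on)

lemma Ck_on_compose_linear:
  assumes "bounded_linear L" "open U" "Ck_on k f U"
  shows "Ck_on k (\<lambda>x. L (f x)) U"
  using assms(3)
proof (induction k arbitrary: f)
  case 0
  then show ?case using bounded_linear.continuous_on[OF assms(1)] by auto
next
  case (Suc k)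
  show ?case
  proof (rule Ck_on_SucI[OF assms(2), where f' = "\<lambda>x i. L (frechet_derivative f (at x) i)"])
    show "((\<lambda>x. L (f x)) has_derivative (\<lambda>i. L (frechet_derivative f (at x) i))) (at x)"
      if "x \<in> U" for x
      using bounded_linear.has_derivative[OF assms(1) Ck_on_has_derivative[OF assms(2) Suc.prems that]]
      by simp
  qed (use Suc in auto)
qed

lemma Ck_on_add:
  assumes "open U" "Ck_on k f U" "Ck_on k g U"
  shows "Ck_on k (\<lambda>x. f x + g x) U"
  using assms(2,3)
proof (induction k arbitrary: f g)
  case 0
  then show ?case by (auto intro: continuous_intros)
next
  case (Suc k)
  show ?case
  proof (rule Ck_on_SucI[OF assms(1),
      where f' = "\<lambda>x i. frechet_derivative f (at x) i + frechet_derivative g (at x) i"])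
    show "((\<lambda>x. f x + g x) has_derivative
      (\<lambda>i. frechet_derivative f (at x) i + frechet_derivative g (at x) i)) (at x)" if "x \<in> U" for x
      by (intro has_derivative_add Ck_on_has_derivative[OF assms(1) Suc.prems(1) that]
          Ck_on_has_derivative[OF assms(1) Suc.prems(2) that])
  qed (use Suc in auto)
qed

lemma Ck_on_bilinear:
  assumes "bounded_bilinear p" "open U" "Ck_on k f U" "Ck_on k g U"
  shows "Ck_on k (\<lambda>x. p (f x) (g x)) U"
  using assms(3,4)
proof (induction k arbitrary: f g)
  case 0
  then show ?case using bounded_bilinear.continuous_on[OF assms(1)] by auto
next
  case (Suc k)
  show ?case
  proof (rule Ck_on_SucI[OF assms(2),
      where f' = "\<lambda>x i. p (f x) (frechet_derivative g (at x) i) + p (frechet_derivative f (at x) i) (g x)"])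
    show "((\<lambda>x. p (f x) (g x)) has_derivative
      (\<lambda>i. p (f x) (frechet_derivative g (at x) i) + p (frechet_derivative f (at x) i) (g x))) (at x)"
      if "x \<in> U" for x
      by (intro bounded_bilinear.FDERIV[OF assms(1)] Ck_on_has_derivative[OF assms(2) Suc.prems(1) that]
          Ck_on_has_derivative[OF assms(2) Suc.prems(2) that])
    show "Ck_on k (\<lambda>x. p (f x) (frechet_derivative g (at x) i) + p (frechet_derivative f (at x) i) (g x)) U"
      if "i \<in> Basis" for i
      by (intro Ck_on_add[OF assms(2)] Suc.IH) (use Suc.prems Ck_on_Suc_imp that in auto)
  qed
qed

lemma Ck_on_sum:
  assumes "open U" "finite A" "\<And>a. a \<in> A \<Longrightarrow> Ck_on k (f a) U"
  shows "Ck_on k (\<lambda>x. \<Sum>a\<in>A. f a x) U"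
  using assms(2,3) by (induction A rule: finite_induct) (auto intro: Ck_on_const Ck_on_add assms(1))

lemma linear_Basis_expansion:
  fixes L :: "'a::euclidean_space \<Rightarrow> 'b::real_vector"
  assumes "linear L"
  shows "L v = (\<Sum>j\<in>Basis. (v \<bullet> j) *\<^sub>R L j)"
proof -
  have "L v = L (\<Sum>j\<in>Basis. (v \<bullet> j) *\<^sub>R j)" by (simp add: euclidean_representation)
  then show ?thesis by (simp add: linear_sum[OF assms] linear_cmul[OF assms])
qed

text \<open>Induction on the order with \<open>g\<close> varying: a partial derivative of the
  composite is a finite sum of products of a partial derivative of \<open>f\<close> with a partial
  derivative of \<open>g\<close> after \<open>f\<close>, and the latter is again a composite of the
  same kind.\<close>

lemma Ck_on_compose:
  assumes "open U" "open V" "f ` U \<subseteq> V" "Ck_on k f U" "Ck_on k g V"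
  shows "Ck_on k (\<lambda>x. g (f x)) U"
  using assms(4,5)
proof (induction k arbitrary: g)
  case 0
  then show ?case using continuous_on_compose2[of V g U f] assms(3) by auto
next
  case (Suc k)
  let ?f' = "\<lambda>x. frechet_derivative f (at x)" and ?g' = "\<lambda>y. frechet_derivative g (at y)"
  show ?case
  proof (rule Ck_on_SucI[OF assms(1), where f' = "\<lambda>x i. \<Sum>j\<in>Basis. (?f' x i \<bullet> j) *\<^sub>R ?g' (f x) j"])
    fix x assume x: "x \<in> U"
    have g: "(g has_derivative ?g' (f x)) (at (f x))"
      using Ck_on_has_derivative[OF assms(2) Suc.prems(2)] x assms(3) by auto
    have "((\<lambda>x. g (f x)) has_derivative (\<lambda>i. ?g' (f x) (?f' x i))) (at x)"
      using diff_chain_at[OF Ck_on_has_derivative[OF assms(1) Suc.prems(1) x] g] by (simp add: o_def)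
    moreover have "(\<lambda>i. ?g' (f x) (?f' x i)) = (\<lambda>i. \<Sum>j\<in>Basis. (?f' x i \<bullet> j) *\<^sub>R ?g' (f x) j)"
      by (rule ext) (rule linear_Basis_expansion[OF has_derivative_linear[OF g]])
    ultimately show "((\<lambda>x. g (f x)) has_derivative (\<lambda>i. \<Sum>j\<in>Basis. (?f' x i \<bullet> j) *\<^sub>R ?g' (f x) j)) (at x)"
      by (simp only:)
  next
    fix i :: 'a assume i: "i \<in> Basis"
    show "Ck_on k (\<lambda>x. \<Sum>j\<in>Basis. (?f' x i \<bullet> j) *\<^sub>R ?g' (f x) j) U"
    proof (rule Ck_on_sum[OF assms(1) finite_Basis])
      fix j :: 'b assume j: "j \<in> Basis"
      have 1: "Ck_on k (\<lambda>x. ?f' x i \<bullet> j) U"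
        by (rule Ck_on_compose_linear[OF bounded_linear_inner_left assms(1)]) (use Suc.prems i in auto)
      have 2: "Ck_on k (\<lambda>x. ?g' (f x) j) U"
        using Suc.IH[OF Ck_on_Suc_imp[OF Suc.prems(1)], of "\<lambda>y. ?g' y j"] Suc.prems(2) j by simp
      show "Ck_on k (\<lambda>x. (?f' x i \<bullet> j) *\<^sub>R ?g' (f x) j) U"
        by (rule Ck_on_bilinear[OF bounded_bilinear_scaleR assms(1) 1 2])
    qed
  qed
qed

text \<open>One neighbourhood serves all orders, as in \<open>smooth_on\<close>. The property is
  therefore open, so smoothness statements can be combined with other eventual statements in
  \<open>nhds x\<close>.\<close>

definition smooth_at :: "('a::euclidean_space \<Rightarrow> 'b::euclidean_space) \<Rightarrow> 'a \<Rightarrow> bool" where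
  "smooth_at f x \<longleftrightarrow> (\<exists>U. open U \<and> x \<in> U \<and> (\<forall>k. Ck_on k f U))"

lemma smooth_at_differentiable:
  assumes "smooth_at f x" shows "f differentiable at x"
proof -
  obtain U where "open U" "x \<in> U" "Ck_on (Suc 0) f U"
    using assms unfolding smooth_at_def by blast
  then show ?thesis by (auto simp: differentiable_on_eq_differentiable_at)
qed

lemma smooth_at_has_derivative:
  "smooth_at f x \<Longrightarrow> (f has_derivative frechet_derivative f (at x)) (at x)"
  using smooth_at_differentiable frechet_derivative_works by blast

lemma smooth_at_continuous: "smooth_at f x \<Longrightarrow> isCont f x"
  using smooth_at_differentiable differentiable_imp_continuous_within by blast

lemma smooth_at_eventually:
  assumes "smooth_at f x" shows "\<forall>\<^sub>F y in nhds x. smooth_at f y"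
  using assms unfolding smooth_at_def eventually_nhds by blast

lemma smooth_at_cong:
  assumes "smooth_at f x" "\<forall>\<^sub>F y in nhds x. f y = g y" shows "smooth_at g x"
proof -
  obtain U where U: "open U" "x \<in> U" "\<And>k. Ck_on k f U" using assms(1) unfolding smooth_at_def by blast
  obtain V where V: "open V" "x \<in> V" "\<And>y. y \<in> V \<Longrightarrow> f y = g y"
    using assms(2) unfolding eventually_nhds by blast
  have "Ck_on k g (U \<inter> V)" for k
    by (rule Ck_on_cong[of _ f]) (use U V Ck_on_subset[of k f U "U \<inter> V"] in auto)
  then show ?thesis unfolding smooth_at_def using U V by (intro exI[of _ "U \<inter> V"]) auto
qed

lemma smooth_at_const [intro]: "smooth_at (\<lambda>x. c) x"
  unfolding smooth_at_def using Ck_on_const by blast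

lemma smooth_at_linear: "bounded_linear f \<Longrightarrow> smooth_at f x"
  unfolding smooth_at_def using Ck_on_linear by blast

lemma smooth_at_id [intro]: "smooth_at (\<lambda>x. x) x"
  by (rule smooth_at_linear) (rule bounded_linear_ident)

lemma smooth_at_compose:
  assumes "smooth_at f x" "smooth_at g (f x)"
  shows "smooth_at (\<lambda>x. g (f x)) x"
proof -
  obtain U where U: "open U" "x \<in> U" "\<And>k. Ck_on k f U" using assms(1) unfolding smooth_at_def by blast
  obtain V where V: "open V" "f x \<in> V" "\<And>k. Ck_on k g V" using assms(2) unfolding smooth_at_def by blast
  let ?W = "U \<inter> f -` V"
  have W: "open ?W" using U V by (metis Ck_on.simps(1) Int_commute continuous_open_preimage)
  have "Ck_on k (\<lambda>x. g (f x)) ?W" for k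
    by (rule Ck_on_compose[OF W V(1)]) (use U V Ck_on_subset[of k f U ?W] in auto)
  then show ?thesis unfolding smooth_at_def using U V W by (intro exI[of _ ?W]) auto
qed

lemma smooth_at_compose_linear:
  "bounded_linear L \<Longrightarrow> smooth_at f x \<Longrightarrow> smooth_at (\<lambda>x. L (f x)) x"
  by (rule smooth_at_compose) (auto intro: smooth_at_linear)

lemma smooth_at_add:
  assumes "smooth_at f x" "smooth_at g x" shows "smooth_at (\<lambda>x. f x + g x) x"
proof -
  obtain U where U: "open U" "x \<in> U" "\<And>k. Ck_on k f U" using assms(1) unfolding smooth_at_def by blast
  obtain V where V: "open V" "x \<in> V" "\<And>k. Ck_on k g V" using assms(2) unfolding smooth_at_def by blast
  have "Ck_on k (\<lambda>x. f x + g x) (U \<inter> V)" for k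
    by (rule Ck_on_add) (use U V Ck_on_subset[of k f U "U \<inter> V"] Ck_on_subset[of k g V "U \<inter> V"] in auto)
  then show ?thesis unfolding smooth_at_def using U V by (intro exI[of _ "U \<inter> V"]) auto
qed

lemma smooth_at_bilinear:
  assumes "bounded_bilinear p" "smooth_at f x" "smooth_at g x" shows "smooth_at (\<lambda>x. p (f x) (g x)) x"
proof -
  obtain U where U: "open U" "x \<in> U" "\<And>k. Ck_on k f U" using assms(2) unfolding smooth_at_def by blast
  obtain V where V: "open V" "x \<in> V" "\<And>k. Ck_on k g V" using assms(3) unfolding smooth_at_def by blast
  have "Ck_on k (\<lambda>x. p (f x) (g x)) (U \<inter> V)" for k
    by (rule Ck_on_bilinear[OF assms(1)])
      (use U V Ck_on_subset[of k f U "U \<inter> V"] Ck_on_subset[of k g V "U \<inter> V"] in auto)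
  then show ?thesis unfolding smooth_at_def using U V by (intro exI[of _ "U \<inter> V"]) auto
qed

lemmas smooth_at_fst = smooth_at_compose_linear[OF bounded_linear_fst]
lemmas smooth_at_snd = smooth_at_compose_linear[OF bounded_linear_snd]
lemmas smooth_at_Re = smooth_at_compose_linear[OF bounded_linear_Re]
lemmas smooth_at_Im = smooth_at_compose_linear[OF bounded_linear_Im]
lemmas smooth_at_uminus = smooth_at_compose_linear[OF bounded_linear_minus[OF bounded_linear_ident]]
lemmas smooth_at_of_real = smooth_at_compose_linear[OF bounded_linear_of_real]
lemmas smooth_at_mult = smooth_at_bilinear[OF bounded_bilinear_mult]

lemma smooth_at_diff:
  "smooth_at f x \<Longrightarrow> smooth_at g x \<Longrightarrow> smooth_at (\<lambda>x. f x - g x) x"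
  using smooth_at_add[OF _ smooth_at_uminus] by fastforce

lemma smooth_at_Pair:
  assumes "smooth_at f x" "smooth_at g x" shows "smooth_at (\<lambda>x. (f x, g x)) x"
proof -
  have 1: "bounded_linear (\<lambda>a::'b. (a, 0::'c))" and 2: "bounded_linear (\<lambda>b::'c. (0::'b, b))"
    by (auto intro!: bounded_linear_Pair bounded_linear_ident bounded_linear_zero)
  show ?thesis
    using smooth_at_add[OF smooth_at_compose_linear[OF 1 assms(1)] smooth_at_compose_linear[OF 2 assms(2)]]
    by simp
qed

lemma smooth_at_Complex:
  assumes "smooth_at f x" "smooth_at g x" shows "smooth_at (\<lambda>x. Complex (f x) (g x)) x"
  using smooth_at_add[OF smooth_at_of_real[OF assms(1)]
      smooth_at_mult[OF smooth_at_const[of \<i>] smooth_at_of_real[OF assms(2)]]]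
  by (simp add: Complex_eq)

lemma smooth_at_power:
  fixes f :: "'a::euclidean_space \<Rightarrow> 'b::{euclidean_space,real_normed_algebra_1}"
  assumes "smooth_at f x" shows "smooth_at (\<lambda>x. f x ^ n) x"
  by (induction n) (auto intro: smooth_at_mult assms)

lemma Ck_on_real_SucI:
  fixes f :: "real \<Rightarrow> real"
  assumes "open U" "\<And>x. x \<in> U \<Longrightarrow> (f has_real_derivative f' x) (at x)" "Ck_on k f' U"
  shows "Ck_on (Suc k) f U"
  by (rule Ck_on_SucI[where f' = "\<lambda>x i. f' x * i"])
    (use assms in \<open>auto simp: has_field_derivative_def\<close>)

lemma Ck_on_sin_cos: "Ck_on k sin (UNIV::real set) \<and> Ck_on k cos (UNIV::real set)"
proof (induction k)
  case 0
  show ?case by (auto intro: continuous_intros)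
next
  case (Suc k)
  have "Ck_on k (\<lambda>x::real. - sin x) UNIV"
    by (rule Ck_on_compose_linear[OF bounded_linear_minus[OF bounded_linear_ident]]) (use Suc in auto)
  then show ?case
    by (intro conjI Ck_on_real_SucI[of _ sin cos] Ck_on_real_SucI[of _ cos "\<lambda>x. - sin x"])
      (use Suc in \<open>auto intro!: derivative_eq_intros\<close>)
qed

lemma Ck_on_inverse: "Ck_on k inverse (- {0::real})"
proof (induction k)
  case 0
  show ?case by (auto intro!: continuous_intros)
next
  case (Suc k)
  have "Ck_on k (\<lambda>x::real. - (inverse x * inverse x)) (- {0})"
    by (intro Ck_on_compose_linear[OF bounded_linear_minus[OF bounded_linear_ident]]
        Ck_on_bilinear[OF bounded_bilinear_mult] Suc) auto
  then show ?case
    by (intro Ck_on_real_SucI[of _ _ "\<lambda>x. - (inverse x * inverse x)"])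
      (auto intro!: derivative_eq_intros)
qed

lemma Ck_on_sqrt: "Ck_on k sqrt {0<..}"
proof (induction k)
  case 0
  show ?case by (auto intro!: continuous_intros)
next
  case (Suc k)
  have "Ck_on k (\<lambda>x. inverse (sqrt x)) {0<..}"
    by (rule Ck_on_compose[OF _ _ _ Suc Ck_on_inverse]) auto
  then have "Ck_on k (\<lambda>x. (1/2) * inverse (sqrt x)) {0<..}"
    by (intro Ck_on_bilinear[OF bounded_bilinear_mult] Ck_on_const) auto
  then show ?case
    by (intro Ck_on_real_SucI[of _ _ "\<lambda>x. (1/2) * inverse (sqrt x)"])
      (auto intro!: derivative_eq_intros)
qed

lemma smooth_at_sin: "smooth_at f x \<Longrightarrow> smooth_at (\<lambda>x. sin (f x :: real)) x"
  and smooth_at_cos: "smooth_at f x \<Longrightarrow> smooth_at (\<lambda>x. cos (f x :: real)) x"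
proof -
  have "smooth_at sin (f x)" "smooth_at cos (f x)"
    unfolding smooth_at_def using Ck_on_sin_cos by blast+
  then show "smooth_at f x \<Longrightarrow> smooth_at (\<lambda>x. sin (f x)) x"
    "smooth_at f x \<Longrightarrow> smooth_at (\<lambda>x. cos (f x)) x"
    by (auto intro: smooth_at_compose)
qed

lemma smooth_at_inverse:
  assumes "smooth_at f x" "f x \<noteq> 0" shows "smooth_at (\<lambda>x. inverse (f x :: real)) x"
proof (rule smooth_at_compose[OF assms(1)])
  show "smooth_at inverse (f x)" unfolding smooth_at_def
    using Ck_on_inverse assms(2) by (intro exI[of _ "- {0}"]) auto
qed

lemma smooth_at_divide:
  "smooth_at f x \<Longrightarrow> smooth_at g x \<Longrightarrow> g x \<noteq> 0 \<Longrightarrow> smooth_at (\<lambda>x. f x / g x :: real) x"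
  using smooth_at_mult[OF _ smooth_at_inverse, of f x g] by (simp add: field_class.field_divide_inverse)

lemma smooth_at_sqrt:
  assumes "smooth_at f x" "f x > 0" shows "smooth_at (\<lambda>x. sqrt (f x)) x"
proof (rule smooth_at_compose[OF assms(1)])
  show "smooth_at sqrt (f x)" unfolding smooth_at_def
    using Ck_on_sqrt assms(2) by (intro exI[of _ "{0<..}"]) auto
qed

lemma power2_less_1: "- 1 < x \<Longrightarrow> x < 1 \<Longrightarrow> x\<^sup>2 < (1::real)"
  by (simp add: abs_square_less_1 abs_less_iff)

lemma Ck_on_arcsin: "Ck_on k arcsin {-1<..<1}"
proof (cases k)
  case 0
  then show ?thesis by (auto intro!: continuous_intros)
next
  case (Suc j)
  have "Ck_on j (\<lambda>x::real. 1 - x\<^sup>2) {-1<..<1}"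
    using Ck_on_add[OF _ Ck_on_const Ck_on_compose_linear[OF bounded_linear_minus[OF bounded_linear_ident] _
      Ck_on_bilinear[OF bounded_bilinear_mult _ Ck_on_linear[OF _ bounded_linear_ident] Ck_on_linear[OF _ bounded_linear_ident]]],
      of "{-1<..<1::real}" j 1]
    by (simp add: power2_eq_square)
  then have "Ck_on j (\<lambda>x. sqrt (1 - x\<^sup>2)) {-1<..<1}"
    by (rule Ck_on_compose[rotated 3, OF _ Ck_on_sqrt]) (auto simp: power2_less_1)
  then have "Ck_on j (\<lambda>x. inverse (sqrt (1 - x\<^sup>2))) {-1<..<1}"
    by (rule Ck_on_compose[rotated 3, OF _ Ck_on_inverse])
       (auto simp: power2_less_1, smt (verit) power2_less_1)
  then show ?thesis unfolding Suc
    by (intro Ck_on_real_SucI[of _ _ "\<lambda>x. inverse (sqrt (1 - x\<^sup>2))"])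
      (auto intro!: derivative_eq_intros)
qed

lemma smooth_at_arcsin:
  assumes "smooth_at f x" "\<bar>f x\<bar> < 1" shows "smooth_at (\<lambda>x. arcsin (f x)) x"
proof (rule smooth_at_compose[OF assms(1)])
  show "smooth_at arcsin (f x)" unfolding smooth_at_def
    using Ck_on_arcsin assms(2) by (intro exI[of _ "{-1<..<1}"]) (auto simp: abs_less_iff)
qed

lemmas smooth_at_intros = smooth_at_const smooth_at_id smooth_at_add smooth_at_diff smooth_at_uminus
  smooth_at_mult smooth_at_power smooth_at_fst smooth_at_snd smooth_at_Re smooth_at_Im smooth_at_Pair
  smooth_at_Complex smooth_at_of_real smooth_at_sin smooth_at_cos smooth_at_divide smooth_at_sqrt smooth_at_arcsin

text \<open>Base point and vector may vary together. Where \<open>h x\<close> stays in the domain of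
  smoothness the derivative is linear in the vector, and expanding the vector in the basis leaves
  finitely many continuous partial derivatives. The expansion is only an eventual equality, hence
  the passage to a limit of an eventually equal function.\<close>

lemma smooth_at_continuous_derivative:
  assumes f: "smooth_at f (h p)" and h: "continuous (at p within S) h" and v: "continuous (at p within S) v"
  shows "continuous (at p within S) (\<lambda>p. frechet_derivative f (at (h p)) (v p))"
proof -
  let ?D = "\<lambda>x. frechet_derivative f (at x)"
  obtain U where U: "open U" "h p \<in> U" "\<And>k. Ck_on k f U" using f unfolding smooth_at_def by blast
  have D: "continuous (at p within S) (\<lambda>p. ?D (h p) j)" if "j \<in> Basis" for j
  proof -
    have "continuous_on U (\<lambda>x. ?D x j)" using U(3)[of "Suc 0"] that by simp
    then have "isCont (\<lambda>x. ?D x j) (h p)" using U by (simp add: continuous_on_eq_continuous_at)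
    then show ?thesis
      using continuous_within_compose3 h by blast
  qed
  have lin: "linear (?D x)" if "x \<in> U" for x
    using Ck_on_has_derivative[OF U(1) U(3) that] has_derivative_linear by blast
  have E: "(\<Sum>j\<in>Basis. (v x \<bullet> j) *\<^sub>R ?D (h x) j) = ?D (h x) (v x)" if "h x \<in> U" for x
    by (rule linear_Basis_expansion[OF lin[OF that], symmetric])
  have "continuous (at p within S) (\<lambda>p. \<Sum>j\<in>Basis. (v p \<bullet> j) *\<^sub>R ?D (h p) j)"
    by (intro continuous_intros D v)
  then have "((\<lambda>p. \<Sum>j\<in>Basis. (v p \<bullet> j) *\<^sub>R ?D (h p) j) \<longlongrightarrow> ?D (h p) (v p)) (at p within S)"
    unfolding continuous_within E[OF U(2)] .
  moreover have "\<forall>\<^sub>F x in at p within S. h x \<in> U"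
    using h U(1,2) unfolding continuous_within by (rule topological_tendstoD)
  then have "\<forall>\<^sub>F x in at p within S. (\<Sum>j\<in>Basis. (v x \<bullet> j) *\<^sub>R ?D (h x) j) = ?D (h x) (v x)"
    by eventually_elim (rule E)
  ultimately show ?thesis
    unfolding continuous_within by (rule Lim_transform_eventually)
qed

lemma smooth_on_iff:
  "smooth_on S f \<longleftrightarrow> (\<forall>x\<in>S. \<exists>g. smooth_at g x \<and> (\<forall>\<^sub>F y in nhds x. y \<in> S \<longrightarrow> g y = f y))"
proof (intro iffI ballI)
  fix x assume "smooth_on S f" "x \<in> S"
  then obtain U g where "open U" "x \<in> U" "\<forall>k. Ck_on k g U" "\<forall>y\<in>S \<inter> U. g y = f y"
    unfolding smooth_on_def by blast
  then show "\<exists>g. smooth_at g x \<and> (\<forall>\<^sub>F y in nhds x. y \<in> S \<longrightarrow> g y = f y)"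
    unfolding smooth_at_def eventually_nhds by blast
next
  assume A: "\<forall>x\<in>S. \<exists>g. smooth_at g x \<and> (\<forall>\<^sub>F y in nhds x. y \<in> S \<longrightarrow> g y = f y)"
  show "smooth_on S f" unfolding smooth_on_def
  proof
    fix x assume "x \<in> S"
    then obtain g U V where g: "open U" "x \<in> U" "\<And>k. Ck_on k g U"
      and V: "open V" "x \<in> V" "\<forall>y\<in>V. y \<in> S \<longrightarrow> g y = f y"
      using A unfolding smooth_at_def eventually_nhds by meson
    have "Ck_on k g (U \<inter> V)" for k by (rule Ck_on_subset[OF g(3)]) auto
    then show "\<exists>U g. open U \<and> x \<in> U \<and> (\<forall>k. Ck_on k g U) \<and> (\<forall>y\<in>S \<inter> U. g y = f y)"
      using g V by (intro exI[of _ "U \<inter> V"] exI[of _ g]) auto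
  qed
qed

lemma smooth_on_smooth_at:
  assumes "smooth_on S f" "x \<in> interior S" shows "smooth_at f x"
proof -
  obtain g where g: "smooth_at g x" "\<forall>\<^sub>F y in nhds x. y \<in> S \<longrightarrow> g y = f y"
    using assms interior_subset unfolding smooth_on_iff by blast
  have "\<forall>\<^sub>F y in nhds x. y \<in> S" using assms(2) by (simp add: eventually_nhds_in_nhd)
  with g(2) have "\<forall>\<^sub>F y in nhds x. g y = f y" by eventually_elim simp
  with g(1) show ?thesis by (rule smooth_at_cong)
qed

section \<open>Local parametrizations of manifolds\<close>

lemma eventually_isCont_compose:
  assumes "isCont f x" "eventually P (nhds (f x))"
  shows "\<forall>\<^sub>F y in nhds x. P (f y)"
proof -
  have "filterlim f (nhds (f x)) (nhds x)"
    using assms(1) unfolding isCont_def by (simp add: tendsto_at_iff_tendsto_nhds)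
  then show ?thesis by (rule eventually_compose_filterlim[OF assms(2)])
qed

lemma open_nhdsI: "(\<And>x. x \<in> S \<Longrightarrow> \<forall>\<^sub>F y in nhds x. y \<in> S) \<Longrightarrow> open S"
  by (subst open_subopen) (metis eventually_nhds subsetI)

lemma interior_nhdsI:
  assumes "\<forall>\<^sub>F y in nhds x. y \<in> S" shows "x \<in> interior S"
  using assms unfolding eventually_nhds by (auto intro: interiorI)

lemma frechet_derivative_chain:
  assumes "f differentiable at x" "g differentiable at (f x)"
  shows "frechet_derivative (\<lambda>x. g (f x)) (at x) v = frechet_derivative g (at (f x)) (frechet_derivative f (at x) v)"
  using fun_cong[OF frechet_derivative_compose[OF assms], of v] by (simp add: o_def)

lemma has_derivative_cong_nhds:
  assumes "(f has_derivative D) (at x)" "\<forall>\<^sub>F y in nhds x. f y = g y"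
  shows "(g has_derivative D) (at x)"
proof (rule has_derivative_transform_eventually[OF assms(1)])
  show "\<forall>\<^sub>F y in at x. f y = g y"
    unfolding eventually_at_filter using assms(2) by eventually_elim simp
qed (use eventually_nhds_x_imp_x[OF assms(2)] in auto)

lemma frechet_derivative_cong_nhds:
  assumes "f differentiable at x" "\<forall>\<^sub>F y in nhds x. f y = g y"
  shows "g differentiable at x" "frechet_derivative g (at x) = frechet_derivative f (at x)"
proof -
  have "(g has_derivative frechet_derivative f (at x)) (at x)"
    by (rule has_derivative_cong_nhds[OF _ assms(2)]) (use assms(1) frechet_derivative_works in blast)
  then show "g differentiable at x" "frechet_derivative g (at x) = frechet_derivative f (at x)"
    by (auto simp: differentiable_def dest: frechet_derivative_at)
qed

lemma frechet_derivative_inverse_id: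
  assumes "f differentiable at x" "g differentiable at (f x)" "\<forall>\<^sub>F y in nhds x. g (f y) = y"
  shows "frechet_derivative g (at (f x)) (frechet_derivative f (at x) v) = v"
proof -
  have "((\<lambda>y. g (f y)) has_derivative (\<lambda>v. v)) (at x)"
    by (rule has_derivative_cong_nhds[OF has_derivative_ident]) (use assms(3) in \<open>auto elim: eventually_mono\<close>)
  then have "frechet_derivative (\<lambda>y. g (f y)) (at x) = (\<lambda>v. v)"
    by (metis frechet_derivative_at)
  then show ?thesis using frechet_derivative_chain[OF assms(1,2)] by metis
qed

text \<open>\<open>G\<close> is only known to undo \<open>\<phi>\<close> on values of
  \<open>\<phi>\<close>. Injectivity and invariance of domain, where the dimension bound enters,
  make the image of a neighbourhood of \<open>q\<close> open; so all points near
  \<open>\<phi> q\<close> are such values and \<open>G\<close> is a right inverse as well.\<close>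

lemma eventually_local_homeomorphism:
  fixes \<phi> :: "'f::euclidean_space \<Rightarrow> 'e::euclidean_space"
  assumes dim: "DIM('e) \<le> DIM('f)" and "smooth_at \<phi> q"
    and "\<forall>\<^sub>F q' in nhds q. G (\<phi> q') = q'" "\<forall>\<^sub>F q' in nhds q. P q'"
  shows "\<forall>\<^sub>F y in nhds (\<phi> q). P (G y) \<and> \<phi> (G y) = y"
proof -
  have "\<forall>\<^sub>F q' in nhds q. smooth_at \<phi> q' \<and> G (\<phi> q') = q' \<and> P q'"
    using smooth_at_eventually[OF assms(2)] assms(3,4) by eventually_elim simp
  then obtain U where U: "open U" "q \<in> U" "\<And>q'. q' \<in> U \<Longrightarrow> smooth_at \<phi> q' \<and> G (\<phi> q') = q' \<and> P q'"
    unfolding eventually_nhds by blast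
  have "open (\<phi> ` U)"
  proof (rule invariance_of_domain_gen[OF U(1) _ _ dim])
    show "continuous_on U \<phi>" using U(3) smooth_at_continuous by (blast intro: continuous_at_imp_continuous_on)
    show "inj_on \<phi> U" using U(3) by (metis inj_onI)
  qed
  moreover have "P (G y) \<and> \<phi> (G y) = y" if "y \<in> \<phi> ` U" for y using U(3) that by auto
  ultimately show ?thesis unfolding eventually_nhds using U(2) by blast
qed

text \<open>Pointwise form of openness, suited to eventual arguments. Conversely, the open set
  required by \<open>openin_mtop\<close> is the union of all open sets whose preimage under the
  chart lies in \<open>W\<close>.\<close>

lemma openin_mtop_iff:
  fixes X :: "('a, 'e::euclidean_space) atlas"
  shows "openin (mtop X) W \<longleftrightarrow> W \<subseteq> carr X \<and>
     (\<forall>c\<in>X. \<forall>p\<in>W \<inter> fst c. \<forall>\<^sub>F y in nhds (snd c p). \<forall>p'\<in>fst c. snd c p' = y \<longrightarrow> p' \<in> W)"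
proof -
  have "(\<exists>T. open T \<and> W \<inter> fst c = fst c \<inter> snd c -` T) \<longleftrightarrow>
    (\<forall>p\<in>W \<inter> fst c. \<forall>\<^sub>F y in nhds (snd c p). \<forall>p'\<in>fst c. snd c p' = y \<longrightarrow> p' \<in> W)" (is "?L \<longleftrightarrow> ?R")
    for c :: "('a, 'e) chart"
  proof
    assume ?L
    then obtain T where T: "open T" "W \<inter> fst c = fst c \<inter> snd c -` T" by blast
    show ?R
    proof
      fix p assume "p \<in> W \<inter> fst c"
      then show "\<forall>\<^sub>F y in nhds (snd c p). \<forall>p'\<in>fst c. snd c p' = y \<longrightarrow> p' \<in> W"
        unfolding eventually_nhds using T by (intro exI[of _ T]) blast
    qed
  next
    assume R: ?R
    let ?T = "\<Union>{T. open T \<and> (\<forall>y\<in>T. \<forall>p'\<in>fst c. snd c p' = y \<longrightarrow> p' \<in> W)}"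
    have "W \<inter> fst c = fst c \<inter> snd c -` ?T"
      using R unfolding eventually_nhds by blast
    then show ?L by (intro exI[of _ ?T]) auto
  qed
  then show ?thesis unfolding openin_mtop by simp
qed

lemma topspace_mtop: "topspace (mtop X) = carr X"
proof -
  have "openin (mtop X) (carr X)"
    unfolding openin_mtop_iff by (auto simp: carr_def intro!: always_eventually)
  moreover have "topspace (mtop X) \<subseteq> carr X"
    using openin_topspace[of "mtop X"] unfolding openin_mtop_iff by simp
  ultimately show ?thesis using openin_subset by blast
qed

lemma carr_euclid [simp]: "carr (euclid S) = S"
  by (simp add: carr_def euclid_def)

lemma carr_sub: "carr (sub X N) = carr X \<inter> N"
  by (auto simp: carr_def sub_def)

lemma openin_mtop_sub: "openin (mtop X) W \<Longrightarrow> W \<subseteq> N \<Longrightarrow> openin (mtop (sub X N)) W"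
  unfolding openin_mtop_iff carr_sub by (fastforce simp: sub_def elim: eventually_mono)

lemma openin_mtop_euclid:
  "openin (mtop (euclid S)) W \<longleftrightarrow> W \<subseteq> S \<and> (\<forall>x\<in>W. \<forall>\<^sub>F y in nhds x. y \<in> S \<longrightarrow> y \<in> W)"
  unfolding openin_mtop_iff by (auto simp: euclid_def carr_def)

lemma in_chart_apply: "inj_on (snd c) (fst c) \<Longrightarrow> p \<in> fst c \<Longrightarrow> in_chart c g (snd c p) = g p"
  by (simp add: in_chart_def)

text \<open>A smooth left inverse in each chart makes \<open>J\<close> a local diffeomorphism: by invariance of domain
  it is open, so no chart is required to be open or to avoid the boundary.\<close>

locale local_param =
  fixes X :: "('a, 'e::euclidean_space) atlas" and B :: "'f::euclidean_space set" and J :: "'f \<Rightarrow> 'a"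
  assumes open_B: "open B"
    and J_carr: "q \<in> B \<Longrightarrow> J q \<in> carr X"
    and chart_inj: "c \<in> X \<Longrightarrow> inj_on (snd c) (fst c)"
    and dim_le: "DIM('e) \<le> DIM('f)"
    and chart_near: "c \<in> X \<Longrightarrow> q \<in> B \<Longrightarrow> J q \<in> fst c \<Longrightarrow> \<forall>\<^sub>F q' in nhds q. J q' \<in> fst c"
    and smooth_J: "c \<in> X \<Longrightarrow> q \<in> B \<Longrightarrow> J q \<in> fst c \<Longrightarrow> smooth_at (\<lambda>q. snd c (J q)) q"
    and left_inverse: "c \<in> X \<Longrightarrow> q \<in> B \<Longrightarrow> J q \<in> fst c \<Longrightarrow>
      \<exists>G. smooth_at G (snd c (J q)) \<and> (\<forall>\<^sub>F q' in nhds q. G (snd c (J q')) = q')"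
begin

lemma eventually_B: "q \<in> B \<Longrightarrow> \<forall>\<^sub>F q' in nhds q. q' \<in> B"
  using open_B by (auto simp: eventually_nhds)

lemma obtain_chart:
  assumes "q \<in> B" obtains c where "c \<in> X" "J q \<in> fst c"
  using J_carr[OF assms] by (auto simp: carr_def)

lemma local_inverse:
  assumes "c \<in> X" "q \<in> B" "J q \<in> fst c"
  obtains G where "smooth_at G (snd c (J q))" "\<forall>\<^sub>F q' in nhds q. G (snd c (J q')) = q'"
    "\<And>P. \<forall>\<^sub>F q' in nhds q. P q' \<Longrightarrow>
      \<forall>\<^sub>F y in nhds (snd c (J q)). P (G y) \<and> G y \<in> B \<and> J (G y) \<in> fst c \<and> snd c (J (G y)) = y"
proof -
  obtain G where G: "smooth_at G (snd c (J q))" "\<forall>\<^sub>F q' in nhds q. G (snd c (J q')) = q'"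
    using left_inverse[OF assms] by blast
  have "\<forall>\<^sub>F y in nhds (snd c (J q)). P (G y) \<and> G y \<in> B \<and> J (G y) \<in> fst c \<and> snd c (J (G y)) = y"
    if P: "\<forall>\<^sub>F q' in nhds q. P q'" for P
  proof -
    have "\<forall>\<^sub>F q' in nhds q. P q' \<and> q' \<in> B \<and> J q' \<in> fst c"
      using P eventually_B[OF assms(2)] chart_near[OF assms] by eventually_elim simp
    from eventually_local_homeomorphism[OF dim_le smooth_J[OF assms] G(2) this]
    show ?thesis by eventually_elim simp
  qed
  with G show ?thesis by (rule that)
qed

section \<open>Tangent vectors and maps in a local parametrization\<close>

definition push :: "'f \<Rightarrow> 'f \<Rightarrow> ('a, 'e) tvec" where
  "push q v = (\<lambda>c. frechet_derivative (\<lambda>q. snd c (J q)) (at q) v)"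

text \<open>\<open>chart_deriv\<close> differentiates within the image of the chart, which need not
  be open. The local inverse shows that \<open>snd c (J q)\<close> is an interior point of that
  image, so the derivative is the ordinary one and the chain rule applies.\<close>

lemma chart_deriv_push:
  fixes \<phi> :: "'a \<Rightarrow> 'b::euclidean_space"
  assumes c: "c \<in> X" "q \<in> B" "J q \<in> fst c" and \<phi>: "(\<lambda>q. \<phi> (J q)) differentiable at q"
  shows "chart_deriv c \<phi> (J q) (push q v c) = frechet_derivative (\<lambda>q. \<phi> (J q)) (at q) v"
proof -
  obtain G where G: "smooth_at G (snd c (J q))" "\<forall>\<^sub>F q' in nhds q. G (snd c (J q')) = q'"
    and loc': "\<And>P. \<forall>\<^sub>F q' in nhds q. P q' \<Longrightarrow>
      \<forall>\<^sub>F y in nhds (snd c (J q)). P (G y) \<and> G y \<in> B \<and> J (G y) \<in> fst c \<and> snd c (J (G y)) = y"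
    by (fact local_inverse[OF c])
  have loc: "\<forall>\<^sub>F y in nhds (snd c (J q)). True \<and> G y \<in> B \<and> J (G y) \<in> fst c \<and> snd c (J (G y)) = y"
    by (rule loc') simp
  have Gq: "G (snd c (J q)) = q" using eventually_nhds_x_imp_x[OF G(2)] .
  have int: "snd c (J q) \<in> interior (snd c ` fst c)"
    by (rule interior_nhdsI) (rule eventually_mono[OF loc], metis imageI)
  have "(\<lambda>y. \<phi> (J (G y))) differentiable at (snd c (J q))"
    using differentiable_chain_at[OF smooth_at_differentiable[OF G(1)], of "\<lambda>q. \<phi> (J q)"] \<phi> Gq
    by (simp add: o_def)
  moreover have "\<forall>\<^sub>F y in nhds (snd c (J q)). \<phi> (J (G y)) = in_chart c \<phi> y"
    using loc by eventually_elim (metis in_chart_apply[OF chart_inj[OF c(1)]])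
  ultimately have d: "in_chart c \<phi> differentiable at (snd c (J q))"
    by (rule frechet_derivative_cong_nhds)
  have "\<forall>\<^sub>F q' in nhds q. in_chart c \<phi> (snd c (J q')) = \<phi> (J q')"
    using chart_near[OF c] by eventually_elim (rule in_chart_apply[OF chart_inj[OF c(1)]])
  then have "\<forall>\<^sub>F q' in nhds q. \<phi> (J q') = in_chart c \<phi> (snd c (J q'))"
    by eventually_elim simp
  from frechet_derivative_cong_nhds(2)[OF \<phi> this]
  have "frechet_derivative (\<lambda>q. in_chart c \<phi> (snd c (J q))) (at q) = frechet_derivative (\<lambda>q. \<phi> (J q)) (at q)" .
  then show ?thesis
    using frechet_derivative_chain[OF smooth_at_differentiable[OF smooth_J[OF c]] d, of v]
    unfolding chart_deriv_def push_def at_within_interior[OF int] by simp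
qed

lemma push_eq_0:
  assumes "c \<in> X" "q \<in> B" "J q \<in> fst c" "push q v c = 0" shows "v = 0"
proof -
  obtain G where G: "smooth_at G (snd c (J q))" "\<forall>\<^sub>F q' in nhds q. G (snd c (J q')) = q'"
    using local_inverse[OF assms(1-3)] by blast
  have "frechet_derivative G (at (snd c (J q))) (push q v c) = v"
    using frechet_derivative_inverse_id[OF smooth_at_differentiable[OF smooth_J[OF assms(1-3)]]
        smooth_at_differentiable[OF G(1)] G(2)] by (simp add: push_def)
  moreover have "frechet_derivative G (at (snd c (J q))) 0 = 0"
    using smooth_at_has_derivative[OF G(1)] has_derivative_linear linear_0 by blast
  ultimately show ?thesis using assms(4) by simp
qed

lemma linear_push: "c \<in> X \<Longrightarrow> q \<in> B \<Longrightarrow> J q \<in> fst c \<Longrightarrow> linear (\<lambda>v. push q v c)"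
  unfolding push_def using smooth_at_has_derivative[OF smooth_J] has_derivative_linear by blast

lemma tangent_vec_push: "q \<in> B \<Longrightarrow> tangent_vec X (J q) (push q v)"
  unfolding tangent_vec_def
  using chart_deriv_push smooth_at_differentiable[OF smooth_J] by (metis IntD1 IntD2 push_def)

lemma in_ker_push:
  assumes "q \<in> B" "(\<lambda>q. g (J q)) differentiable at q" "frechet_derivative (\<lambda>q. g (J q)) (at q) v = 0"
  shows "in_ker X g (J q) (push q v)"
  unfolding in_ker_def using chart_deriv_push assms by metis

lemma push_has_vector_derivative:
  assumes "c \<in> X" "h t \<in> B" "J (h t) \<in> fst c" "(h has_vector_derivative h') (at t)"
  shows "((snd c \<circ> (\<lambda>t. J (h t))) has_vector_derivative push (h t) h' c) (at t)"
  using vector_derivative_diff_chain_within[OF assms(4)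
      has_derivative_at_withinI[OF smooth_at_has_derivative[OF smooth_J[OF assms(1-3)]]]]
  by (simp add: push_def o_def)

text \<open>By \<open>push_eq_0\<close> the derivative of \<open>J\<close> in a chart is injective,
  so independence from the velocity can be tested in the parameter space.\<close>

lemma normal_vec_push:
  assumes "h t \<in> B" "(h has_vector_derivative h') (at t)"
    and g: "(\<lambda>q. g (J q)) differentiable at (h t)" "frechet_derivative (\<lambda>q. g (J q)) (at (h t)) w = 0"
    and w: "w \<notin> span {h'}"
  shows "normal_vec X g (\<lambda>t. J (h t)) t (push (h t) w)"
  unfolding normal_vec_def
proof (intro conjI ballI impI)
  fix c assume c: "c \<in> X" "J (h t) \<in> fst c"
  note lin = linear_push[OF c(1) assms(1) c(2)]
  have v: "vector_derivative (snd c \<circ> (\<lambda>t. J (h t))) (at t) = push (h t) h' c"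
    by (rule vector_derivative_at[OF push_has_vector_derivative[OF c(1) assms(1) c(2) assms(2)]])
  show "push (h t) w c \<notin> span {vector_derivative (snd c \<circ> (\<lambda>t. J (h t))) (at t)}"
  proof
    assume "push (h t) w c \<in> span {vector_derivative (snd c \<circ> (\<lambda>t. J (h t))) (at t)}"
    then obtain a where "push (h t) w c = a *\<^sub>R push (h t) h' c"
      unfolding v span_singleton by auto
    then have "push (h t) (w - a *\<^sub>R h') c = 0"
      using linear_diff[OF lin] linear_cmul[OF lin] by simp
    then have "w = a *\<^sub>R h'" using push_eq_0[OF c(1) assms(1) c(2)] by force
    then show False using w by (simp add: span_mul span_base)
  qed
qed (use tangent_vec_push in_ker_push assms in auto)

lemma continuous_on_push:
  fixes h w :: "'t::t2_space \<Rightarrow> 'f"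
  assumes "continuous_on A h" "continuous_on A w" "h ` A \<subseteq> B" "c \<in> X"
  shows "continuous_on {x \<in> A. J (h x) \<in> fst c} (\<lambda>x. push (h x) (w x) c)"
  unfolding continuous_on_eq_continuous_within push_def
proof
  fix x assume x: "x \<in> {x \<in> A. J (h x) \<in> fst c}"
  show "continuous (at x within {x \<in> A. J (h x) \<in> fst c})
    (\<lambda>x. frechet_derivative (\<lambda>q. snd c (J q)) (at (h x)) (w x))"
    by (rule smooth_at_continuous_derivative)
      (use x assms in \<open>auto simp: continuous_on_eq_continuous_within
        intro!: smooth_J intro: continuous_within_subset[of _ A]\<close>)
qed

lemma eventually_preimage:
  assumes "openin (mtop X) W" "q \<in> B" "J q \<in> W"
  shows "\<forall>\<^sub>F q' in nhds q. J q' \<in> W"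
proof -
  obtain c where c: "c \<in> X" "J q \<in> fst c" by (rule obtain_chart[OF assms(2)])
  have "\<forall>\<^sub>F y in nhds (snd c (J q)). \<forall>p'\<in>fst c. snd c p' = y \<longrightarrow> p' \<in> W"
    using assms(1,3) c unfolding openin_mtop_iff by blast
  from eventually_isCont_compose[OF smooth_at_continuous[OF smooth_J[OF c(1) assms(2) c(2)]] this]
  show ?thesis using chart_near[OF c(1) assms(2) c(2)] by eventually_elim blast
qed

lemma local_param_sub: "J ` B \<subseteq> N \<Longrightarrow> local_param (sub X N) B J"
proof (unfold_locales, goal_cases)
  case (5 c q)
  then show ?case using chart_near eventually_B[of q] by (fastforce simp: sub_def elim: eventually_elim2)
next
  case (2 q)
  then show ?case using J_carr by (auto simp: carr_sub)
next
  case (3 c)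
  then obtain d where "d \<in> X" "c = (fst d \<inter> N, snd d)" by (auto simp: sub_def)
  then show ?case using inj_on_subset[OF chart_inj[of d], of "fst d \<inter> N"] by simp
qed (use open_B dim_le smooth_J left_inverse in \<open>auto simp: sub_def\<close>)

lemma local_param_restrict: "open B' \<Longrightarrow> B' \<subseteq> B \<Longrightarrow> local_param X B' J"
  by unfold_locales (use J_carr dim_le chart_near chart_inj smooth_J left_inverse in \<open>auto dest: subsetD\<close>)

text \<open>\<open>S\<close> may have boundary, as in \<open>{0..1} \<times> UNIV\<close>: the local
  extension beyond \<open>S\<close> is supplied by \<open>h\<close>, which is smooth in a full
  neighbourhood of every point of \<open>S\<close>.\<close>

lemma smooth_map_param:
  assumes "\<And>x. x \<in> S \<Longrightarrow> smooth_at h x" "h ` S \<subseteq> B" "\<And>x. x \<in> S \<Longrightarrow> H x = J (h x)"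
  shows "smooth_map (euclid S) X H"
  unfolding smooth_map_def
proof (intro conjI ballI)
  show "continuous_map (mtop (euclid S)) (mtop X) H"
    unfolding continuous_map topspace_mtop carr_euclid
  proof (intro conjI allI impI)
    show "H ` S \<subseteq> carr X" using assms J_carr by auto
    fix W assume W: "openin (mtop X) W"
    have "\<forall>\<^sub>F y in nhds x. y \<in> S \<longrightarrow> H y \<in> W" if x: "x \<in> S" "H x \<in> W" for x
    proof -
      have "\<forall>\<^sub>F q' in nhds (h x). J q' \<in> W"
        by (rule eventually_preimage[OF W]) (use x assms in auto)
      from eventually_isCont_compose[OF smooth_at_continuous[OF assms(1)[OF x(1)]] this]
      show ?thesis by eventually_elim (simp add: assms(3))
    qed
    then show "openin (mtop (euclid S)) {x \<in> S. H x \<in> W}" unfolding openin_mtop_euclid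
      by (auto elim!: eventually_mono)
  qed
  fix c d assume c: "c \<in> euclid S" and d: "d \<in> X"
  then have c: "c = (S, id)" by (simp add: euclid_def)
  show "smooth_on (snd c ` (fst c \<inter> H -` fst d)) (in_chart c (snd d \<circ> H))"
    unfolding smooth_on_iff
  proof
    fix x assume x: "x \<in> snd c ` (fst c \<inter> H -` fst d)"
    have "smooth_at (\<lambda>x. snd d (J (h x))) x"
      by (rule smooth_at_compose[OF assms(1) smooth_J[OF d]]) (use x c assms(2,3) in auto)
    moreover have "\<forall>\<^sub>F y in nhds x. y \<in> snd c ` (fst c \<inter> H -` fst d) \<longrightarrow>
        snd d (J (h y)) = in_chart c (snd d \<circ> H) y"
      by (rule always_eventually) (use c assms(3) in \<open>auto simp: in_chart_def\<close>)
    ultimately show "\<exists>g. smooth_at g x \<and> (\<forall>\<^sub>F y in nhds x. y \<in> snd c ` (fst c \<inter> H -` fst d) \<longrightarrow>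
        g y = in_chart c (snd d \<circ> H) y)" by blast
  qed
qed

lemma openin_param:
  assumes "open W" "W \<subseteq> B" shows "openin (mtop X) (J ` W)"
  unfolding openin_mtop_iff
proof (intro conjI ballI)
  show "J ` W \<subseteq> carr X" using assms J_carr by auto
  fix c p assume c: "c \<in> X" and p: "p \<in> J ` W \<inter> fst c"
  then obtain q where q: "q \<in> W" "p = J q" "J q \<in> fst c" by auto
  then have "q \<in> B" using assms by auto
  have ev: "\<forall>\<^sub>F q' in nhds q. q' \<in> W" using assms q(1) by (auto simp: eventually_nhds)
  obtain G where "smooth_at G (snd c (J q))" "\<forall>\<^sub>F q' in nhds q. G (snd c (J q')) = q'"
    and loc: "\<And>P. \<forall>\<^sub>F q' in nhds q. P q' \<Longrightarrow>
      \<forall>\<^sub>F y in nhds (snd c (J q)). P (G y) \<and> G y \<in> B \<and> J (G y) \<in> fst c \<and> snd c (J (G y)) = y"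
    by (fact local_inverse[OF c \<open>q \<in> B\<close> q(3)])
  from loc[OF ev] show "\<forall>\<^sub>F y in nhds (snd c p). \<forall>p'\<in>fst c. snd c p' = y \<longrightarrow> p' \<in> J ` W"
    unfolding q(2) by eventually_elim (metis chart_inj[OF c] imageI inj_onD)
qed

text \<open>Turns a coordinate formula \<open>K\<close> on the parameter space, with explicit
  inverse \<open>L\<close>, into a chart of the manifold. It will produce the Morse chart at the
  critical point.\<close>

lemma diffeo_param:
  fixes K :: "'f \<Rightarrow> 'g::euclidean_space"
  assumes W: "open W" "W \<subseteq> B" "inj_on J W"
    and K: "\<And>q. q \<in> W \<Longrightarrow> smooth_at K q" "\<And>q. q \<in> W \<Longrightarrow> L (K q) = q"
      "\<And>y. y \<in> K ` W \<Longrightarrow> smooth_at L y"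
    and \<kappa>: "\<And>q. q \<in> W \<Longrightarrow> \<kappa> (J q) = K q"
  shows "diffeo (sub X (J ` W)) (euclid (K ` W)) \<kappa>"
proof -
  let ?N = "J ` W"
  have carr: "carr (sub X ?N) = ?N" using J_carr W by (auto simp: carr_sub)
  have bij: "bij_betw \<kappa> ?N (K ` W)"
    unfolding bij_betw_def
  proof
    show "inj_on \<kappa> ?N"
    proof (rule inj_onI)
      fix x y assume "x \<in> ?N" "y \<in> ?N" and eq: "\<kappa> x = \<kappa> y"
      then obtain q q' where q: "q \<in> W" "q' \<in> W" "x = J q" "y = J q'" by auto
      then have "L (K q) = L (K q')" using eq \<kappa> by simp
      then show "x = y" using q K(2) by simp
    qed
    show "\<kappa> ` ?N = K ` W" using \<kappa> by (auto simp: image_image)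
  qed
  have "smooth_map (sub X ?N) (euclid (K ` W)) \<kappa>" unfolding smooth_map_def
  proof (intro conjI ballI)
    show "continuous_map (mtop (sub X ?N)) (mtop (euclid (K ` W))) \<kappa>"
      unfolding continuous_map topspace_mtop carr carr_euclid
    proof (intro conjI allI impI)
      fix U assume U: "openin (mtop (euclid (K ` W))) U"
      have "open {q \<in> W. K q \<in> U}"
      proof (rule open_nhdsI)
        fix q assume q: "q \<in> {q \<in> W. K q \<in> U}"
        then have "\<forall>\<^sub>F y in nhds (K q). y \<in> K ` W \<longrightarrow> y \<in> U" using U by (auto simp: openin_mtop_euclid)
        then have "\<forall>\<^sub>F q' in nhds q. K q' \<in> K ` W \<longrightarrow> K q' \<in> U"
          by (rule eventually_isCont_compose[OF smooth_at_continuous[OF K(1)], rotated]) (use q in auto)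
        moreover have "\<forall>\<^sub>F q' in nhds q. q' \<in> W" using W(1) q by (auto simp: eventually_nhds)
        ultimately show "\<forall>\<^sub>F q' in nhds q. q' \<in> {q \<in> W. K q \<in> U}" by eventually_elim auto
      qed
      then have "openin (mtop X) (J ` {q \<in> W. K q \<in> U})" by (rule openin_param) (use W in auto)
      then have "openin (mtop (sub X ?N)) (J ` {q \<in> W. K q \<in> U})" by (rule openin_mtop_sub) auto
      moreover have "J ` {q \<in> W. K q \<in> U} = {x \<in> ?N. \<kappa> x \<in> U}" using \<kappa> by auto
      ultimately show "openin (mtop (sub X ?N)) {x \<in> ?N. \<kappa> x \<in> U}" by simp
    qed (use \<kappa> in auto)
    fix c' d assume c': "c' \<in> sub X ?N" and d: "d \<in> euclid (K ` W)"
    then obtain c where c: "c \<in> X" "c' = (fst c \<inter> ?N, snd c)" by (auto simp: sub_def)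
    have inj: "inj_on (snd c') (fst c')" using chart_inj[OF c(1)] c(2) by (auto intro: inj_on_subset)
    have d: "d = (K ` W, id)" using d by (simp add: euclid_def)
    show "smooth_on (snd c' ` (fst c' \<inter> \<kappa> -` fst d)) (in_chart c' (snd d \<circ> \<kappa>))"
      unfolding smooth_on_iff
    proof
      fix a assume "a \<in> snd c' ` (fst c' \<inter> \<kappa> -` fst d)"
      then obtain q where q: "q \<in> W" "J q \<in> fst c" "a = snd c (J q)" using c(2) by auto
      have "q \<in> B" using q W by auto
      have ev: "\<forall>\<^sub>F q' in nhds q. q' \<in> W" using W q(1) by (auto simp: eventually_nhds)
      obtain G where G: "smooth_at G a" "\<forall>\<^sub>F q' in nhds q. G (snd c (J q')) = q'"
        and loc': "\<And>P. \<forall>\<^sub>F q' in nhds q. P q' \<Longrightarrow>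
          \<forall>\<^sub>F y in nhds a. P (G y) \<and> G y \<in> B \<and> J (G y) \<in> fst c \<and> snd c (J (G y)) = y"
        by (fact local_inverse[OF c(1) \<open>q \<in> B\<close> q(2), folded q(3)])
      have loc: "\<forall>\<^sub>F y in nhds a. G y \<in> W \<and> G y \<in> B \<and> J (G y) \<in> fst c \<and> snd c (J (G y)) = y"
        by (rule loc'[OF ev])
      have Gq: "G a = q" using eventually_nhds_x_imp_x[OF G(2)] q(3) by simp
      have "smooth_at (\<lambda>y. K (G y)) a"
        by (rule smooth_at_compose[OF G(1)]) (use K(1) q Gq in auto)
      moreover have "\<forall>\<^sub>F y in nhds a. y \<in> snd c' ` (fst c' \<inter> \<kappa> -` fst d) \<longrightarrow>
          K (G y) = in_chart c' (snd d \<circ> \<kappa>) y"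
        using loc
      proof eventually_elim
        case (elim y)
        then have "J (G y) \<in> fst c'" and y: "snd c' (J (G y)) = y" using c(2) by auto
        from in_chart_apply[OF inj this(1), of "snd d \<circ> \<kappa>"]
        have "in_chart c' (snd d \<circ> \<kappa>) y = (snd d \<circ> \<kappa>) (J (G y))" unfolding y .
        also have "\<dots> = K (G y)" using \<kappa> elim d by simp
        finally show ?case by simp
      qed
      ultimately show "\<exists>g. smooth_at g a \<and> (\<forall>\<^sub>F y in nhds a. y \<in> snd c' ` (fst c' \<inter> \<kappa> -` fst d) \<longrightarrow>
          g y = in_chart c' (snd d \<circ> \<kappa>) y)" by blast
    qed
  qed
  moreover have "smooth_map (euclid (K ` W)) (sub X ?N) (inv_into ?N \<kappa>)"
  proof -
    interpret W: local_param X W J by (rule local_param_restrict[OF W(1,2)])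
    interpret N: local_param "sub X ?N" W J by (rule W.local_param_sub) simp
    show ?thesis
    proof (rule N.smooth_map_param[of _ L])
      fix y assume "y \<in> K ` W"
      then obtain q where q: "q \<in> W" "y = K q" by auto
      then have "inv_into ?N \<kappa> (\<kappa> (J q)) = J q" by (intro bij_betw_inv_into_left[OF bij]) auto
      then show "inv_into ?N \<kappa> y = J (L y)" using q \<kappa> K(2) by simp
    qed (use K in auto)
  qed
  ultimately show ?thesis unfolding diffeo_def carr carr_euclid using bij by simp
qed

text \<open>The opposite direction, for a handle chart about which no formula is known. Smoothness
  of \<open>\<kappa> \<circ> J\<close> comes from reading \<open>\<kappa>\<close> in a chart. With
  the dimension bound, invariance of domain then shows that \<open>J \<circ> \<Theta>\<close> agrees
  with the inverse of \<open>\<kappa>\<close> on a full neighbourhood, and there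
  \<open>\<Theta>\<close> is the smooth local inverse \<open>G\<close> applied to the chart
  expression of that inverse.\<close>

lemma chart_of_diffeo:
  fixes \<kappa> :: "'a \<Rightarrow> 'g::euclidean_space"
  assumes inj: "inj_on J B" and Q: "openin (mtop X) Q" and \<kappa>: "diffeo (sub X Q) (euclid (\<kappa> ` Q)) \<kappa>"
    and dim: "DIM('g) \<le> DIM('f)" and q: "q \<in> B" "J q \<in> Q"
  defines "\<Theta> \<equiv> \<lambda>y. inv_into B J (inv_into Q \<kappa> y)"
  shows "smooth_at (\<lambda>q. \<kappa> (J q)) q" "smooth_at \<Theta> (\<kappa> (J q))" "\<Theta> (\<kappa> (J q)) = q"
    "\<forall>\<^sub>F y in nhds (\<kappa> (J q)). inv_into Q \<kappa> y = J (\<Theta> y) \<and> \<kappa> (J (\<Theta> y)) = y"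
proof -
  obtain c where c: "c \<in> X" "J q \<in> fst c" by (rule obtain_chart[OF q(1)])
  let ?c = "(fst c \<inter> Q, snd c)"
  have carr: "carr (sub X Q) = Q" using Q by (auto simp: carr_sub openin_mtop)
  have injc: "inj_on (snd ?c) (fst ?c)" using chart_inj[OF c(1)] by (auto intro: inj_on_subset)
  have inj\<kappa>: "inj_on \<kappa> Q" using \<kappa> unfolding diffeo_def carr bij_betw_def by simp
  have cQ: "?c \<in> sub X Q" using c by (auto simp: sub_def)
  have near: "\<forall>\<^sub>F q' in nhds q. q' \<in> B \<and> J q' \<in> Q \<and> J q' \<in> fst c"
    using eventually_preimage[OF Q q] chart_near[OF c(1) q(1) c(2)] eventually_B[OF q(1)]
    by eventually_elim simp
  have "smooth_on (snd ?c ` (fst ?c \<inter> \<kappa> -` fst (\<kappa> ` Q, id :: 'g \<Rightarrow> 'g))) (in_chart ?c (snd (\<kappa> ` Q, id) \<circ> \<kappa>))"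
    using \<kappa> cQ unfolding diffeo_def smooth_map_def euclid_def by blast
  moreover have "snd c (J q) \<in> snd ?c ` (fst ?c \<inter> \<kappa> -` fst (\<kappa> ` Q, id :: 'g \<Rightarrow> 'g))" using c q by auto
  ultimately obtain g where g: "smooth_at g (snd c (J q))"
    "\<forall>\<^sub>F y in nhds (snd c (J q)). y \<in> snd ?c ` (fst ?c \<inter> \<kappa> -` fst (\<kappa> ` Q, id :: 'g \<Rightarrow> 'g)) \<longrightarrow>
      g y = in_chart ?c (snd (\<kappa> ` Q, id) \<circ> \<kappa>) y"
    unfolding smooth_on_iff by blast
  have "smooth_at (\<lambda>q. g (snd c (J q))) q"
    by (rule smooth_at_compose[OF smooth_J[OF c(1) q(1) c(2)] g(1)])
  moreover have "\<forall>\<^sub>F q' in nhds q. g (snd c (J q')) = \<kappa> (J q')"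
    using eventually_isCont_compose[OF smooth_at_continuous[OF smooth_J[OF c(1) q(1) c(2)]] g(2)] near
  proof eventually_elim
    case (elim q')
    then have "g (snd c (J q')) = in_chart ?c (snd (\<kappa> ` Q, id) \<circ> \<kappa>) (snd ?c (J q'))" by auto
    also have "\<dots> = \<kappa> (J q')" using in_chart_apply[OF injc, of "J q'"] elim by simp
    finally show ?case .
  qed
  ultimately show sm: "smooth_at (\<lambda>q. \<kappa> (J q)) q" by (rule smooth_at_cong)
  have \<Theta>: "\<Theta> (\<kappa> (J q')) = q'" if "q' \<in> B" "J q' \<in> Q" for q'
    unfolding \<Theta>_def using inj inj\<kappa> that by simp
  then show "\<Theta> (\<kappa> (J q)) = q" using q by simp
  obtain G where G: "smooth_at G (snd c (J q))" "\<forall>\<^sub>F q' in nhds q. G (snd c (J q')) = q'"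
    using local_inverse[OF c(1) q(1) c(2)] by blast
  have "\<forall>\<^sub>F q' in nhds q. \<Theta> (\<kappa> (J q')) = q'" using near by eventually_elim (simp add: \<Theta>)
  moreover have "\<forall>\<^sub>F q' in nhds q. q' \<in> B \<and> J q' \<in> Q \<and> J q' \<in> fst c \<and> G (snd c (J q')) = q'"
    using near G(2) by eventually_elim simp
  ultimately have loc: "\<forall>\<^sub>F y in nhds (\<kappa> (J q)). (\<Theta> y \<in> B \<and> J (\<Theta> y) \<in> Q \<and> J (\<Theta> y) \<in> fst c \<and>
      G (snd c (J (\<Theta> y))) = \<Theta> y) \<and> \<kappa> (J (\<Theta> y)) = y"
    by (rule eventually_local_homeomorphism[OF dim sm])
  then show ev: "\<forall>\<^sub>F y in nhds (\<kappa> (J q)). inv_into Q \<kappa> y = J (\<Theta> y) \<and> \<kappa> (J (\<Theta> y)) = y"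
    by eventually_elim (metis inj\<kappa> inv_into_f_f)
  let ?d = "(\<kappa> ` Q, id :: 'g \<Rightarrow> 'g)" and ?i = "inv_into Q \<kappa>"
  have "smooth_on (snd ?d ` (fst ?d \<inter> ?i -` fst ?c)) (in_chart ?d (snd ?c \<circ> ?i))"
    using \<kappa> cQ unfolding diffeo_def smooth_map_def carr euclid_def by blast
  moreover have iq: "?i (\<kappa> (J q)) = J q" using inj\<kappa> q by simp
  then have "\<kappa> (J q) \<in> snd ?d ` (fst ?d \<inter> ?i -` fst ?c)" using q c by auto
  ultimately obtain g where g: "smooth_at g (\<kappa> (J q))"
    "\<forall>\<^sub>F y in nhds (\<kappa> (J q)). y \<in> snd ?d ` (fst ?d \<inter> ?i -` fst ?c) \<longrightarrow> g y = in_chart ?d (snd ?c \<circ> ?i) y"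
    unfolding smooth_on_iff by blast
  have E: "\<forall>\<^sub>F y in nhds (\<kappa> (J q)). g y = snd c (J (\<Theta> y)) \<and> G (snd c (J (\<Theta> y))) = \<Theta> y"
    using g(2) loc ev
  proof eventually_elim
    case (elim y)
    then have "y \<in> \<kappa> ` Q" by (metis imageI)
    then have "in_chart ?d (snd ?c \<circ> ?i) y = snd c (?i y)" by (simp add: in_chart_def)
    moreover have "y \<in> snd ?d ` (fst ?d \<inter> ?i -` fst ?c)" using elim \<open>y \<in> \<kappa> ` Q\<close> by auto
    ultimately show ?case using elim by auto
  qed
  have "g (\<kappa> (J q)) = snd c (J q)" using eventually_nhds_x_imp_x[OF E] \<Theta> q by simp
  then have "smooth_at (\<lambda>y. G (g y)) (\<kappa> (J q))" using smooth_at_compose[OF g(1)] G(1) by simp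
  moreover have "\<forall>\<^sub>F y in nhds (\<kappa> (J q)). G (g y) = \<Theta> y" using E by eventually_elim simp
  ultimately show "smooth_at \<Theta> (\<kappa> (J q))" by (rule smooth_at_cong)
qed

end

section \<open>Lifting a chart to the orientation double covering\<close>

type_synonym plane_pt = "(real \<times> real) \<times> complex"

text \<open>The universal covering of \<open>M \<times> \<complex>\<close> with the second
  coordinate doubled. In this normalization it factors through \<open>QA\<close> and the covering
  from \<open>A\<close> to \<open>M\<close>, whose nontrivial deck transformation becomes
  \<open>deck\<close>.\<close>

definition QM :: "plane_pt \<Rightarrow> model_pt" where
  "QM q = (M_class (fst (fst q)) (2 * snd (fst q)), snd q)"

definition QA :: "plane_pt \<Rightarrow> model_pt" where
  "QA q = (A_class (fst (fst q)) (snd (fst q)), snd q)"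

definition deck :: "plane_pt \<Rightarrow> plane_pt" where
  "deck q = ((- fst (fst q), snd (fst q) + 1/2), snd q)"

lemma M_class_eqD:
  assumes "M_class r s = M_class r' s'" shows "\<exists>n::int. r' = (-1) powi n * r \<and> s' = s + of_int n"
proof -
  have "(r', s') \<in> M_class r' s'" unfolding M_class_def by (auto intro: exI[of _ 0])
  then show ?thesis unfolding assms[symmetric] by (auto simp: M_class_def)
qed

lemma A_class_eqD:
  assumes "A_class r s = A_class r' s'" shows "r' = r \<and> (\<exists>n::int. s' = s + of_int n)"
proof -
  have "(r', s') \<in> A_class r' s'" unfolding A_class_def by (auto intro: exI[of _ 0])
  then show ?thesis unfolding assms[symmetric] by (auto simp: A_class_def)
qed

lemma A_class_shift: "A_class r (s + of_int m) = A_class r s"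
proof -
  have "\<exists>n'::int. s + of_int m + of_int n = s + of_int n'" for n by (intro exI[of _ "m + n"]) simp
  moreover have "\<exists>n'::int. s + of_int n = s + of_int m + of_int n'" for n
    by (intro exI[of _ "n - m"]) simp
  ultimately show ?thesis unfolding A_class_def by auto
qed

lemma QM_deck: "QM (deck q) = QM q"
  using M_class_shift[of 1 "fst (fst q)" "2 * snd (fst q)"] by (simp add: QM_def deck_def algebra_simps)

lemma map_prod_\<pi>_AM_QA: "map_prod \<pi>_AM id (QA q) = QM q"
  by (simp add: QA_def QM_def \<pi>_AM_class)

lemma abs_of_int_less_1: "\<bar>of_int n :: real\<bar> < 1 \<Longrightarrow> n = 0"
  by linarith

lemma inj_on_M_class: "inj_on (\<lambda>(r, s). M_class r s) (UNIV \<times> {s0 - 1/2<..<s0 + 1/2})"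
proof (rule inj_onI, clarify)
  fix r s r' s' assume A: "s \<in> {s0 - 1/2<..<s0 + 1/2}" "s' \<in> {s0 - 1/2<..<s0 + 1/2}"
    "M_class r s = M_class r' s'"
  then obtain n :: int where n: "r' = (-1) powi n * r" "s' = s + of_int n" using M_class_eqD by blast
  then have "n = 0" using A by (intro abs_of_int_less_1) (auto simp: abs_less_iff)
  then show "r = r' \<and> s = s'" using n by simp
qed

lemma openin_mtop_sub_iff:
  assumes "openin (mtop X) N"
  shows "openin (mtop (sub X N)) W \<longleftrightarrow> openin (mtop X) W \<and> W \<subseteq> N"
proof (intro iffI conjI)
  assume W: "openin (mtop (sub X N)) W"
  then show sub: "W \<subseteq> N" unfolding openin_mtop_iff carr_sub by blast
  show "openin (mtop X) W" unfolding openin_mtop_iff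
  proof (intro conjI ballI)
    show "W \<subseteq> carr X" using W unfolding openin_mtop_iff carr_sub by blast
    fix c p assume c: "c \<in> X" and p: "p \<in> W \<inter> fst c"
    have "(fst c \<inter> N, snd c) \<in> sub X N" using c by (auto simp: sub_def)
    from bspec[OF conjunct2[OF W[unfolded openin_mtop_iff]] this]
    have "\<forall>p\<in>W \<inter> (fst c \<inter> N). \<forall>\<^sub>F y in nhds (snd c p). \<forall>p'\<in>fst c \<inter> N. snd c p' = y \<longrightarrow> p' \<in> W"
      by simp
    then have "\<forall>\<^sub>F y in nhds (snd c p). \<forall>p'\<in>fst c \<inter> N. snd c p' = y \<longrightarrow> p' \<in> W"
      using p sub by blast
    moreover have "\<forall>\<^sub>F y in nhds (snd c p). \<forall>p'\<in>fst c. snd c p' = y \<longrightarrow> p' \<in> N"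
      using assms c p sub unfolding openin_mtop_iff by blast
    ultimately show "\<forall>\<^sub>F y in nhds (snd c p). \<forall>p'\<in>fst c. snd c p' = y \<longrightarrow> p' \<in> W"
      by eventually_elim blast
  qed
qed (auto intro: openin_mtop_sub)

definition stretch :: "real \<Rightarrow> plane_pt \<Rightarrow> plane_pt" where
  "stretch a q = ((fst (fst q), a * snd (fst q)), snd q)"

lemma bounded_linear_stretch: "bounded_linear (stretch a)"
  unfolding stretch_def
  by (intro bounded_linear_Pair bounded_linear_const_mult
      bounded_linear_compose[OF bounded_linear_fst] bounded_linear_compose[OF bounded_linear_snd]
      bounded_linear_fst bounded_linear_snd bounded_linear_compose[OF bounded_linear_fst bounded_linear_fst]
      bounded_linear_compose[OF bounded_linear_snd bounded_linear_fst])

text \<open>Representatives of one class have values of \<open>s\<close> that differ by integers, so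
  the open strip of width 1 about \<open>s0\<close> embeds in the Moebius band. In the doubled
  coordinate of \<open>QM\<close> it is a strip of radius 1/4, which accounts for
  \<open>M_chart (2 * s0)\<close> and for the bound 1/4 in \<open>M_chart_apply\<close>.\<close>

definition M_chart :: "real \<Rightarrow> (model_pt, plane_pt) chart" where
  "M_chart s0 = (let U = UNIV \<times> {s0 - 1/2<..<s0 + 1/2}; p = (\<lambda>(r, s). M_class r s) in
     (p ` U \<times> UNIV, map_prod (inv_into U p) id))"

lemma prod_mfdI:
  "c \<in> X \<Longrightarrow> d \<in> Y \<Longrightarrow> (fst c \<times> fst d, map_prod (snd c) (snd d)) \<in> prod_mfd X Y"
  unfolding prod_mfd_def by blast

lemma M_chart_MC: "M_chart s0 \<in> MC"
proof -
  let ?U = "UNIV \<times> {s0 - 1/2<..<s0 + 1/2} :: (real \<times> real) set" and ?p = "\<lambda>(r, s). M_class r s"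
  have "open ?U" by (intro open_Times open_UNIV open_greaterThanLessThan)
  then have "(?p ` ?U, inv_into ?U ?p) \<in> Moebius"
    unfolding Moebius_def quotient_mfd_def using inj_on_M_class[of s0] by blast
  then show ?thesis using prod_mfdI[of _ Moebius "(UNIV, id)" "euclid UNIV"]
    unfolding MC_def M_chart_def Let_def by (fastforce simp: euclid_def)
qed

lemma M_chart_apply:
  assumes "\<bar>snd (fst q) - s0\<bar> < 1/4"
  shows "QM q \<in> fst (M_chart (2 * s0))" "snd (M_chart (2 * s0)) (QM q) = stretch 2 q"
proof -
  let ?U = "UNIV \<times> {2 * s0 - 1/2<..<2 * s0 + 1/2} :: (real \<times> real) set"
  have q: "(fst (fst q), 2 * snd (fst q)) \<in> ?U"
  proof -
    have "snd (fst q) - s0 < 1/4" "s0 - snd (fst q) < 1/4" using assms by linarith+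
    then show ?thesis by auto
  qed
  have "M_class (fst (fst q)) (2 * snd (fst q)) \<in> (\<lambda>(r, s). M_class r s) ` ?U"
    by (rule image_eqI[OF _ q]) simp
  then show "QM q \<in> fst (M_chart (2 * s0))" by (simp add: M_chart_def QM_def Let_def)
  show "snd (M_chart (2 * s0)) (QM q) = stretch 2 q"
    using inv_into_f_f[OF inj_on_M_class q] by (simp add: M_chart_def QM_def Let_def stretch_def)
qed

lemma eventually_M_chart:
  "\<forall>\<^sub>F q in nhds q0. QM q \<in> fst (M_chart (2 * snd (fst q0))) \<and>
     snd (M_chart (2 * snd (fst q0))) (QM q) = stretch 2 q"
proof -
  have "isCont (\<lambda>q::plane_pt. snd (fst q)) q0" by (intro continuous_intros)
  moreover have "\<forall>\<^sub>F s in nhds (snd (fst q0)). \<bar>s - snd (fst q0)\<bar> < 1/4"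
    unfolding eventually_nhds_metric by (intro exI[of _ "1/4"]) (auto simp: dist_real_def)
  ultimately have "\<forall>\<^sub>F q in nhds q0. \<bar>snd (fst q) - snd (fst q0)\<bar> < 1/4"
    by (rule eventually_isCont_compose)
  then show ?thesis by eventually_elim (use M_chart_apply in blast)
qed

lemma eventually_QM:
  assumes "openin (mtop MC) W" "QM q0 \<in> W" shows "\<forall>\<^sub>F q in nhds q0. QM q \<in> W"
proof -
  let ?m = "M_chart (2 * snd (fst q0))"
  note ev = eventually_M_chart[of q0]
  have 0: "QM q0 \<in> fst ?m \<and> snd ?m (QM q0) = stretch 2 q0" by (rule eventually_nhds_x_imp_x[OF ev])
  have "\<forall>\<^sub>F y in nhds (snd ?m (QM q0)). \<forall>p'\<in>fst ?m. snd ?m p' = y \<longrightarrow> p' \<in> W"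
    using assms 0 M_chart_MC unfolding openin_mtop_iff by blast
  then have "\<forall>\<^sub>F y in nhds (stretch 2 q0). \<forall>p'\<in>fst ?m. snd ?m p' = y \<longrightarrow> p' \<in> W" using 0 by simp
  from eventually_isCont_compose[OF smooth_at_continuous[OF smooth_at_linear[OF bounded_linear_stretch]] this] ev
  show ?thesis by eventually_elim blast
qed

text \<open>In the charts \<open>M_chart\<close> the map \<open>QM\<close> is
  \<open>stretch 2\<close>. Hence smoothness of the inverse of \<open>\<Phi>\<close>, read in
  charts, makes the composite with \<open>QM\<close> smooth, and smoothness of \<open>\<Phi>\<close>
  followed by \<open>stretch (1/2)\<close> provides the local left inverse.\<close>

lemma local_param_inv_chart:
  fixes X :: "('a, 'e::euclidean_space) atlas"
  assumes dim: "DIM('e) \<le> 4" and charts: "\<And>c. c \<in> X \<Longrightarrow> inj_on (snd c) (fst c) \<and> openin (mtop X) (fst c)"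
    and N: "openin (mtop X) N" and \<Phi>N: "openin (mtop MC) (\<Phi> ` N)"
    and \<Phi>: "diffeo (sub X N) (sub MC (\<Phi> ` N)) \<Phi>"
  shows "local_param X {q. QM q \<in> \<Phi> ` N} (\<lambda>q. inv_into N \<Phi> (QM q))"
proof -
  let ?U = "{q. QM q \<in> \<Phi> ` N}" and ?i = "inv_into N \<Phi>"
  have N_carr: "N \<subseteq> carr X" using N by (auto simp: openin_mtop_iff)
  have carr: "carr (sub X N) = N" using N_carr by (auto simp: carr_sub)
  have inj: "inj_on \<Phi> N" using \<Phi> unfolding diffeo_def carr bij_betw_def by simp
  have iN: "?i (QM q) \<in> N" "\<Phi> (?i (QM q)) = QM q" if "q \<in> ?U" for q
    using that by (auto simp: inv_into_into f_inv_into_f)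
  have U: "\<forall>\<^sub>F q in nhds q0. q \<in> ?U" if "q0 \<in> ?U" for q0 using eventually_QM[OF \<Phi>N] that by simp
  have near: "\<forall>\<^sub>F q in nhds q0. ?i (QM q) \<in> fst c" if c: "c \<in> X" "q0 \<in> ?U" "?i (QM q0) \<in> fst c" for c q0
  proof -
    have "openin (mtop X) (fst c \<inter> N)" using charts[OF c(1)] N by (simp add: openin_Int)
    then have "openin (mtop (sub X N)) (fst c \<inter> N)" by (rule openin_mtop_sub) simp
    moreover have "continuous_map (mtop (sub MC (\<Phi> ` N))) (mtop (sub X N)) ?i"
      using \<Phi> unfolding diffeo_def smooth_map_def carr by blast
    ultimately have "openin (mtop (sub MC (\<Phi> ` N))) {x \<in> topspace (mtop (sub MC (\<Phi> ` N))). ?i x \<in> fst c \<inter> N}"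
      unfolding continuous_map by blast
    then have "openin (mtop MC) {x \<in> topspace (mtop (sub MC (\<Phi> ` N))). ?i x \<in> fst c \<inter> N}"
      unfolding openin_mtop_sub_iff[OF \<Phi>N] by simp
    moreover have "topspace (mtop (sub MC (\<Phi> ` N))) = \<Phi> ` N"
      unfolding topspace_mtop carr_sub using \<Phi>N by (auto simp: openin_mtop_iff)
    ultimately have "\<forall>\<^sub>F q in nhds q0. QM q \<in> {x \<in> \<Phi> ` N. ?i x \<in> fst c \<inter> N}"
      using iN c by (intro eventually_QM) auto
    then show ?thesis by eventually_elim simp
  qed
  show ?thesis
  proof
    show "open ?U" by (rule open_nhdsI) (rule U)
    show "DIM('e) \<le> DIM((real \<times> real) \<times> complex)" using dim by simp
    fix q assume "q \<in> ?U" then show "?i (QM q) \<in> carr X" using iN(1) N_carr by blast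
  next
    fix c q0 assume c: "c \<in> X" and q0: "q0 \<in> ?U" "?i (QM q0) \<in> fst c"
    let ?m = "M_chart (2 * snd (fst q0))"
    let ?m' = "(fst ?m \<inter> \<Phi> ` N, snd ?m)" and ?c = "(fst c \<inter> N, snd c)"
    have m': "?m' \<in> sub MC (\<Phi> ` N)" and c': "?c \<in> sub X N"
      using M_chart_MC c by (auto simp: sub_def)
    have 0: "QM q0 \<in> fst ?m \<and> snd ?m (QM q0) = stretch 2 q0"
      by (rule eventually_nhds_x_imp_x[OF eventually_M_chart])
    have injm: "inj_on (snd ?m') (fst ?m')"
    proof (rule inj_onI)
      fix x y assume "x \<in> fst ?m'" "y \<in> fst ?m'" "snd ?m' x = snd ?m' y"
      then show "x = y" unfolding M_chart_def Let_def
        by (auto simp: map_prod_def split: prod.splits dest: inv_into_injective)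
    qed
    have injc: "inj_on (snd ?c) (fst ?c)" using charts[OF c] by (auto intro: inj_on_subset)
    have ev: "\<forall>\<^sub>F q in nhds q0. q \<in> ?U \<and> ?i (QM q) \<in> fst c \<and> QM q \<in> fst ?m \<and> snd ?m (QM q) = stretch 2 q"
      using U[OF q0(1)] near[OF c q0] eventually_M_chart by eventually_elim simp
    let ?S = "snd ?m' ` (fst ?m' \<inter> ?i -` fst ?c)"
    have "smooth_on ?S (in_chart ?m' (snd ?c \<circ> ?i))"
      using \<Phi> m' c' unfolding diffeo_def smooth_map_def carr by blast
    moreover have "stretch 2 q0 \<in> ?S" using 0 q0 iN
      by (intro image_eqI[of _ _ "QM q0"]) auto
    ultimately obtain g where g: "smooth_at g (stretch 2 q0)"
      "\<forall>\<^sub>F y in nhds (stretch 2 q0). y \<in> ?S \<longrightarrow> g y = in_chart ?m' (snd ?c \<circ> ?i) y"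
      unfolding smooth_on_iff by blast
    note str = smooth_at_linear[OF bounded_linear_stretch[of 2], of q0]
    have "smooth_at (\<lambda>q. g (stretch 2 q)) q0" by (rule smooth_at_compose[OF str g(1)])
    moreover have "\<forall>\<^sub>F q in nhds q0. g (stretch 2 q) = snd c (?i (QM q))"
      using eventually_isCont_compose[OF smooth_at_continuous[OF str] g(2)] ev
    proof eventually_elim
      case (elim q)
      then have q: "QM q \<in> fst ?m'" "snd ?m' (QM q) = stretch 2 q" by auto
      then have "stretch 2 q \<in> ?S" using elim iN by (intro image_eqI[of _ _ "QM q"]) auto
      then have "g (stretch 2 q) = in_chart ?m' (snd ?c \<circ> ?i) (snd ?m' (QM q))" using elim q(2) by simp
      also have "\<dots> = (snd ?c \<circ> ?i) (QM q)" by (rule in_chart_apply[OF injm q(1)])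
      finally show ?case by simp
    qed
    ultimately show sm: "smooth_at (\<lambda>q. snd c (?i (QM q))) q0" by (rule smooth_at_cong)
    show "\<forall>\<^sub>F q in nhds q0. ?i (QM q) \<in> fst c" using near[OF c q0] .
    let ?T = "snd ?c ` (fst ?c \<inter> \<Phi> -` fst ?m')" and ?a = "snd c (?i (QM q0))"
    have "smooth_on ?T (in_chart ?c (snd ?m' \<circ> \<Phi>))"
      using \<Phi> m' c' unfolding diffeo_def smooth_map_def carr by blast
    moreover have "?a \<in> ?T" using 0 q0 iN by (intro image_eqI[of _ _ "?i (QM q0)"]) auto
    ultimately obtain G where G: "smooth_at G ?a"
      "\<forall>\<^sub>F y in nhds ?a. y \<in> ?T \<longrightarrow> G y = in_chart ?c (snd ?m' \<circ> \<Phi>) y"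
      unfolding smooth_on_iff by blast
    have "smooth_at (\<lambda>y. stretch (1/2) (G y)) ?a"
      by (rule smooth_at_compose_linear[OF bounded_linear_stretch G(1)])
    moreover have "\<forall>\<^sub>F q in nhds q0. stretch (1/2) (G (snd c (?i (QM q)))) = q"
      using eventually_isCont_compose[OF smooth_at_continuous[OF sm] G(2)] ev
    proof eventually_elim
      case (elim q)
      then have q: "?i (QM q) \<in> fst ?c" using iN by auto
      then have "snd c (?i (QM q)) \<in> ?T" using elim iN by (intro image_eqI[of _ _ "?i (QM q)"]) auto
      then have "G (snd c (?i (QM q))) = in_chart ?c (snd ?m' \<circ> \<Phi>) (snd ?c (?i (QM q)))" using elim by simp
      also have "\<dots> = (snd ?m' \<circ> \<Phi>) (?i (QM q))" by (rule in_chart_apply[OF injc q])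
      also have "\<dots> = stretch 2 q" using iN elim by simp
      finally show ?case by (simp add: stretch_def)
    qed
    ultimately show "\<exists>G. smooth_at G ?a \<and> (\<forall>\<^sub>F q in nhds q0. G (snd c (?i (QM q))) = q)" by blast
  qed (use charts in auto)
qed

section \<open>Orientations carried by a parametrization\<close>

definition vec_pt :: "real^4 \<Rightarrow> plane_pt" where
  "vec_pt v = ((v $ 1, v $ 2), Complex (v $ 3) (v $ 4))"

lemma linear_vec_pt: "linear vec_pt"
  by (rule linearI) (simp_all add: vec_pt_def complex_eq_iff)

lemma inj_vec_pt: "inj vec_pt"
proof (rule injI)
  fix v w :: "real^4" assume "vec_pt v = vec_pt w"
  then have "v $ i = w $ i" for i using exhaust_4[of i] by (auto simp: vec_pt_def)
  then show "v = w" by (simp add: vec_eq_iff)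
qed

text \<open>This matrix is the derivative of \<open>deck\<close> in the coordinates
  \<open>vec_pt\<close>; its sign is what makes \<open>deck\<close> exchange the two orientations
  over a point.\<close>

lemma det_reflection: "det (matrix (\<lambda>v :: real^4. \<chi> i. if i = 1 then - v $ 1 else v $ i)) = -1"
proof -
  have "matrix (\<lambda>v :: real^4. \<chi> i. if i = 1 then - v $ 1 else v $ i) $ i $ j =
    (if i = j then if i = 1 then -1 else 1 else 0)" for i j
    by (auto simp: matrix_def axis_def)
  then show ?thesis by (subst det_diagonal) (simp_all add: prod.delta)
qed

lemma continuous_det:
  assumes "\<And>i j. continuous F (\<lambda>x. A x $ i $ j)" shows "continuous F (\<lambda>x. det (A x :: real^'n^'n))"
  unfolding det_def by (intro continuous_intros assms)

lemma orientation_atD: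
  assumes "orientation_at X p \<sigma>"
  shows "c \<in> X \<Longrightarrow> p \<in> fst c \<Longrightarrow> \<sigma> c \<in> {1, -1}"
    and "\<not> (c \<in> X \<and> p \<in> fst c) \<Longrightarrow> \<sigma> c = 0"
    and "c \<in> X \<Longrightarrow> d \<in> X \<Longrightarrow> p \<in> fst c \<Longrightarrow> p \<in> fst d \<Longrightarrow>
      \<sigma> d = sgn (det (matrix (chart_deriv c (snd d) p))) * \<sigma> c"
proof -
  from assms have 1: "\<forall>c. if c \<in> X \<and> p \<in> fst c then \<sigma> c \<in> {1, -1} else \<sigma> c = 0"
    and 2: "\<forall>c\<in>X. \<forall>d\<in>X. p \<in> fst c \<inter> fst d \<longrightarrow>
      \<sigma> d = sgn (det (matrix (chart_deriv c (snd d) p))) * \<sigma> c"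
    unfolding orientation_at_def by (rule conjunct1, rule conjunct2)
  show "c \<in> X \<Longrightarrow> p \<in> fst c \<Longrightarrow> \<sigma> c \<in> {1, -1}" using spec[OF 1, of c] by simp
  show "\<not> (c \<in> X \<and> p \<in> fst c) \<Longrightarrow> \<sigma> c = 0" using spec[OF 1, of c] by (simp split: if_splits)
  show "c \<in> X \<Longrightarrow> d \<in> X \<Longrightarrow> p \<in> fst c \<Longrightarrow> p \<in> fst d \<Longrightarrow>
      \<sigma> d = sgn (det (matrix (chart_deriv c (snd d) p))) * \<sigma> c"
    using bspec[OF bspec[OF 2, of c], of d] by simp
qed

locale oriented_param = local_param X B J for X :: "('a, real^4) atlas" and B :: "plane_pt set" and J
begin

text \<open>Whether \<open>J\<close> takes the standard orientation of the parameter space to that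
  of the chart \<open>c\<close>. Composition with \<open>vec_pt\<close> makes the derivative an
  endomorphism of \<open>real^4\<close>, so that it has a determinant.\<close>

definition osgn :: "plane_pt \<Rightarrow> ('a, real^4) chart \<Rightarrow> real" where
  "osgn q c = sgn (det (matrix (\<lambda>v. push q (vec_pt v) c)))"

text \<open>The point of the covering that carries \<open>e\<close> times the orientation pushed
  forward by \<open>J\<close>. The value 0 at the other charts is dictated by
  \<open>orientation_at\<close>, where it makes an orientation a unique function.\<close>

definition lift :: "real \<Rightarrow> plane_pt \<Rightarrow> ('a, real^4) opoint" where
  "lift e q = (J q, \<lambda>c. if c \<in> X \<and> J q \<in> fst c then e * osgn q c else 0)"

lemma push_vec_pt:
  assumes "c \<in> X" "q \<in> B" "J q \<in> fst c"
  shows "linear (\<lambda>v. push q (vec_pt v) c)" "inj (\<lambda>v. push q (vec_pt v) c)"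
proof -
  note lin = linear_push[OF assms]
  show "linear (\<lambda>v. push q (vec_pt v) c)"
    using linear_compose[OF linear_vec_pt lin] by (simp add: o_def)
  have "inj (\<lambda>v. push q v c)" unfolding linear_injective_0[OF lin] using push_eq_0[OF assms] by blast
  then show "inj (\<lambda>v. push q (vec_pt v) c)" using inj_compose[OF _ inj_vec_pt] by (simp add: o_def)
qed

lemma det_push_neq_0: "c \<in> X \<Longrightarrow> q \<in> B \<Longrightarrow> J q \<in> fst c \<Longrightarrow> det (matrix (\<lambda>v. push q (vec_pt v) c)) \<noteq> 0"
  using push_vec_pt det_nz_iff_inj by blast

lemma osgn_cases: "c \<in> X \<Longrightarrow> q \<in> B \<Longrightarrow> J q \<in> fst c \<Longrightarrow> osgn q c \<in> {1, -1}"
  using det_push_neq_0 by (simp add: osgn_def sgn_real_def)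

text \<open>Multiplicativity of the determinant. \<open>chart_deriv\<close> is at first only known
  on pushed vectors; these are all vectors because \<open>?f\<close> is invertible, and so it is
  linear and has a matrix.\<close>

lemma osgn_chart_deriv:
  assumes c: "c \<in> X" "J q \<in> fst c" and d: "d \<in> X" "J q \<in> fst d" and q: "q \<in> B"
  shows "osgn q d = sgn (det (matrix (chart_deriv c (snd d) (J q)))) * osgn q c"
proof -
  let ?f = "\<lambda>v. push q (vec_pt v) c" and ?g = "\<lambda>v. push q (vec_pt v) d"
  let ?L = "chart_deriv c (snd d) (J q)"
  have "J q \<in> fst c \<inter> fst d" using c d by simp
  then have L: "?L (?f v) = ?g v" for v
    using tangent_vec_push[OF q, of "vec_pt v", unfolded tangent_vec_def, rule_format, OF c(1) d(1)] by simp
  obtain f' where f': "linear f'" "\<And>x. ?f (f' x) = x"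
    using linear_injective_isomorphism[OF push_vec_pt[OF c(1) q c(2)]] by blast
  have "?L x = ?g (f' x)" for x using L[of "f' x"] f'(2)[of x] by simp
  then have "?L = ?g \<circ> f'" by (simp add: fun_eq_iff)
  then have "linear ?L" using linear_compose[OF f'(1) push_vec_pt(1)[OF d(1) q d(2)]] by simp
  then have "matrix ?g = matrix ?L ** matrix ?f"
  proof -
    have "?g = ?L \<circ> ?f" using L by (simp add: fun_eq_iff)
    then show ?thesis using matrix_compose[OF push_vec_pt(1)[OF c(1) q c(2)] \<open>linear ?L\<close>] by simp
  qed
  then show ?thesis by (simp add: osgn_def det_mul sgn_mult)
qed

lemma orientation_lift:
  assumes e: "e \<in> {1, -1}" and q: "q \<in> B" shows "orientation_at X (J q) (snd (lift e q))"
  unfolding orientation_at_def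
proof (intro conjI allI ballI impI)
  fix c show "if c \<in> X \<and> J q \<in> fst c then snd (lift e q) c \<in> {1, -1} else snd (lift e q) c = 0"
    using osgn_cases[of c q] e q by (auto simp: lift_def)
next
  fix c d assume "c \<in> X" "d \<in> X" "J q \<in> fst c \<inter> fst d"
  then show "snd (lift e q) d = sgn (det (matrix (chart_deriv c (snd d) (J q)))) * snd (lift e q) c"
    using osgn_chart_deriv[of c q d] q by (simp add: lift_def)
qed

text \<open>The determinant is continuous in the parameter and has no zero.\<close>

lemma eventually_osgn:
  assumes c: "c \<in> X" "q \<in> B" "J q \<in> fst c"
  shows "\<forall>\<^sub>F q' in nhds q. osgn q' c = osgn q c"
proof -
  let ?D = "\<lambda>q. det (matrix (\<lambda>v. push q (vec_pt v) c))"
  have "isCont (\<lambda>q. push q (vec_pt v) c) q" for v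
    unfolding push_def
    using smooth_at_continuous_derivative[of "\<lambda>q. snd c (J q)" "\<lambda>q. q" q UNIV "\<lambda>_. vec_pt v"] smooth_J[OF c]
    by simp
  then have "isCont ?D q" unfolding matrix_def by (intro continuous_det) (auto intro!: continuous_intros)
  then have lim: "(?D \<longlongrightarrow> ?D q) (nhds q)" using tendsto_at_iff_tendsto_nhds[of ?D q] by (simp add: isCont_def)
  consider "?D q > 0" | "?D q < 0" using det_push_neq_0[OF c] by linarith
  then show ?thesis
  proof cases
    case 1
    from order_tendstoD(1)[OF lim this] show ?thesis by eventually_elim (use 1 in \<open>simp add: osgn_def\<close>)
  next
    case 2
    from order_tendstoD(2)[OF lim this] show ?thesis by eventually_elim (use 2 in \<open>simp add: osgn_def\<close>)
  qed
qed

text \<open>A chart of the covering is a chart of the base together with one sign, and the sign of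
  \<open>lift e\<close> is locally constant, so everything is inherited from \<open>J\<close>. The
  lifted charts are injective because the value of an orientation at one chart determines all others
  by the transition rule.\<close>

lemma local_param_lift:
  assumes e: "e \<in> {1, -1}" shows "local_param (orient_cover X) B (lift e)"
proof
  show "open B" by (rule open_B)
  show "DIM(real^4) \<le> DIM((real \<times> real) \<times> complex)" by simp
  show "lift e q \<in> carr (orient_cover X)" if q: "q \<in> B" for q
  proof -
    obtain c where c: "c \<in> X" "J q \<in> fst c" by (rule obtain_chart[OF q])
    then have "snd (lift e q) c \<in> {1, -1}" using osgn_cases[OF c(1) q c(2)] e by (auto simp: lift_def)
    then have m: "({(p, \<sigma>). p \<in> fst c \<and> orientation_at X p \<sigma> \<and> \<sigma> c = snd (lift e q) c}, snd c \<circ> fst) \<in> orient_cover X"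
      unfolding orient_cover_def using c(1) by blast
    have "lift e q \<in> {(p, \<sigma>). p \<in> fst c \<and> orientation_at X p \<sigma> \<and> \<sigma> c = snd (lift e q) c}"
      using c orientation_lift[OF e q] by (simp add: lift_def)
    then show ?thesis unfolding carr_def by (intro UN_I[OF m]) simp
  qed
  fix c' assume "c' \<in> orient_cover X"
  then obtain c s where c: "c \<in> X" "s \<in> {1, -1}"
    and c': "c' = ({(p, \<sigma>). p \<in> fst c \<and> orientation_at X p \<sigma> \<and> \<sigma> c = s}, snd c \<circ> fst)"
    unfolding orient_cover_def by blast
  show "inj_on (snd c') (fst c')"
  proof (rule inj_onI)
    fix x y assume x: "x \<in> fst c'" and y: "y \<in> fst c'" and eq: "snd c' x = snd c' y"
    have p: "fst x = fst y"
      by (rule inj_onD[OF chart_inj[OF c(1)]]) (use x y eq c' in auto)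
    have ox: "orientation_at X (fst x) (snd x)" and oy: "orientation_at X (fst x) (snd y)"
      and xc: "fst x \<in> fst c" "snd x c = snd y c" using x y p c' by auto
    have "snd x d = snd y d" for d
    proof (cases "d \<in> X \<and> fst x \<in> fst d")
      case True
      then show ?thesis
        using orientation_atD(3)[OF ox c(1), of d] orientation_atD(3)[OF oy c(1), of d] xc by simp
    next
      case False
      then show ?thesis using orientation_atD(2)[OF ox False] orientation_atD(2)[OF oy False] by simp
    qed
    then show "x = y" using p by (simp add: prod_eq_iff ext)
  qed
  fix q assume q: "q \<in> B" "lift e q \<in> fst c'"
  then have Jq: "J q \<in> fst c" "e * osgn q c = s" using c c' by (auto simp: lift_def)
  show "\<forall>\<^sub>F q' in nhds q. lift e q' \<in> fst c'"
    using chart_near[OF c(1) q(1) Jq(1)] eventually_osgn[OF c(1) q(1) Jq(1)] eventually_B[OF q(1)]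
  proof eventually_elim
    case (elim q')
    then show ?case using orientation_lift[OF e, of q'] c(1) Jq c' by (simp add: lift_def)
  qed
  have eq: "snd c' (lift e q) = snd c (J q)" for q by (simp add: c' lift_def)
  show "smooth_at (\<lambda>q. snd c' (lift e q)) q" unfolding eq by (rule smooth_J[OF c(1) q(1) Jq(1)])
  show "\<exists>G. smooth_at G (snd c' (lift e q)) \<and> (\<forall>\<^sub>F q' in nhds q. G (snd c' (lift e q')) = q')"
    unfolding eq by (rule left_inverse[OF c(1) q(1) Jq(1)])
qed

lemma lift_cases:
  assumes x: "x \<in> carr (orient_cover X)" "fst x = J q" and q: "q \<in> B"
  shows "x = lift 1 q \<or> x = lift (-1) q"
proof -
  obtain c where c: "c \<in> X" "J q \<in> fst c" by (rule obtain_chart[OF q])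
  have ox: "orientation_at X (J q) (snd x)"
    using x unfolding carr_def orient_cover_def by auto
  have "snd x c \<in> {1, -1}" by (rule orientation_atD(1)[OF ox c])
  then obtain e where e: "e \<in> {1, -1}" "snd x c = e * osgn q c"
    using osgn_cases[OF c(1) q c(2)] by auto
  have "snd x d = snd (lift e q) d" for d
  proof (cases "d \<in> X \<and> J q \<in> fst d")
    case True
    then have "snd x d = sgn (det (matrix (chart_deriv c (snd d) (J q)))) * snd x c"
      using orientation_atD(3)[OF ox c(1) _ c(2)] by simp
    then show ?thesis using osgn_chart_deriv[OF c _ _ q, of d] True e by (simp add: lift_def)
  next
    case False
    then show ?thesis using orientation_atD(2)[OF ox False] by (auto simp: lift_def)
  qed
  then have "x = lift e q" using x(2) by (simp add: prod_eq_iff lift_def fun_eq_iff)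
  then show ?thesis using e by auto
qed

text \<open>Both sides lie over the same base point; the reflection in \<open>r\<close> contained in
  \<open>deck\<close> reverses the pushed orientation.\<close>

lemma lift_deck:
  assumes deck: "\<And>q. J (deck q) = J q" and q: "q \<in> B" "deck q \<in> B"
  shows "lift e (deck q) = lift (- e) q"
proof -
  have "osgn (deck q) c = - osgn q c" if c: "c \<in> X" "J q \<in> fst c" for c
  proof -
    let ?\<Delta> = "\<lambda>q. ((- fst (fst q), snd (fst q)), snd q) :: plane_pt"
    let ?\<delta> = "\<lambda>v :: real^4. \<chi> i. if i = 1 then - v $ 1 else v $ i"
    have lin: "bounded_linear ?\<Delta>"
      by (intro bounded_linear_Pair bounded_linear_minus bounded_linear_snd
          bounded_linear_compose[OF bounded_linear_fst bounded_linear_fst]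
          bounded_linear_compose[OF bounded_linear_snd bounded_linear_fst])
    have d: "(deck has_derivative ?\<Delta>) (at q)"
      using has_derivative_add_const[OF bounded_linear_imp_has_derivative[OF lin], of "((0, 1/2), 0)"]
      by (simp add: deck_def[abs_def])
    have cd: "J (deck q) \<in> fst c" using c deck by simp
    have "frechet_derivative (\<lambda>q. snd c (J (deck q))) (at q) v = push (deck q) (?\<Delta> v) c" for v
    proof -
      have "deck differentiable at q" using d by (auto simp: differentiable_def)
      then show ?thesis
        using frechet_derivative_chain[of deck q "\<lambda>q. snd c (J q)" v]
          smooth_at_differentiable[OF smooth_J[OF c(1) q(2) cd]] fun_cong[OF frechet_derivative_at[OF d], of v]
        by (simp add: push_def)
    qed
    then have "push q v c = push (deck q) (?\<Delta> v) c" for v by (simp add: push_def deck)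
    moreover have "?\<Delta> (vec_pt v) = vec_pt (?\<delta> v)" for v by (simp add: vec_pt_def)
    ultimately have comp: "(\<lambda>v. push q (vec_pt v) c) = (\<lambda>v. push (deck q) (vec_pt v) c) \<circ> ?\<delta>"
      by (simp add: fun_eq_iff)
    have lin\<delta>: "linear ?\<delta>" by (rule linearI) (auto simp: vec_eq_iff)
    have "matrix (\<lambda>v. push q (vec_pt v) c) = matrix (\<lambda>v. push (deck q) (vec_pt v) c) ** matrix ?\<delta>"
      unfolding comp by (rule matrix_compose[OF lin\<delta> push_vec_pt(1)[OF c(1) q(2) cd]])
    then show ?thesis by (simp add: osgn_def det_mul det_reflection sgn_minus)
  qed
  then show ?thesis by (auto simp: lift_def deck fun_eq_iff)
qed

end

section \<open>The tube around the core and the choice of the sheet\<close>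

definition tube :: "real \<Rightarrow> plane_pt set" where
  "tube \<delta> = ({-\<delta><..<\<delta>} \<times> UNIV) \<times> ball 0 \<delta>"

lemma mem_tube: "q \<in> tube \<delta> \<longleftrightarrow> \<bar>fst (fst q)\<bar> < \<delta> \<and> cmod (snd q) < \<delta>"
  unfolding tube_def by (cases q) (auto simp: abs_less_iff)

lemma open_tube: "open (tube \<delta>)" and convex_tube: "convex (tube \<delta>)"
  unfolding tube_def by (auto intro!: open_Times convex_Times)

lemma deck_tube: "q \<in> tube \<delta> \<Longrightarrow> deck q \<in> tube \<delta>"
  by (simp add: mem_tube deck_def)

definition model :: "plane_pt \<Rightarrow> complex" where
  "model q = of_real (fst (fst q)) * exp (of_real (2 * pi * snd (fst q)) * \<i>) + (snd q)\<^sup>2"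

lemma F_m_QM: "F_m (QM q) = model q"
  unfolding QM_def model_def F_m_class by (simp add: mult.left_commute mult.assoc)

lemma F_a_QA: "F_a (QA q) = model q"
  unfolding F_a_def comp_apply map_prod_\<pi>_AM_QA F_m_QM ..

lemma QA_eqD:
  assumes "QA q = QA q'"
  shows "fst (fst q') = fst (fst q)" "\<exists>n::int. snd (fst q') = snd (fst q) + of_int n" "snd q' = snd q"
  using assms A_class_eqD[of "fst (fst q)" "snd (fst q)" "fst (fst q')" "snd (fst q')"]
  by (simp_all add: QA_def)

lemma QA_shift: "QA ((r, s + of_int n), z) = QA ((r, s), z)"
  by (simp add: QA_def A_class_shift)

lemma QA_deck_deck: "QA (deck (deck q)) = QA q"
  using QA_shift[of "fst (fst q)" "snd (fst q)" 1 "snd q"] by (simp add: deck_def add.commute)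

lemma half_not_int: "(1/2 :: real) \<noteq> of_int n"
proof
  assume "(1/2 :: real) = of_int n"
  then have "of_int (2 * n) = (of_int 1 :: real)" by simp
  then have "2 * n = 1" by (simp only: of_int_eq_iff)
  then show False by presburger
qed

lemma QA_deck_neq: "QA (deck q) \<noteq> QA q"
proof
  assume "QA (deck q) = QA q"
  from QA_eqD(2)[OF this[symmetric]] obtain n :: int where "1/2 = (of_int n :: real)" by (auto simp: deck_def)
  then show False using half_not_int by blast
qed

text \<open>The parity of the integer relating two representatives decides: an even shift of the
  doubled coordinate is a period of the annulus, an odd one is such a period composed with
  \<open>deck\<close>.\<close>

lemma QA_fibre:
  assumes y: "y \<in> carr AC" and eq: "map_prod \<pi>_AM id y = QM q"
  shows "y = QA q \<or> y = QA (deck q)"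
proof -
  obtain r s z where yr: "y = (A_class r s, z)"
    using y unfolding carr_def AC_def prod_mfd_def Annulus_def quotient_mfd_def euclid_def by auto
  have "M_class (fst (fst q)) (2 * snd (fst q)) = M_class r (2 * s)" and z: "z = snd q"
    using eq unfolding yr by (auto simp: \<pi>_AM_class QM_def)
  then obtain n :: int where n: "r = (-1) powi n * fst (fst q)" "2 * s = 2 * snd (fst q) + of_int n"
    using M_class_eqD by blast
  show ?thesis
  proof (cases "even n")
    case True
    then obtain m where "n = 2 * m" by blast
    then have "r = fst (fst q)" "s = snd (fst q) + of_int m" using n by (auto simp: power_int_minus_left)
    then show ?thesis using A_class_shift z yr by (simp add: QA_def)
  next
    case False
    then obtain m where "n = 2 * m + 1" using oddE by blast
    then have "r = - fst (fst q)" "s = (snd (fst q) + 1/2) + of_int m"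
      using n by (auto simp: power_int_minus_left field_simps)
    then have "y = QA (deck q)" using A_class_shift[of r "snd (fst q) + 1/2" m] z yr
      by (simp add: QA_def deck_def)
    then show ?thesis ..
  qed
qed

text \<open>The representative of a point in the domain \<open>U\<close> of a chart may differ by an
  integer \<open>n\<close> from its representative in \<open>\<Omega>\<close>; translation by
  \<open>n\<close> carries a neighbourhood of one to a neighbourhood of the other.\<close>

lemma openin_QA:
  assumes "open \<Omega>" shows "openin (mtop AC) (QA ` \<Omega>)"
  unfolding openin_mtop_iff
proof (intro conjI ballI)
  show "QA ` \<Omega> \<subseteq> carr AC"
  proof
    fix y assume "y \<in> QA ` \<Omega>"
    then obtain q where q: "y = QA q" by auto
    let ?U = "UNIV \<times> {snd (fst q) - 1/2<..<snd (fst q) + 1/2} :: (real \<times> real) set"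
    let ?p = "\<lambda>(r, s). A_class r s"
    have "inj_on ?p ?U"
    proof (rule inj_onI, clarify)
      fix r s r' s' assume A: "s \<in> {snd (fst q) - 1/2<..<snd (fst q) + 1/2}"
        "s' \<in> {snd (fst q) - 1/2<..<snd (fst q) + 1/2}" "A_class r s = A_class r' s'"
      then obtain n :: int where n: "r' = r" "s' = s + of_int n" using A_class_eqD by blast
      then have "n = 0" using A by (intro abs_of_int_less_1) (auto simp: abs_less_iff)
      then show "r = r' \<and> s = s'" using n by simp
    qed
    moreover have "open ?U" by (intro open_Times open_UNIV open_greaterThanLessThan)
    ultimately have "(?p ` ?U, inv_into ?U ?p) \<in> Annulus" unfolding Annulus_def quotient_mfd_def by blast
    from prod_mfdI[OF this, of "(UNIV, id)" "euclid UNIV"]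
    have c: "(?p ` ?U \<times> UNIV, map_prod (inv_into ?U ?p) id) \<in> AC" by (simp add: AC_def euclid_def)
    have "A_class (fst (fst q)) (snd (fst q)) \<in> ?p ` ?U"
      by (rule image_eqI[of _ _ "(fst (fst q), snd (fst q))"]) (auto simp: mem_Times_iff)
    then show "y \<in> carr AC" unfolding carr_def q by (intro UN_I[OF c]) (simp add: QA_def)
  qed
  fix c y assume c: "c \<in> AC" and y: "y \<in> QA ` \<Omega> \<inter> fst c"
  obtain U where U: "inj_on (\<lambda>(r, s). A_class r s) U"
    and c': "c = ((\<lambda>(r, s). A_class r s) ` U \<times> UNIV, map_prod (inv_into U (\<lambda>(r, s). A_class r s)) id)"
    using c unfolding AC_def prod_mfd_def Annulus_def quotient_mfd_def euclid_def by auto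
  have sc: "snd c (QA p) = p" if "fst p \<in> U" for p
    using inv_into_f_f[OF U that] by (simp add: c' QA_def case_prod_beta)
  have fc: "\<exists>p. fst p \<in> U \<and> x = QA p" if "x \<in> fst c" for x
    using that by (force simp: c' QA_def)
  obtain p where p: "fst p \<in> U" "y = QA p" using fc y by blast
  obtain \<omega> where \<omega>: "\<omega> \<in> \<Omega>" "QA \<omega> = QA p" using y p by auto
  obtain n :: int where n: "snd (fst p) = snd (fst \<omega>) + of_int n" using QA_eqD(2)[OF \<omega>(2)] by blast
  let ?t = "\<lambda>q :: plane_pt. ((fst (fst q), snd (fst q) - of_int n), snd q)"
  have "?t p = \<omega>" using n QA_eqD[OF \<omega>(2)] by (simp add: prod_eq_iff)
  then have "\<forall>\<^sub>F q in nhds (?t p). q \<in> \<Omega>" using \<omega>(1) assms by (auto simp: eventually_nhds)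
  then have "\<forall>\<^sub>F q in nhds p. ?t q \<in> \<Omega>"
    by (rule eventually_isCont_compose[rotated]) (intro continuous_intros)
  then show "\<forall>\<^sub>F x in nhds (snd c y). \<forall>p'\<in>fst c. snd c p' = x \<longrightarrow> p' \<in> QA ` \<Omega>"
    unfolding p(2) sc[OF p(1)]
  proof eventually_elim
    case (elim q)
    show ?case
    proof (intro ballI impI)
      fix p' assume p': "p' \<in> fst c" "snd c p' = q"
      from fc[OF p'(1)] obtain p'' where p'': "fst p'' \<in> U" "p' = QA p''" by blast
      then have "p' = QA q" using sc[OF p''(1)] p'(2) by simp
      also have "\<dots> = QA (?t q)" using QA_shift[of "fst (fst q)" "snd (fst q) - of_int n" n "snd q"] by simp
      finally show "p' \<in> QA ` \<Omega>" using elim by blast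
    qed
  qed
qed

text \<open>One period of the core is compact and so has a uniform neighbourhood of some radius
  \<open>e\<close> in the open preimage; \<open>QM\<close> has period 1 in \<open>s\<close>, which
  extends it along the whole line. The tube takes \<open>e / 2\<close> because the distance to the
  core is estimated by \<open>\<bar>r\<bar> + cmod z\<close>.\<close>

lemma tube_subset:
  assumes U: "open {q. QM q \<in> A}" and core: "M_core \<subseteq> A"
  obtains \<delta> where "\<delta> > 0" "tube \<delta> \<subseteq> {q. QM q \<in> A}"
proof -
  let ?K = "({0} \<times> {0..1}) \<times> {0} :: plane_pt set"
  have "compact ?K" by (intro compact_Times) auto
  moreover have "?K \<subseteq> {q. QM q \<in> A}" using core by (auto simp: QM_def M_core_def)
  ultimately obtain e where e: "e > 0" "(\<Union>x\<in>?K. ball x e) \<subseteq> {q. QM q \<in> A}"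
    using compact_subset_open_imp_ball_epsilon_subset[OF _ U] by blast
  have "q \<in> {q. QM q \<in> A}" if q: "q \<in> tube (e / 2)" for q
  proof -
    obtain r s z where qq: "q = ((r, s), z)" by (metis surj_pair)
    let ?n = "\<lfloor>s\<rfloor>" and ?x = "((0, frac s), 0) :: plane_pt"
    have "dist ?x ((r, frac s), z) = sqrt (r\<^sup>2 + (cmod z)\<^sup>2)"
      by (simp add: dist_norm norm_Pair)
    also have "\<dots> \<le> \<bar>r\<bar> + cmod z" using sqrt_sum_squares_le_sum_abs[of r "cmod z"] by simp
    also have "\<dots> < e" using q by (simp add: qq mem_tube)
    finally have "((r, frac s), z) \<in> ball ?x e" by simp
    moreover have "?x \<in> ?K" using frac_ge_0[of s] frac_lt_1[of s] by auto
    ultimately have "QM ((r, frac s), z) \<in> A" using e(2) by blast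
    moreover have "QM q = QM ((r, frac s), z)"
      using M_class_shift[of "2 * ?n" r "2 * frac s"]
      by (simp add: qq QM_def frac_def power_int_minus_left algebra_simps)
    ultimately show ?thesis by simp
  qed
  then have "tube (e / 2) \<subseteq> {q. QM q \<in> A}" by (rule subsetI)
  then show ?thesis using that[of "e / 2"] e(1) by simp
qed

lemma smooth_map_euclid_smooth_at:
  assumes "smooth_map (euclid S) (euclid T) h" "open S" "h ` S \<subseteq> T" "x \<in> S"
  shows "smooth_at h x"
proof -
  have "smooth_on (snd (S, id) ` (fst (S, id :: 'a \<Rightarrow> 'a) \<inter> h -` fst (T, id :: 'b \<Rightarrow> 'b)))
      (in_chart (S, id) (snd (T, id) \<circ> h))"
    using assms(1) unfolding smooth_map_def euclid_def by blast
  moreover have "snd (S, id) ` (fst (S, id :: 'a \<Rightarrow> 'a) \<inter> h -` fst (T, id :: 'b \<Rightarrow> 'b)) = S"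
    using assms(3) by auto
  ultimately have "smooth_at (in_chart (S, id) (snd (T, id) \<circ> h)) x"
    using assms(2,4) by (auto intro: smooth_on_smooth_at simp: interior_open)
  then show ?thesis
    by (rule smooth_at_cong) (use assms(2,4) in \<open>auto simp: eventually_nhds in_chart_def intro!: exI[of _ S]\<close>)
qed

lemma smooth_on_subset_cong:
  assumes f: "smooth_on S f" and "T \<subseteq> S" "\<And>x. x \<in> T \<Longrightarrow> f x = g x" shows "smooth_on T g"
  unfolding smooth_on_iff
proof
  fix x assume "x \<in> T"
  then obtain h where h: "smooth_at h x" "\<forall>\<^sub>F y in nhds x. y \<in> S \<longrightarrow> h y = f y"
    using f assms(2) unfolding smooth_on_iff by blast
  from h(2) have "\<forall>\<^sub>F y in nhds x. y \<in> T \<longrightarrow> h y = g y"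
    by eventually_elim (use assms(2,3) in auto)
  then show "\<exists>h. smooth_at h x \<and> (\<forall>\<^sub>F y in nhds x. y \<in> T \<longrightarrow> h y = g y)" using h(1) by blast
qed

text \<open>The part of \<open>smooth_manifold\<close> that makes the identity map smooth. It is
  isolated here in order to be passed to the orientation covering and then used for the constant
  ambient isotopy.\<close>

definition smooth_transitions :: "('a, 'e::euclidean_space) atlas \<Rightarrow> bool" where
  "smooth_transitions X \<longleftrightarrow>
     (\<forall>c\<in>X. \<forall>d\<in>X. smooth_on (snd c ` (fst c \<inter> fst d)) (in_chart c (snd d)))"

lemma smooth_transitions_orient_cover:
  assumes inj: "\<And>c. c \<in> X \<Longrightarrow> inj_on (snd c) (fst c)"
    and inj': "\<And>c. c \<in> orient_cover X \<Longrightarrow> inj_on (snd c) (fst c)"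
    and "smooth_transitions X"
  shows "smooth_transitions (orient_cover X)"
  unfolding smooth_transitions_def
proof (intro ballI)
  fix c' d' assume c'X: "c' \<in> orient_cover X" and "d' \<in> orient_cover X"
  then obtain c s d t where c: "c \<in> X" "d \<in> X"
    and c': "c' = ({(p, \<sigma>). p \<in> fst c \<and> orientation_at X p \<sigma> \<and> \<sigma> c = s}, snd c \<circ> fst)"
    and d': "d' = ({(p, \<sigma>). p \<in> fst d \<and> orientation_at X p \<sigma> \<and> \<sigma> d = t}, snd d \<circ> fst)"
    unfolding orient_cover_def by blast
  let ?S = "snd c' ` (fst c' \<inter> fst d')"
  have "smooth_on (snd c ` (fst c \<inter> fst d)) (in_chart c (snd d))"
    using assms(3) c unfolding smooth_transitions_def by blast
  then show "smooth_on ?S (in_chart c' (snd d'))"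
  proof (rule smooth_on_subset_cong)
    show "?S \<subseteq> snd c ` (fst c \<inter> fst d)" by (auto simp: c' d')
    fix y assume "y \<in> ?S"
    then obtain x where x: "x \<in> fst c'" "y = snd c' x" by auto
    then have "in_chart c' (snd d') y = snd d' x" using in_chart_apply[OF inj'[OF c'X]] by blast
    moreover have "in_chart c (snd d) (snd c (fst x)) = snd d (fst x)"
      by (rule in_chart_apply[OF inj[OF c(1)]]) (use x c' in auto)
    ultimately show "in_chart c (snd d) y = in_chart c' (snd d') y" using x by (simp add: c' d')
  qed
qed

text \<open>\<open>J\<close> inverts \<open>\<Phi>\<close> near the core, in the coordinates of the universal covering of the annulus.\<close>

locale annulus_param = local_param X "tube \<delta>" J
  for X :: "('x, 'e::euclidean_space) atlas" and \<delta> :: real and J +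
  fixes N :: "'x set" and \<Phi> :: "'x \<Rightarrow> model_pt" and f :: "'x \<Rightarrow> complex" and \<theta> :: "complex \<Rightarrow> complex"
  assumes \<delta>_pos: "\<delta> > 0"
    and transitions: "smooth_transitions X"
    and J_N: "q \<in> tube \<delta> \<Longrightarrow> J q \<in> N"
    and \<Phi>_J: "q \<in> tube \<delta> \<Longrightarrow> \<Phi> (J q) = QA q"
    and J_unique: "q \<in> tube \<delta> \<Longrightarrow> x \<in> N \<Longrightarrow> \<Phi> x = QA q \<Longrightarrow> x = J q"
    and f_J: "q \<in> tube \<delta> \<Longrightarrow> f (J q) = \<theta> (model q)"
    and smooth_\<theta>: "q \<in> tube \<delta> \<Longrightarrow> smooth_at \<theta> (model q)"
    and cmod_f_J: "q \<in> tube \<delta> \<Longrightarrow> cmod (f (J q)) = 1/2 - Re (model q)"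

lemma lift_dichotomy:
  assumes "oriented_param X (tube \<delta>) J" and N: "\<And>q. q \<in> tube \<delta> \<Longrightarrow> J q \<in> N"
    and \<Phi>: "\<And>q. q \<in> tube \<delta> \<Longrightarrow> \<Phi> (J q) = QM q"
    and lift: "is_lift X N \<Phi> \<Phi>'" and deck: "\<And>q. J (deck q) = J q"
  obtains e where "e \<in> {1, -1}" "\<And>q. q \<in> tube \<delta> \<Longrightarrow> \<Phi>' (oriented_param.lift X J e q) = QA q"
proof -
  interpret oriented_param X "tube \<delta>" J by fact
  interpret L: local_param "orient_cover X" "tube \<delta>" "lift 1" by (rule local_param_lift) simp
  have LN: "lift 1 ` tube \<delta> \<subseteq> lift_nbhd X N"
    using L.J_carr N by (auto simp: lift_nbhd_def lift_def)
  interpret L': local_param "sub (orient_cover X) (lift_nbhd X N)" "tube \<delta>" "lift 1"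
    by (rule L.local_param_sub[OF LN])
  let ?\<Psi> = "\<lambda>q. \<Phi>' (lift 1 q)"
  have cont: "continuous_map (mtop (sub (orient_cover X) (lift_nbhd X N))) (mtop AC) \<Phi>'"
    using lift unfolding is_lift_def by blast
  have fibre: "?\<Psi> q = QA q \<or> ?\<Psi> q = QA (deck q)" if q: "q \<in> tube \<delta>" for q
  proof (rule QA_fibre)
    show "?\<Psi> q \<in> carr AC"
      using cont L'.J_carr[OF q] unfolding continuous_map topspace_mtop by blast
    show "map_prod \<pi>_AM id (?\<Psi> q) = QM q"
      using lift LN q \<Phi>[OF q] unfolding is_lift_def by (auto simp: lift_def)
  qed
  \<comment> \<open>Either alternative of \<open>fibre\<close> persists nearby: the two candidates
    differ by 1/2 in \<open>s\<close> modulo 1, whereas \<open>s\<close> of the value and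
    \<open>s\<close> of the parameter each move by less than 1/8, in total by less than 1/4.\<close>
  have near: "\<forall>\<^sub>F q in nhds q0. q \<in> tube \<delta> \<and> ?\<Psi> q = QA (g q)"
    if q0: "q0 \<in> tube \<delta>" "?\<Psi> q0 = QA (g q0)" and g: "g = id \<or> g = deck" for q0 g
  proof -
    let ?s = "\<lambda>q :: plane_pt. snd (fst q)"
    let ?\<Omega> = "{q. \<bar>?s q - ?s (g q0)\<bar> < 1/8}"
    let ?W = "{x \<in> topspace (mtop (sub (orient_cover X) (lift_nbhd X N))). \<Phi>' x \<in> QA ` ?\<Omega>}"
    have "open ?\<Omega>" by (intro open_Collect_less continuous_intros)
    then have "openin (mtop (sub (orient_cover X) (lift_nbhd X N))) ?W"
      using cont openin_QA unfolding continuous_map by blast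
    moreover have "lift 1 q0 \<in> ?W"
      using L'.J_carr[OF q0(1)] q0(2) unfolding topspace_mtop by auto
    ultimately have "\<forall>\<^sub>F q in nhds q0. lift 1 q \<in> ?W" by (rule L'.eventually_preimage[OF _ q0(1)])
    moreover have "\<forall>\<^sub>F q in nhds q0. \<bar>?s q - ?s q0\<bar> < 1/8"
    proof -
      have "open {q. \<bar>?s q - ?s q0\<bar> < 1/8}" by (intro open_Collect_less continuous_intros)
      then show ?thesis by (auto simp: eventually_nhds)
    qed
    ultimately show ?thesis using eventually_B[OF q0(1)]
    proof eventually_elim
      case (elim q)
      then obtain q1 where q1: "\<bar>?s q1 - ?s (g q0)\<bar> < 1/8" "?\<Psi> q = QA q1" by auto
      have "?\<Psi> q = QA (g q)"
      proof (rule ccontr)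
        assume neq: "?\<Psi> q \<noteq> QA (g q)"
        have gs: "?s (g q) - ?s (g q0) = ?s q - ?s q0" using g by (auto simp: deck_def)
        then have close: "\<bar>?s q1 - ?s (g q)\<bar> < 1/4" using q1(1) elim by linarith
        have "?\<Psi> q = QA (deck (g q))"
          using fibre[OF elim(3)] neq g QA_deck_deck[of q] by auto
        then have "QA (deck (g q)) = QA q1" using q1(2) by simp
        from QA_eqD(2)[OF this] obtain n :: int where "?s q1 = ?s (g q) + 1/2 + of_int n"
          by (auto simp: deck_def)
        then have "\<bar>1/2 + of_int n :: real\<bar> < 1/4" using close by simp
        then have "- 1 < n" "n < 0" by linarith+
        then show False by simp
      qed
      then show ?case using elim by simp
    qed
  qed
  let ?E = "{q \<in> tube \<delta>. ?\<Psi> q = QA (id q)}" and ?E' = "{q \<in> tube \<delta>. ?\<Psi> q = QA (deck q)}"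
  have "open ?E" by (rule open_nhdsI) (use near[of _ id] in auto)
  moreover have "open ?E'" by (rule open_nhdsI) (use near[of _ deck] in auto)
  moreover have "tube \<delta> \<subseteq> ?E \<union> ?E'" using fibre by auto
  moreover have "?E \<inter> ?E' \<inter> tube \<delta> = {}" using QA_deck_neq by force
  ultimately have "?E \<inter> tube \<delta> = {} \<or> ?E' \<inter> tube \<delta> = {}"
    using connectedD[OF convex_connected[OF convex_tube]] by blast
  then consider "\<And>q. q \<in> tube \<delta> \<Longrightarrow> ?\<Psi> q = QA q" | "\<And>q. q \<in> tube \<delta> \<Longrightarrow> ?\<Psi> q = QA (deck q)"
    using fibre by fastforce
  then show ?thesis
  proof cases
    case 1
    then show ?thesis using that[of 1] by simp
  next
    case 2
    \<comment> \<open>Along \<open>lift 1\<close> the lifted chart is off by \<open>deck\<close>.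
      Substituting \<open>deck q\<close> changes the sheet, and applying \<open>deck\<close> twice
      is a period of \<open>QA\<close>.\<close>
    have "\<Phi>' (lift (-1) q) = QA q" if q: "q \<in> tube \<delta>" for q
      using 2[OF deck_tube[OF q]] lift_deck[of q 1] deck q deck_tube[OF q] QA_deck_deck by simp
    then show ?thesis using that[of "-1"] by simp
  qed
qed

lemma annulus_param_exists:
  fixes X :: "('a, real^4) atlas"
  assumes M: "smooth_manifold X" and norm: "normalized X f n S N \<Phi> V \<psi>" and k: "k \<in> {1..n}"
    and lift: "is_lift X (N k) (\<Phi> k) \<Phi>'"
  obtains \<delta> J where "annulus_param (orient_cover X) \<delta> J (lift_nbhd X (N k)) \<Phi>' (f \<circ> fst) (inv_into (V k) (\<psi> k))"
    "\<And>q. q \<in> tube \<delta> \<Longrightarrow> model q \<in> \<psi> k ` V k"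
proof -
  have "\<forall>k\<in>{1..n}. let q = exp (2 * of_real pi * \<i> * of_nat k / of_nat n) / 2 in
        f ` S k = {q} \<and> tubular_nbhd X (S k) (N k) \<and>
        M_core \<subseteq> \<Phi> k ` N k \<and> openin (mtop MC) (\<Phi> k ` N k) \<and>
        diffeo (sub X (N k)) (sub MC (\<Phi> k ` N k)) (\<Phi> k) \<and>
        complex_chart q (V k) (\<psi> k) \<and> \<psi> k q = 0 \<and> f ` N k \<subseteq> V k \<and>
        (\<forall>p\<in>N k. \<psi> k (f p) = F_m (\<Phi> k p)) \<and>
        (\<forall>w\<in>V k. cmod w = - Re (\<psi> k w) + 1 / 2)"
    using norm unfolding normalized_def by (rule conjunct2)
  note norm_k = bspec[OF this k, unfolded Let_def]
  obtain q where tub: "openin (mtop X) (N k)" and core: "M_core \<subseteq> \<Phi> k ` N k"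
    and op: "openin (mtop MC) (\<Phi> k ` N k)" and \<Phi>: "diffeo (sub X (N k)) (sub MC (\<Phi> k ` N k)) (\<Phi> k)"
    and chart: "complex_chart q (V k) (\<psi> k)" and fV: "f ` N k \<subseteq> V k"
    and \<psi>f: "\<And>p. p \<in> N k \<Longrightarrow> \<psi> k (f p) = F_m (\<Phi> k p)"
    and mod: "\<And>w. w \<in> V k \<Longrightarrow> cmod w = - Re (\<psi> k w) + 1 / 2"
    using norm_k unfolding tubular_nbhd_def by meson
  have charts: "inj_on (snd c) (fst c) \<and> openin (mtop X) (fst c)" if "c \<in> X" for c
    using M that unfolding smooth_manifold_def by blast
  let ?j = "\<lambda>q. inv_into (N k) (\<Phi> k) (QM q)"
  have base: "local_param X {q. QM q \<in> \<Phi> k ` N k} ?j"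
    by (rule local_param_inv_chart[OF _ charts tub op \<Phi>]) simp_all
  then have "open {q. QM q \<in> \<Phi> k ` N k}" by (rule local_param.open_B)
  from tube_subset[OF this core] obtain \<delta> where \<delta>: "\<delta> > 0" "tube \<delta> \<subseteq> {q. QM q \<in> \<Phi> k ` N k}" .
  interpret oriented_param X "tube \<delta>" ?j
    unfolding oriented_param_def by (rule local_param.local_param_restrict[OF base open_tube \<delta>(2)])
  have jN: "?j q \<in> N k" and \<Phi>j: "\<Phi> k (?j q) = QM q" if "q \<in> tube \<delta>" for q
  proof -
    have "QM q \<in> \<Phi> k ` N k" using \<delta>(2) that by blast
    then show "?j q \<in> N k" "\<Phi> k (?j q) = QM q" by (rule inv_into_into, rule f_inv_into_f)
  qed
  have deck: "?j (deck q) = ?j q" for q by (simp add: QM_deck)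
  obtain e where e: "e \<in> {1, -1}" and \<Phi>e: "\<And>q. q \<in> tube \<delta> \<Longrightarrow> \<Phi>' (lift e q) = QA q"
    using lift_dichotomy[OF oriented_param_axioms jN \<Phi>j lift deck] by blast
  interpret L: local_param "orient_cover X" "tube \<delta>" "lift e" by (rule local_param_lift[OF e])
  have carrN: "carr (sub X (N k)) = N k" using tub by (auto simp: carr_sub openin_mtop_iff)
  have inj\<Phi>: "inj_on (\<Phi> k) (N k)" using \<Phi> unfolding diffeo_def carrN bij_betw_def by simp
  have inj\<psi>: "inj_on (\<psi> k) (V k)" and op\<psi>: "open (\<psi> k ` V k)"
    and sm\<psi>: "smooth_map (euclid (\<psi> k ` V k)) (euclid (V k)) (inv_into (V k) (\<psi> k))"
    using chart unfolding complex_chart_def diffeo_def bij_betw_def by auto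
  have model: "\<psi> k (f (?j q)) = model q" "f (?j q) \<in> V k" if "q \<in> tube \<delta>" for q
    using \<psi>f[OF jN[OF that]] \<Phi>j[OF that] F_m_QM fV jN[OF that] by auto
  show ?thesis
  proof (rule that)
    show "annulus_param (orient_cover X) \<delta> (lift e) (lift_nbhd X (N k)) \<Phi>' (f \<circ> fst) (inv_into (V k) (\<psi> k))"
    proof
      show "\<delta> > 0" by (rule \<delta>(1))
      show "smooth_transitions (orient_cover X)"
        by (rule smooth_transitions_orient_cover)
          (use charts L.chart_inj M in \<open>auto simp: smooth_manifold_def smooth_transitions_def\<close>)
      fix q assume q: "q \<in> tube \<delta>"
      show "lift e q \<in> lift_nbhd X (N k)"
        using L.J_carr[OF q] jN[OF q] by (simp add: lift_nbhd_def lift_def)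
      show "\<Phi>' (lift e q) = QA q" by (rule \<Phi>e[OF q])
      show "(f \<circ> fst) (lift e q) = inv_into (V k) (\<psi> k) (model q)"
        using model[OF q] inv_into_f_f[OF inj\<psi>, of "f (?j q)"] by (simp add: lift_def)
      have "model q \<in> \<psi> k ` V k" using model[OF q] by (metis imageI)
      then show "smooth_at (inv_into (V k) (\<psi> k)) (model q)"
        by (intro smooth_map_euclid_smooth_at[OF sm\<psi> op\<psi>]) (auto simp: inv_into_into)
      show "cmod ((f \<circ> fst) (lift e q)) = 1/2 - Re (model q)"
        using mod[OF model(2)[OF q]] model(1)[OF q] by (simp add: lift_def)
      fix x assume x: "x \<in> lift_nbhd X (N k)" "\<Phi>' x = QA q"
      have "\<Phi> k (fst x) = QM q"
        using lift x map_prod_\<pi>_AM_QA unfolding is_lift_def by metis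
      then have "fst x = ?j q" using inj\<Phi> x(1) by (auto simp: lift_nbhd_def inv_into_f_eq)
      then consider "x = lift e q" | "x = lift (- e) q"
        using lift_cases[of x q] x(1) q e by (auto simp: lift_nbhd_def)
      then show "x = lift e q"
      proof cases
        \<comment> \<open>The other point over the same base point is
          \<open>lift e (deck q)\<close>, where the lifted chart has the value
          \<open>QA (deck q)\<close>, different from \<open>QA q\<close>.\<close>
        case 2
        then have "x = lift e (deck q)" using lift_deck[OF deck q deck_tube[OF q]] by simp
        then have "QA (deck q) = QA q" using \<Phi>e[OF deck_tube[OF q]] x(2) by simp
        then show ?thesis using QA_deck_neq by blast
      qed
    qed
    show "model q \<in> \<psi> k ` V k" if "q \<in> tube \<delta>" for q using model[OF that] by (metis imageI)
  qed
qed

section \<open>An explicit family of circles\<close>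

text \<open>With \<open>sin (\<eta>/2) = \<sigma> u\<close> the circle has angle \<open>2 \<pi> s = 2 \<pi> m + \<eta>\<close>, \<open>r\<close> is a multiple of
  \<open>sin \<eta>\<close> and \<open>z = \<surd>\<epsilon> w (p + \<i> \<kappa> u)\<close>, where \<open>p\<close> is determined by \<open>Re (r exp (2 \<pi> \<i> s) + z\<^sup>2) = \<epsilon>\<close>.
  The attaching circle has \<open>\<kappa> = 0\<close> and \<open>4 \<sigma>\<^sup>2 (1 - \<sigma>\<^sup>2) = \<epsilon>\<close>. The standard curve has
  \<open>\<kappa> = \<sigma> = 1/\<surd>2\<close>; there \<open>p + \<i> \<kappa> u = exp (\<i> \<eta>/2)\<close> and \<open>z\<^sup>2 = \<epsilon> cos \<eta> exp (\<i> \<eta>)\<close>.\<close>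

definition circ :: "real \<Rightarrow> real \<Rightarrow> real \<Rightarrow> real \<Rightarrow> real \<Rightarrow> real \<Rightarrow> plane_pt" where
  "circ e m \<epsilon> \<sigma> \<kappa> t = (let u = cos (2 * pi * t); w = sin (2 * pi * t); b = \<sigma>\<^sup>2 / (1 - \<sigma>\<^sup>2) in
     ((- (e * \<epsilon> * u * sqrt (1 - \<sigma>\<^sup>2 * u\<^sup>2) / (2 * \<sigma> * (1 - \<sigma>\<^sup>2))), m + arcsin (\<sigma> * u) / pi),
      Complex (sqrt \<epsilon> * w * sqrt (1 - (b - \<kappa>\<^sup>2) * u\<^sup>2)) (sqrt \<epsilon> * w * (\<kappa> * u))))"

definition circ_velocity :: "real \<Rightarrow> real \<Rightarrow> real \<Rightarrow> real \<Rightarrow> real \<Rightarrow> plane_pt" where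
  "circ_velocity e \<epsilon> \<sigma> \<kappa> t = (let u = cos (2 * pi * t); w = sin (2 * pi * t); b = \<sigma>\<^sup>2 / (1 - \<sigma>\<^sup>2);
       \<rho> = sqrt (1 - \<sigma>\<^sup>2 * u\<^sup>2); p = sqrt (1 - (b - \<kappa>\<^sup>2) * u\<^sup>2) in
     ((e * \<epsilon> * (2 * pi * w) * (1 - 2 * \<sigma>\<^sup>2 * u\<^sup>2) / (2 * \<sigma> * (1 - \<sigma>\<^sup>2) * \<rho>), - (2 * \<sigma> * w / \<rho>)),
      Complex (sqrt \<epsilon> * (2 * pi * u * p + w * (b - \<kappa>\<^sup>2) * u * (2 * pi * w) / p))
        (sqrt \<epsilon> * \<kappa> * (2 * pi) * (u\<^sup>2 - w\<^sup>2))))"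

text \<open>Together with the velocity, the next two fields frame the level set of \<open>Re F\<^sub>a\<close> along the
  circle. The first one is \<open>\<delta>z = \<i> (p + \<i> \<kappa> u)\<close>, \<open>\<delta>s = 0\<close>, with \<open>\<delta>r\<close> chosen to make it tangent; it is
  tangent to the fiber for the standard curve.\<close>

definition frame1 :: "real \<Rightarrow> real \<Rightarrow> real \<Rightarrow> real \<Rightarrow> real \<Rightarrow> plane_pt" where
  "frame1 e \<epsilon> \<sigma> \<kappa> t = (let u = cos (2 * pi * t); w = sin (2 * pi * t); b = \<sigma>\<^sup>2 / (1 - \<sigma>\<^sup>2);
       \<rho> = sqrt (1 - \<sigma>\<^sup>2 * u\<^sup>2); p = sqrt (1 - (b - \<kappa>\<^sup>2) * u\<^sup>2) in
     ((- (2 * e * sqrt \<epsilon> * w * \<kappa> * p / (\<sigma> * \<rho>)), 0), Complex (- (\<kappa> * u)) p))"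

definition frame2 :: "real \<Rightarrow> real \<Rightarrow> real \<Rightarrow> real \<Rightarrow> plane_pt" where
  "frame2 e \<epsilon> \<sigma> t = (let u = cos (2 * pi * t) in
     ((e * \<epsilon> * (1 - 2 * \<sigma>\<^sup>2 * u\<^sup>2) / (4 * \<sigma>\<^sup>2 * (1 - \<sigma>\<^sup>2)), 1 / (2 * pi)), 0))"

definition model_derivative :: "plane_pt \<Rightarrow> plane_pt \<Rightarrow> complex" where
  "model_derivative q v = (let r = fst (fst q); s = 2 * pi * snd (fst q) in
     Complex (cos s * fst (fst v) - r * sin s * (2 * pi * snd (fst v))
         + 2 * (Re (snd q) * Re (snd v) - Im (snd q) * Im (snd v)))
       (sin s * fst (fst v) + r * cos s * (2 * pi * snd (fst v))
         + 2 * (Re (snd q) * Im (snd v) + Im (snd q) * Re (snd v))))"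

lemma model_eq: "model q = Complex
    (fst (fst q) * cos (2 * pi * snd (fst q)) + (Re (snd q))\<^sup>2 - (Im (snd q))\<^sup>2)
    (fst (fst q) * sin (2 * pi * snd (fst q)) + 2 * Re (snd q) * Im (snd q))"
  unfolding model_def
  by (rule complex_eqI) (simp_all add: Re_exp Im_exp power2_eq_square)

lemma model_has_derivative: "(model has_derivative model_derivative q) (at q)"
proof -
  have "((\<lambda>q. of_real (fst (fst q) * cos (2 * pi * snd (fst q)) + (Re (snd q))\<^sup>2 - (Im (snd q))\<^sup>2)
      + \<i> * of_real (fst (fst q) * sin (2 * pi * snd (fst q)) + 2 * Re (snd q) * Im (snd q)))
      has_derivative model_derivative q) (at q)"
    by (rule derivative_eq_intros refl | simp)+
      (auto simp: fun_eq_iff model_derivative_def Let_def complex_eq_iff algebra_simps power2_eq_square)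
  then show ?thesis unfolding model_eq[abs_def] Complex_eq .
qed

lemma model_derivative_linear: "linear (model_derivative q)"
  using model_has_derivative has_derivative_linear by blast

lemma one_minus_mult_pos:
  fixes B U :: real assumes "B < 1" "0 \<le> U" "U \<le> 1" shows "1 - B * U > 0"
proof (cases "B \<le> 0")
  case True
  then have "B * U \<le> 0" using assms by (intro mult_nonpos_nonneg)
  then show ?thesis by simp
next
  case False
  then have "B * U \<le> B" using assms by (intro mult_left_le) auto
  then show ?thesis using assms by simp
qed

text \<open>\<open>m\<close> is the value of \<open>s\<close> at the critical point and
  \<open>e\<close> is 1 or -1, according to the handle. The last condition ensures
  \<open>b - \<kappa>\<^sup>2 < 1\<close>, so that \<open>p\<close> stays positive even for
  \<open>u = 1\<close> and \<open>u = -1\<close>.\<close>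

locale circle_family =
  fixes e m \<epsilon> \<sigma> \<kappa> :: real
  assumes cos_m: "cos (2 * pi * m) = 0" and sin_m: "sin (2 * pi * m) = e"
    and \<epsilon>: "\<epsilon> > 0" and \<sigma>: "\<sigma> > 0" "\<sigma>\<^sup>2 \<le> 1/2" and \<kappa>: "\<kappa>\<^sup>2 \<le> 1/2" "\<sigma>\<^sup>2 < 1/2 \<or> \<kappa> \<noteq> 0"
begin

abbreviation "u t \<equiv> cos (2 * pi * t)"
abbreviation "w t \<equiv> sin (2 * pi * t)"
abbreviation "b \<equiv> \<sigma>\<^sup>2 / (1 - \<sigma>\<^sup>2)"
abbreviation "\<rho> t \<equiv> sqrt (1 - \<sigma>\<^sup>2 * (u t)\<^sup>2)"
abbreviation "p t \<equiv> sqrt (1 - (b - \<kappa>\<^sup>2) * (u t)\<^sup>2)"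
abbreviation "h \<equiv> circ e m \<epsilon> \<sigma> \<kappa>"
abbreviation "h' \<equiv> circ_velocity e \<epsilon> \<sigma> \<kappa>"

lemma e_sq: "e\<^sup>2 = 1"
  using sin_cos_squared_add[of "2 * pi * m"] cos_m sin_m by simp

lemma u_le: "(u t)\<^sup>2 \<le> 1" and w_eq: "(w t)\<^sup>2 = 1 - (u t)\<^sup>2"
proof -
  show "(u t)\<^sup>2 \<le> 1" by (simp add: abs_square_le_1)
  show "(w t)\<^sup>2 = 1 - (u t)\<^sup>2" using sin_cos_squared_add[of "2 * pi * t"] by linarith
qed

text \<open>The third bound keeps \<open>p\<close> positive. The fourth one bounds \<open>z\<close>
  and excludes a degenerate frame away from \<open>u = 0\<close> in
  \<open>frames_independent\<close>.\<close>

lemma b_bounds: "0 < b" "b \<le> 1" "b - \<kappa>\<^sup>2 < 1" "\<bar>b - 2 * \<kappa>\<^sup>2\<bar> < 1"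
proof -
  have s: "1 - \<sigma>\<^sup>2 > 0" using \<sigma> by simp
  show b0: "0 < b" using s \<sigma> by simp
  show b1: "b \<le> 1" using s \<sigma> by (simp add: field_simps)
  have "b < 1 \<or> \<kappa>\<^sup>2 > 0"
  proof (cases "\<sigma>\<^sup>2 < 1/2")
    case True
    then show ?thesis using s by (simp add: field_simps)
  qed (use \<kappa> in simp)
  moreover have "\<kappa>\<^sup>2 \<ge> 0" by simp
  ultimately show "b - \<kappa>\<^sup>2 < 1" "\<bar>b - 2 * \<kappa>\<^sup>2\<bar> < 1" using b0 b1 \<kappa>(1) unfolding abs_less_iff by linarith+
qed

lemma rho_arg: "1 - \<sigma>\<^sup>2 * (u t)\<^sup>2 > 0" and p_arg: "1 - (b - \<kappa>\<^sup>2) * (u t)\<^sup>2 > 0"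
proof -
  show "1 - \<sigma>\<^sup>2 * (u t)\<^sup>2 > 0" by (rule one_minus_mult_pos) (use \<sigma> u_le in auto)
  show "1 - (b - \<kappa>\<^sup>2) * (u t)\<^sup>2 > 0" by (rule one_minus_mult_pos[OF b_bounds(3)]) (use u_le in auto)
qed

lemma rho_pos: "\<rho> t > 0" and p_pos: "p t > 0"
  using rho_arg p_arg by simp_all

lemma rho_sq: "(\<rho> t)\<^sup>2 = 1 - \<sigma>\<^sup>2 * (u t)\<^sup>2" and p_sq: "(p t)\<^sup>2 = 1 - (b - \<kappa>\<^sup>2) * (u t)\<^sup>2"
  using rho_arg p_arg by (simp_all add: less_imp_le)

lemma abs_\<sigma>u: "\<bar>\<sigma> * u t\<bar> < 1"
proof -
  have "(\<sigma> * u t)\<^sup>2 < 1" using rho_arg[of t] by (simp add: power_mult_distrib)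
  then show ?thesis by (simp add: abs_square_less_1)
qed

lemma h_eq:
  "fst (fst (h t)) = - (e * \<epsilon> * u t * \<rho> t / (2 * \<sigma> * (1 - \<sigma>\<^sup>2)))"
  "snd (fst (h t)) = m + arcsin (\<sigma> * u t) / pi"
  "Re (snd (h t)) = sqrt \<epsilon> * w t * p t" "Im (snd (h t)) = sqrt \<epsilon> * w t * (\<kappa> * u t)"
  by (simp_all add: circ_def Let_def)

lemma angle: "cos (2 * pi * snd (fst (h t))) = - (2 * e * \<sigma> * u t * \<rho> t)"
  "sin (2 * pi * snd (fst (h t))) = e * (1 - 2 * \<sigma>\<^sup>2 * (u t)\<^sup>2)"
proof -
  let ?\<alpha> = "arcsin (\<sigma> * u t)"
  have eq: "2 * pi * snd (fst (h t)) = 2 * pi * m + 2 * ?\<alpha>" by (simp add: h_eq field_simps)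
  have s: "sin ?\<alpha> = \<sigma> * u t" and c: "cos ?\<alpha> = \<rho> t"
    using abs_\<sigma>u[of t] by (simp_all add: abs_less_iff cos_arcsin power_mult_distrib)
  show "cos (2 * pi * snd (fst (h t))) = - (2 * e * \<sigma> * u t * \<rho> t)"
    unfolding eq cos_add cos_m sin_m sin_double s c by simp
  show "sin (2 * pi * snd (fst (h t))) = e * (1 - 2 * \<sigma>\<^sup>2 * (u t)\<^sup>2)"
    unfolding eq sin_add cos_m sin_m cos_double_sin s by (simp add: power_mult_distrib)
qed

lemma Re_sq: "(Re (snd (h t)))\<^sup>2 - (Im (snd (h t)))\<^sup>2 = \<epsilon> * (1 - (u t)\<^sup>2) * (1 - b * (u t)\<^sup>2)"
proof -
  have "(Re (snd (h t)))\<^sup>2 - (Im (snd (h t)))\<^sup>2 = (sqrt \<epsilon>)\<^sup>2 * (w t)\<^sup>2 * ((p t)\<^sup>2 - \<kappa>\<^sup>2 * (u t)\<^sup>2)"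
    unfolding h_eq by (simp only: power_mult_distrib right_diff_distrib mult.assoc)
  then show ?thesis using \<epsilon> unfolding p_sq w_eq by (simp add: algebra_simps)
qed

text \<open>With \<open>U = u\<^sup>2\<close>, subtracting the contribution of \<open>r\<close> from
  \<open>\<epsilon>\<close> leaves \<open>\<epsilon> * (1 - U) * (1 - b * U)\<close> for the real
  part of the square of \<open>z\<close>. The factor \<open>1 - U\<close> is the square of the
  smooth function \<open>w\<close>, which is why \<open>w\<close> appears in \<open>z\<close>, and
  this factorization is the origin of \<open>b\<close>.\<close>

lemma Re_model: "Re (model (h t)) = \<epsilon>"
proof -
  define U where "U = (u t)\<^sup>2"
  have s: "1 - \<sigma>\<^sup>2 \<noteq> 0" "\<sigma> \<noteq> 0" using \<sigma> by auto
  have "fst (fst (h t)) * cos (2 * pi * snd (fst (h t))) = e\<^sup>2 * \<epsilon> * U * (\<rho> t)\<^sup>2 / (1 - \<sigma>\<^sup>2)"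
  proof -
    define u' R where "u' = u t" and "R = \<rho> t"
    show ?thesis unfolding angle(1) h_eq(1) U_def R_def[symmetric] unfolding u'_def[symmetric]
      using s by (simp add: field_simps power2_eq_square)
  qed
  then have "Re (model (h t)) = \<epsilon> * U * (1 - \<sigma>\<^sup>2 * U) / (1 - \<sigma>\<^sup>2) + \<epsilon> * (1 - U) * (1 - b * U)"
    using Re_sq[of t] unfolding model_eq rho_sq e_sq U_def by simp
  also have "\<dots> = \<epsilon>"
  proof -
    define d where "d = 1 - \<sigma>\<^sup>2"
    then have \<sigma>d: "\<sigma>\<^sup>2 = 1 - d" and "d \<noteq> 0" using s by auto
    then show ?thesis unfolding \<sigma>d by (simp add: field_simps)
  qed
  finally show ?thesis .
qed

lemma h_bounds: "\<bar>fst (fst (h t))\<bar> \<le> \<epsilon> / \<sigma>" "(cmod (snd (h t)))\<^sup>2 \<le> 2 * \<epsilon>"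
proof -
  have abs_e: "\<bar>e\<bar> = 1" using e_sq by (simp add: abs_square_eq_1)
  have s: "1 \<le> 2 * (1 - \<sigma>\<^sup>2)" using \<sigma> by simp
  have "\<rho> t \<le> 1" by simp
  have "\<bar>fst (fst (h t))\<bar> = \<epsilon> * (\<bar>u t\<bar> * \<rho> t) / (\<sigma> * (2 * (1 - \<sigma>\<^sup>2)))"
  proof -
    have "2 * \<sigma> * (1 - \<sigma>\<^sup>2) = \<sigma> * (2 * (1 - \<sigma>\<^sup>2))" by simp
    then show ?thesis unfolding h_eq(1)
      using abs_e \<epsilon> \<sigma> s rho_pos[of t] by (simp add: abs_mult algebra_simps)
  qed
  also have "\<dots> \<le> \<epsilon> * (1 * 1) / (\<sigma> * 1)"
    by (intro frac_le mult_left_mono mult_mono) (use \<epsilon> \<sigma> s \<open>\<rho> t \<le> 1\<close> rho_pos[of t] in auto)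
  finally show "\<bar>fst (fst (h t))\<bar> \<le> \<epsilon> / \<sigma>" by simp
  have "(cmod (snd (h t)))\<^sup>2 = (sqrt \<epsilon>)\<^sup>2 * (w t)\<^sup>2 * ((p t)\<^sup>2 + \<kappa>\<^sup>2 * (u t)\<^sup>2)"
    unfolding cmod_power2 h_eq by (simp only: power_mult_distrib distrib_left mult.assoc)
  also have "\<dots> = \<epsilon> * ((w t)\<^sup>2 * (1 - (b - 2 * \<kappa>\<^sup>2) * (u t)\<^sup>2))"
    unfolding p_sq using \<epsilon> by (simp add: algebra_simps)
  also have "\<dots> \<le> \<epsilon> * (1 * 2)"
  proof (intro mult_left_mono mult_mono)
    have "\<bar>(b - 2 * \<kappa>\<^sup>2) * (u t)\<^sup>2\<bar> \<le> 1 * 1"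
      unfolding abs_mult by (intro mult_mono) (use b_bounds(4) u_le in auto)
    then show "1 - (b - 2 * \<kappa>\<^sup>2) * (u t)\<^sup>2 \<le> 2" "0 \<le> 1 - (b - 2 * \<kappa>\<^sup>2) * (u t)\<^sup>2"
      unfolding abs_le_iff by linarith+
    show "(w t)\<^sup>2 \<le> 1" unfolding w_eq by simp
  qed (use \<epsilon> in auto)
  finally show "(cmod (snd (h t)))\<^sup>2 \<le> 2 * \<epsilon>" by simp
qed

lemma h_velocity: "(h has_vector_derivative h' t) (at t)"
proof -
  have s: "1 - \<sigma>\<^sup>2 \<noteq> 0" "\<sigma> \<noteq> 0" using \<sigma> by auto
  note pos = rho_arg[of t] p_arg[of t] rho_pos[of t] p_pos[of t]
  have r: "((\<lambda>t. \<rho> t) has_real_derivative \<sigma>\<^sup>2 * u t * (2 * pi * w t) / \<rho> t) (at t)"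
    using pos(1,3) by (auto intro!: derivative_eq_intros simp: field_simps)
  have pp: "((\<lambda>t. p t) has_real_derivative (b - \<kappa>\<^sup>2) * u t * (2 * pi * w t) / p t) (at t)"
  proof -
    define B where "B = b - \<kappa>\<^sup>2"
    show ?thesis unfolding B_def[symmetric]
      using pos(2,4) unfolding B_def[symmetric] by (auto intro!: derivative_eq_intros simp: field_simps)
  qed
  have uu: "((\<lambda>t. u t) has_real_derivative - (2 * pi * w t)) (at t)"
    and ww: "((\<lambda>t. w t) has_real_derivative 2 * pi * u t) (at t)"
    by (auto intro!: derivative_eq_intros)
  have 1: "((\<lambda>t. - (e * \<epsilon> * u t * \<rho> t / (2 * \<sigma> * (1 - \<sigma>\<^sup>2)))) has_real_derivative
      e * \<epsilon> * (2 * pi * w t) * (1 - 2 * \<sigma>\<^sup>2 * (u t)\<^sup>2) / (2 * \<sigma> * (1 - \<sigma>\<^sup>2) * \<rho> t)) (at t)"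
  proof -
    define C where "C = - e * \<epsilon> / (2 * \<sigma> * (1 - \<sigma>\<^sup>2))"
    have "((\<lambda>t. C * (u t * \<rho> t)) has_real_derivative
        C * (- (2 * pi * w t) * \<rho> t + \<sigma>\<^sup>2 * u t * (2 * pi * w t) / \<rho> t * u t)) (at t)"
      by (intro DERIV_cmult DERIV_mult uu r)
    moreover have "- (2 * pi * w t) * \<rho> t + \<sigma>\<^sup>2 * u t * (2 * pi * w t) / \<rho> t * u t
        = - (2 * pi * w t) * ((\<rho> t)\<^sup>2 - \<sigma>\<^sup>2 * (u t)\<^sup>2) / \<rho> t"
      using pos(3) by (simp add: field_simps power2_eq_square del: real_sqrt_mult_self real_sqrt_pow2)
    ultimately show ?thesis unfolding rho_sq C_def by (simp add: mult_ac)
  qed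
  have 2: "((\<lambda>t. m + arcsin (\<sigma> * u t) / pi) has_real_derivative - (2 * \<sigma> * w t / \<rho> t)) (at t)"
  proof -
    have "(arcsin has_real_derivative inverse (sqrt (1 - (\<sigma> * u t)\<^sup>2))) (at (\<sigma> * u t))"
      using abs_\<sigma>u[of t] by (intro DERIV_arcsin) (auto simp: abs_less_iff)
    from DERIV_chain2[OF this DERIV_cmult[OF uu, of \<sigma>]]
    have "((\<lambda>t. arcsin (\<sigma> * u t)) has_real_derivative inverse (\<rho> t) * (\<sigma> * - (2 * pi * w t))) (at t)"
      by (simp add: power_mult_distrib)
    from DERIV_add[OF DERIV_const[of m] DERIV_cdivide[OF this, of pi]]
    show ?thesis by (simp add: field_simps)
  qed
  have 3: "((\<lambda>t. sqrt \<epsilon> * w t * p t) has_real_derivative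
      sqrt \<epsilon> * (2 * pi * u t * p t + w t * (b - \<kappa>\<^sup>2) * u t * (2 * pi * w t) / p t)) (at t)"
    using DERIV_cmult[OF DERIV_mult[OF ww pp], of "sqrt \<epsilon>"] by (simp add: mult_ac)
  have 4: "((\<lambda>t. sqrt \<epsilon> * w t * (\<kappa> * u t)) has_real_derivative
      sqrt \<epsilon> * \<kappa> * (2 * pi) * ((u t)\<^sup>2 - (w t)\<^sup>2)) (at t)"
    using DERIV_cmult[OF DERIV_mult[OF ww uu], of "sqrt \<epsilon> * \<kappa>"]
    by (simp add: algebra_simps power2_eq_square)
  show ?thesis
    using has_vector_derivative_Pair[OF has_vector_derivative_Pair[OF
          1[unfolded has_real_derivative_iff_has_vector_derivative]
          2[unfolded has_real_derivative_iff_has_vector_derivative]]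
        has_vector_derivative_complex_iff[THEN iffD2, of "\<lambda>t. snd (h t)" "snd (h' t)" "at t"]] 3 4
    by (simp add: circ_def[abs_def] circ_velocity_def Let_def)
qed


lemma model_derivative_h:
  "Re (model_derivative (h t) v) = - (2 * e * \<sigma> * u t * \<rho> t) * fst (fst v)
     + \<epsilon> * u t * \<rho> t / (2 * \<sigma> * (1 - \<sigma>\<^sup>2)) * (1 - 2 * \<sigma>\<^sup>2 * (u t)\<^sup>2) * (2 * pi * snd (fst v))
     + 2 * sqrt \<epsilon> * w t * (p t * Re (snd v) - \<kappa> * u t * Im (snd v))"
  "Im (model_derivative (h t) ((r, 0), z)) = e * (1 - 2 * \<sigma>\<^sup>2 * (u t)\<^sup>2) * r
     + 2 * sqrt \<epsilon> * w t * (p t * Im z + \<kappa> * u t * Re z)"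
proof -
  define u' w' \<rho>' p' where "u' = u t" and "w' = w t" and "\<rho>' = \<rho> t" and "p' = p t"
  have e2: "e * (e * x) = x" for x using e_sq by (simp add: power2_eq_square flip: mult.assoc)
  show "Re (model_derivative (h t) v) = - (2 * e * \<sigma> * u t * \<rho> t) * fst (fst v)
     + \<epsilon> * u t * \<rho> t / (2 * \<sigma> * (1 - \<sigma>\<^sup>2)) * (1 - 2 * \<sigma>\<^sup>2 * (u t)\<^sup>2) * (2 * pi * snd (fst v))
     + 2 * sqrt \<epsilon> * w t * (p t * Re (snd v) - \<kappa> * u t * Im (snd v))"
    unfolding model_derivative_def Let_def complex.sel angle h_eq(1,3,4)
      \<rho>'_def[symmetric] p'_def[symmetric] unfolding u'_def[symmetric] w'_def[symmetric]
    by (simp add: algebra_simps e2)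
  show "Im (model_derivative (h t) ((r, 0), z)) = e * (1 - 2 * \<sigma>\<^sup>2 * (u t)\<^sup>2) * r
     + 2 * sqrt \<epsilon> * w t * (p t * Im z + \<kappa> * u t * Re z)"
    unfolding model_derivative_def Let_def complex.sel angle h_eq(1,3,4)
      \<rho>'_def[symmetric] p'_def[symmetric] unfolding u'_def[symmetric] w'_def[symmetric]
    by (simp add: algebra_simps)
qed

lemma frame1_eq: "frame1 e \<epsilon> \<sigma> \<kappa> t =
    ((- (2 * e * sqrt \<epsilon> * w t * \<kappa> * p t / (\<sigma> * \<rho> t)), 0), Complex (- (\<kappa> * u t)) (p t))"
  by (simp add: frame1_def Let_def)

lemma frame2_eq: "frame2 e \<epsilon> \<sigma> t =
    ((e * \<epsilon> * (1 - 2 * \<sigma>\<^sup>2 * (u t)\<^sup>2) / (4 * \<sigma>\<^sup>2 * (1 - \<sigma>\<^sup>2)), 1 / (2 * pi)), 0)"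
  by (simp add: frame2_def Let_def)

lemma h'_eq: "h' t = ((e * \<epsilon> * (2 * pi * w t) * (1 - 2 * \<sigma>\<^sup>2 * (u t)\<^sup>2) / (2 * \<sigma> * (1 - \<sigma>\<^sup>2) * \<rho> t),
      - (2 * \<sigma> * w t / \<rho> t)),
      Complex (sqrt \<epsilon> * (2 * pi * u t * p t + w t * (b - \<kappa>\<^sup>2) * u t * (2 * pi * w t) / p t))
        (sqrt \<epsilon> * \<kappa> * (2 * pi) * ((u t)\<^sup>2 - (w t)\<^sup>2)))"
  by (simp add: circ_velocity_def Let_def)

lemma frame_tangent:
  "Re (model_derivative (h t) (frame1 e \<epsilon> \<sigma> \<kappa> t)) = 0"
  "Re (model_derivative (h t) (frame2 e \<epsilon> \<sigma> t)) = 0"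
  "Re (model_derivative (h t) (h' t)) = 0"
proof -
  define u' w' \<rho>' p' d where "u' = u t" and "w' = w t" and "\<rho>' = \<rho> t" and "p' = p t" and "d = 1 - \<sigma>\<^sup>2"
  have nz: "\<rho>' \<noteq> 0" "p' \<noteq> 0" "d \<noteq> 0" "\<sigma> \<noteq> 0"
    unfolding d_def \<rho>'_def p'_def using rho_pos[of t] p_pos[of t] \<sigma> by auto
  have e2: "e * (e * x) = x" for x using e_sq by (simp add: power2_eq_square flip: mult.assoc)
  show "Re (model_derivative (h t) (frame1 e \<epsilon> \<sigma> \<kappa> t)) = 0"
    unfolding model_derivative_h(1) frame1_eq fst_conv snd_conv complex.sel
    unfolding \<rho>'_def[symmetric] p'_def[symmetric]
    unfolding u'_def[symmetric] w'_def[symmetric] d_def[symmetric]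
    using nz by (simp add: field_simps e2)
  show "Re (model_derivative (h t) (frame2 e \<epsilon> \<sigma> t)) = 0"
    unfolding model_derivative_h(1) frame2_eq fst_conv snd_conv complex.sel
    unfolding \<rho>'_def[symmetric] p'_def[symmetric]
    unfolding u'_def[symmetric] w'_def[symmetric] d_def[symmetric]
    using nz by (simp add: field_simps e2 power2_eq_square)
  \<comment> \<open>For the velocity, tangency is the derivative of the constancy asserted by
    \<open>Re_model\<close>.\<close>
  have "((\<lambda>t. model (h t)) has_vector_derivative model_derivative (h t) (h' t)) (at t)"
    using vector_derivative_diff_chain_within[OF h_velocity has_derivative_at_withinI[OF model_has_derivative]]
    by (simp add: o_def)
  then have "((\<lambda>t. Re (model (h t))) has_vector_derivative Re (model_derivative (h t) (h' t))) (at t)"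
    by (rule bounded_linear.has_vector_derivative[OF bounded_linear_Re])
  then show "Re (model_derivative (h t) (h' t)) = 0"
    unfolding Re_model using vector_derivative_unique_at has_vector_derivative_const by blast
qed

text \<open>If \<open>d \<noteq> 0\<close>, eliminating \<open>A\<close> from the two components of
  \<open>z\<close> leaves \<open>u * (1 + (b - 2 * \<kappa>\<^sup>2) * (1 - 2 * u\<^sup>2)) =
  0\<close>. The second factor is positive by \<open>b_bounds\<close>, so \<open>u = 0\<close>;
  there the \<open>r\<close> component forces
  \<open>2 * \<kappa>\<^sup>2 * (1 - \<sigma>\<^sup>2) = 1\<close>, against
  \<open>\<kappa>\<^sup>2 \<le> 1/2\<close> and \<open>\<sigma> > 0\<close>. If
  \<open>d = 0\<close>, the \<open>s\<close> and \<open>Im z\<close> components give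
  \<open>B = 0\<close> and \<open>A = 0\<close>.\<close>

lemma frames_independent:
  assumes "A *\<^sub>R frame1 e \<epsilon> \<sigma> \<kappa> t + B *\<^sub>R frame2 e \<epsilon> \<sigma> t = d *\<^sub>R h' t"
  shows "A = 0 \<and> B = 0"
proof -
  define u' w' \<rho>' p' c \<delta> D where "u' = u t" and "w' = w t" and "\<rho>' = \<rho> t" and "p' = p t"
    and "c = 1 - 2 * \<sigma>\<^sup>2 * (u t)\<^sup>2" and "\<delta> = 1 - \<sigma>\<^sup>2" and "D = b - \<kappa>\<^sup>2"
  have nz: "\<rho>' > 0" "p' > 0" "\<delta> > 0" "\<sigma> > 0" "\<epsilon> > 0"
    unfolding \<delta>_def \<rho>'_def p'_def using rho_pos[of t] p_pos[of t] \<sigma> \<epsilon> by auto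
  have p2: "p'\<^sup>2 = 1 - D * u'\<^sup>2" and w2: "w'\<^sup>2 = 1 - u'\<^sup>2"
    using p_sq[of t] w_eq[of t] by (simp_all add: p'_def D_def u'_def w'_def)
  have comp: "- (A * (2 * e * sqrt \<epsilon> * w' * \<kappa> * p' / (\<sigma> * \<rho>'))) + B * (e * \<epsilon> * c / (4 * \<sigma>\<^sup>2 * \<delta>))
      = d * (e * \<epsilon> * (2 * pi * w') * c / (2 * \<sigma> * \<delta> * \<rho>'))"
    "B * (1 / (2 * pi)) = - (d * (2 * \<sigma> * w' / \<rho>'))"
    "- (A * (\<kappa> * u')) = d * (sqrt \<epsilon> * (2 * pi * u' * p' + w' * D * u' * (2 * pi * w') / p'))"
    "A * p' = d * (sqrt \<epsilon> * \<kappa> * (2 * pi) * (u'\<^sup>2 - w'\<^sup>2))"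
    using arg_cong[OF assms, of "\<lambda>v. fst (fst v)"] arg_cong[OF assms, of "\<lambda>v. snd (fst v)"]
      arg_cong[OF assms, of "\<lambda>v. Re (snd v)"] arg_cong[OF assms, of "\<lambda>v. Im (snd v)"]
    unfolding frame1_eq frame2_eq h'_eq u'_def w'_def \<rho>'_def p'_def c_def \<delta>_def D_def
    by (simp_all only: fst_add snd_add fst_scaleR snd_scaleR fst_conv snd_conv real_scaleR_def
        plus_complex.sel scaleR_complex.sel complex.sel mult_zero_right add_0_left add_0_right
        zero_complex.sel mult_minus_right)
  have B: "B = - (4 * pi * \<sigma> * d * w' / \<rho>')" using comp(2) by (simp add: field_simps)
  show ?thesis
  proof (cases "d = 0")
    case True
    then show ?thesis using comp(4) B nz by simp
  next
    case False
    have "0 = - (A * (\<kappa> * u')) * p' + A * p' * (\<kappa> * u')" by simp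
    also have "\<dots> = d * sqrt \<epsilon> * (2 * pi) * u' * (p'\<^sup>2 + D * w'\<^sup>2 + \<kappa>\<^sup>2 * (u'\<^sup>2 - w'\<^sup>2))"
      unfolding comp(3,4) using nz by (simp add: field_simps power2_eq_square)
    also have "p'\<^sup>2 + D * w'\<^sup>2 + \<kappa>\<^sup>2 * (u'\<^sup>2 - w'\<^sup>2) = 1 + (D - \<kappa>\<^sup>2) * (1 - 2 * u'\<^sup>2)"
      unfolding p2 w2 by (simp add: algebra_simps)
    also have "D - \<kappa>\<^sup>2 = b - 2 * \<kappa>\<^sup>2" unfolding D_def by simp
    finally have "u' * (1 + (b - 2 * \<kappa>\<^sup>2) * (1 - 2 * u'\<^sup>2)) = 0" using False nz by simp
    moreover have "\<bar>(b - 2 * \<kappa>\<^sup>2) * (1 - 2 * u'\<^sup>2)\<bar> < 1"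
    proof -
      have "\<bar>1 - 2 * u'\<^sup>2\<bar> \<le> 1" using u_le[of t] unfolding u'_def abs_le_iff by simp
      then have "\<bar>(b - 2 * \<kappa>\<^sup>2) * (1 - 2 * u'\<^sup>2)\<bar> \<le> \<bar>b - 2 * \<kappa>\<^sup>2\<bar>"
        unfolding abs_mult by (intro mult_left_le) auto
      then show ?thesis using b_bounds(4) by linarith
    qed
    then have "1 + (b - 2 * \<kappa>\<^sup>2) * (1 - 2 * u'\<^sup>2) \<noteq> 0" unfolding abs_less_iff by linarith
    ultimately have u0: "u' = 0" by simp
    have c1: "c = 1" using u0 unfolding c_def u'_def by simp
    have p1: "p' = 1" using p2 nz u0 by (simp add: power2_eq_1_iff)
    have w1: "w' \<noteq> 0" using w2 u0 by auto
    have A: "A = - (d * sqrt \<epsilon> * \<kappa> * (2 * pi))" using comp(4) w2 u0 p1 by simp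
    have e0: "e \<noteq> 0" using e_sq by auto
    have "d * e * w' * pi * (2 * (sqrt \<epsilon> * sqrt \<epsilon>) * \<kappa>\<^sup>2 * \<delta> - \<epsilon>) = 0"
      using comp(1) nz unfolding A B c1 p1
      by (simp add: field_simps power2_eq_square del: real_sqrt_mult_self)
    then have "\<epsilon> * (2 * \<kappa>\<^sup>2 * \<delta> - 1) = 0" using False e0 w1 nz by (simp add: algebra_simps)
    then have "2 * \<kappa>\<^sup>2 * \<delta> = 1" using nz by simp
    moreover have "2 * \<kappa>\<^sup>2 * \<delta> \<le> 1 * \<delta>" using \<kappa>(1) nz by (intro mult_right_mono) auto
    ultimately show ?thesis using \<sigma> unfolding \<delta>_def by simp
  qed
qed

lemma h'_neq_0: "h' t \<noteq> 0"
proof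
  assume "h' t = 0"
  then have "snd (fst (h' t)) = 0" "Re (snd (h' t)) = 0" by simp_all
  then have "w t = 0" "u t = 0" unfolding h'_eq using rho_pos[of t] p_pos[of t] \<sigma> \<epsilon> by auto
  then show False using w_eq[of t] by simp
qed

lemma h_periodic: "h (t + 1) = h t"
proof -
  have "2 * pi * (t + 1) = 2 * pi * t + 2 * pi" by (simp add: algebra_simps)
  then show ?thesis by (simp add: circ_def)
qed

text \<open>Reversal of \<open>t\<close> is the involution \<open>z \<mapsto> - z\<close>, the deck
  transformation of the double branched covering over the arc.\<close>

lemma h_uminus: "fst (h (- t)) = fst (h t)" "snd (h (- t)) = - snd (h t)"
  by (simp_all add: circ_def Let_def complex_eq_iff)

lemma h_arcsin: "\<bar>arcsin (\<sigma> * u t)\<bar> \<le> pi / 4" "\<sigma>\<^sup>2 < 1/2 \<Longrightarrow> \<bar>arcsin (\<sigma> * u t)\<bar> < pi / 4"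
proof -
  let ?x = "arcsin (\<sigma> * u t)"
  have s: "sin ?x = \<sigma> * u t" and r: "- pi/2 \<le> ?x" "?x \<le> pi/2"
    using abs_\<sigma>u[of t] arcsin_bounded[of "\<sigma> * u t"] by (auto simp: abs_less_iff)
  have c: "cos (2 * ?x) = 1 - 2 * (\<sigma>\<^sup>2 * (u t)\<^sup>2)"
    unfolding cos_double_sin s by (simp add: power_mult_distrib)
  have "\<sigma>\<^sup>2 * (u t)\<^sup>2 \<le> \<sigma>\<^sup>2" using u_le[of t] by (intro mult_left_le) auto
  then have 1: "cos (2 * ?x) \<ge> 0" and 2: "\<sigma>\<^sup>2 < 1/2 \<Longrightarrow> cos (2 * ?x) > 0"
    using c \<sigma>(2) by linarith+
  have neg: "cos (2 * \<bar>?x\<bar>) = cos (2 * ?x)" by (cases "?x \<ge> 0") (auto simp: abs_if)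
  have le: "\<bar>?x\<bar> \<le> pi / 2" using r by (auto simp: abs_le_iff)
  show "\<bar>?x\<bar> \<le> pi / 4"
  proof (rule ccontr)
    assume A: "\<not> \<bar>?x\<bar> \<le> pi / 4"
    have "cos (2 * \<bar>?x\<bar>) < cos (pi / 2)" by (rule cos_monotone_0_pi) (use A le in auto)
    then show False using 1 neg by simp
  qed
  show "\<bar>?x\<bar> < pi / 4" if "\<sigma>\<^sup>2 < 1/2"
  proof (rule ccontr)
    assume A: "\<not> \<bar>?x\<bar> < pi / 4"
    have "cos (2 * \<bar>?x\<bar>) \<le> cos (pi / 2)" by (rule cos_monotone_0_pi_le) (use A le in auto)
    then show False using 2[OF that] neg by simp
  qed
qed

text \<open>The circle stays over one half of the annulus. The attaching circle is defined with an
  open interval of \<open>s\<close> and the arc with a closed one, whence the two versions.\<close>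

lemma h_angle_bound: "\<bar>snd (fst (h t)) - m\<bar> \<le> 1/4" "\<sigma>\<^sup>2 < 1/2 \<Longrightarrow> \<bar>snd (fst (h t)) - m\<bar> < 1/4"
  using h_arcsin[of t] unfolding h_eq(2) by (simp_all add: field_simps)

text \<open>The angle determines \<open>u\<close>, then \<open>Re z\<close> determines
  \<open>w\<close> since \<open>p > 0\<close>, and the pair \<open>(u, w)\<close> determines
  \<open>t\<close> modulo 1. Two angles within 1/4 of \<open>m\<close> cannot differ by a nonzero
  integer.\<close>

lemma h_inj:
  assumes t: "t \<in> {0..<1}" "t' \<in> {0..<1}" and eq: "QA (h t) = QA (h t')" shows "t = t'"
proof -
  obtain n :: int where n: "snd (fst (h t')) = snd (fst (h t)) + of_int n" using QA_eqD(2)[OF eq] by blast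
  have "\<bar>of_int n :: real\<bar> < 1" using h_angle_bound(1)[of t] h_angle_bound(1)[of t'] n by linarith
  then have "n = 0" by (rule abs_of_int_less_1)
  then have "arcsin (\<sigma> * u t) = arcsin (\<sigma> * u t')" using n by (simp add: h_eq)
  then have "\<sigma> * u t = \<sigma> * u t'"
    using abs_\<sigma>u[of t] abs_\<sigma>u[of t'] by (metis abs_less_iff less_eq_real_def minus_less_iff sin_arcsin)
  then have u: "u t = u t'" using \<sigma> by simp
  have "Re (snd (h t)) = Re (snd (h t'))" using QA_eqD(3)[OF eq] by simp
  then have "w t = w t'" unfolding h_eq using u \<epsilon> p_pos[of t] by simp
  with u obtain n :: int where "2 * pi * t = 2 * pi * t' + 2 * pi * of_int n"
    using sin_cos_eq_iff[of "2 * pi * t" "2 * pi * t'"] by auto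
  then have "2 * pi * t = 2 * pi * (t' + of_int n)" by (simp add: algebra_simps)
  then have n: "t = t' + of_int n" by simp
  then have "\<bar>of_int n :: real\<bar> < 1" using t by auto
  then show ?thesis using n abs_of_int_less_1 by auto
qed

text \<open>At these parameters
  \<open>exp (2 * pi * \<i> * s) = \<i> * e * exp (\<i> * \<eta>)\<close> and
  \<open>r = - e * \<epsilon> * sin \<eta>\<close>, so the two terms of the model are
  \<open>exp (\<i> * \<eta>)\<close> times \<open>- \<i> * \<epsilon> * sin \<eta>\<close> and
  \<open>\<epsilon> * cos \<eta>\<close>, with sum \<open>\<epsilon>\<close>. Along
  \<open>frame1\<close> both terms vary by real multiples of
  \<open>\<i> * exp (\<i> * \<eta>)\<close>, and the chosen \<open>r\<close> component makes them
  cancel completely.\<close>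

lemma Im_model_end:
  assumes "\<kappa> = \<sigma>" "\<sigma>\<^sup>2 = 1/2"
  shows "Im (model (h t)) = 0" "Im (model_derivative (h t) (frame1 e \<epsilon> \<sigma> \<kappa> t)) = 0"
proof -
  have b1: "b = 1" unfolding assms(2) by simp
  have p\<rho>: "p t = \<rho> t" unfolding assms b1 by simp
  define u' w' \<rho>' where "u' = u t" and "w' = w t" and "\<rho>' = \<rho> t"
  have nz: "\<rho>' \<noteq> 0" unfolding \<rho>'_def using rho_pos[of t] by simp
  have w2: "w' * (w' * x) = (1 - u'\<^sup>2) * x" for x
    using w_eq[of t] unfolding u'_def w'_def by (simp add: power2_eq_square flip: mult.assoc)
  have e2: "e * (e * x) = x" for x using e_sq by (simp add: power2_eq_square flip: mult.assoc)
  have \<epsilon>2: "sqrt \<epsilon> * (sqrt \<epsilon> * x) = \<epsilon> * x" for x using \<epsilon> by (simp flip: mult.assoc)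
  have \<rho>2: "\<rho>'\<^sup>2 = 1 - u'\<^sup>2 / 2" unfolding \<rho>'_def u'_def rho_sq assms(2) using u_le[of t] by simp
  have \<sigma>0: "\<sigma> \<noteq> 0" using \<sigma> by simp
  have i\<sigma>: "x / \<sigma> = 2 * \<sigma> * x" for x
  proof -
    have "\<sigma> * \<sigma> = 1/2" using assms(2) by (simp add: power2_eq_square)
    then have "2 * \<sigma> * x * \<sigma> = x" by (simp add: mult_ac)
    then show ?thesis using \<sigma>0 by (simp add: field_simps)
  qed
  show "Im (model (h t)) = 0"
    unfolding model_eq complex.sel angle h_eq(1,3,4) p\<rho>
    unfolding assms(1) \<rho>'_def[symmetric] unfolding u'_def[symmetric] w'_def[symmetric] assms(2)
    by (simp add: i\<sigma> algebra_simps e2 w2 \<epsilon>2 power2_eq_square)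
  have "2 * e * sqrt \<epsilon> * w' * \<sigma> * \<rho>' / (\<sigma> * \<rho>') = 2 * e * sqrt \<epsilon> * w'" using nz \<sigma>0 by simp
  then have "Im (model_derivative (h t) (frame1 e \<epsilon> \<sigma> \<kappa> t))
      = e * (1 - 2 * \<sigma>\<^sup>2 * u'\<^sup>2) * (- (2 * e * sqrt \<epsilon> * w')) + 2 * sqrt \<epsilon> * w' * (\<rho>'\<^sup>2 - \<sigma>\<^sup>2 * u'\<^sup>2)"
    unfolding frame1_eq model_derivative_h(2) p\<rho> complex.sel
    unfolding assms(1) \<rho>'_def[symmetric] unfolding u'_def[symmetric] w'_def[symmetric]
    by (simp add: algebra_simps power2_eq_square)
  also have "\<dots> = 0" unfolding \<rho>2 assms(2) by (simp add: algebra_simps e2)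
  finally show "Im (model_derivative (h t) (frame1 e \<epsilon> \<sigma> \<kappa> t)) = 0" .
qed

text \<open>Inverts the parametrization by the angle: \<open>v\<close> takes the place of
  \<open>\<sigma> * u\<close>.\<close>

lemma half_angle:
  assumes "\<bar>s - m\<bar> \<le> 1/4"
  defines "v \<equiv> sin (pi * (s - m))"
  shows "cos (2 * pi * s) = - (2 * e * v * sqrt (1 - v\<^sup>2))" "v\<^sup>2 \<le> 1/2" "arcsin v = pi * (s - m)"
proof -
  define x where "x = pi * (s - m)"
  have v: "v = sin x" by (simp add: v_def x_def)
  have "pi * \<bar>s - m\<bar> \<le> pi * (1/4)" by (rule mult_left_mono[OF assms(1)]) simp
  then have x: "\<bar>x\<bar> \<le> pi / 4" by (simp add: abs_mult x_def)
  have "cos x \<ge> 0" by (rule cos_ge_zero) (use x in \<open>auto simp: abs_le_iff\<close>)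
  then have c: "cos x = sqrt (1 - v\<^sup>2)" unfolding v by (simp add: sin_squared_eq)
  have eq: "2 * pi * s = 2 * pi * m + 2 * x" by (simp add: algebra_simps x_def)
  show "cos (2 * pi * s) = - (2 * e * v * sqrt (1 - v\<^sup>2))"
    unfolding eq cos_add cos_m sin_m sin_double c v[symmetric] by simp
  have "cos (2 * x) \<ge> 0" by (rule cos_ge_zero) (use x in \<open>auto simp: abs_le_iff\<close>)
  then show "v\<^sup>2 \<le> 1/2" unfolding cos_double_sin v by simp
  show "arcsin v = pi * (s - m)" unfolding v x_def[symmetric] by (rule arcsin_sin) (use x in \<open>auto simp: abs_le_iff\<close>)
qed

text \<open>The angle determines \<open>u t\<close> and thus \<open>t\<close> up to sign; the two
  signs of \<open>t\<close> account for the two square roots of the square of \<open>z\<close> by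
  \<open>h_uminus\<close>.\<close>

lemma reach:
  assumes s: "\<bar>s - m\<bar> \<le> 1/4" and v: "(sin (pi * (s - m)))\<^sup>2 \<le> \<sigma>\<^sup>2"
    and r: "r = cos (2 * pi * s) * (\<epsilon> / (4 * \<sigma>\<^sup>2 * (1 - \<sigma>\<^sup>2)))"
    and z: "\<And>t. fst (h t) = (r, s) \<Longrightarrow> z\<^sup>2 = (snd (h t))\<^sup>2"
  shows "((r, s), z) \<in> range h"
proof -
  define v where "v = sin (pi * (s - m))"
  have "\<bar>v\<bar> \<le> \<sigma>" using v \<sigma>(1) abs_le_square_iff[of v \<sigma>] unfolding v_def by simp
  then have "\<bar>v / \<sigma>\<bar> \<le> 1" using \<sigma>(1) by simp
  then have c: "cos (arccos (v / \<sigma>)) = v / \<sigma>" by (simp add: abs_le_iff cos_arccos_abs)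
  define t where "t = arccos (v / \<sigma>) / (2 * pi)"
  have "2 * pi * t = arccos (v / \<sigma>)" by (simp add: t_def)
  then have \<sigma>u: "\<sigma> * u t = v" and ut: "u t = v / \<sigma>" using c \<sigma>(1) by simp_all
  have \<rho>: "\<rho> t = sqrt (1 - v\<^sup>2)" unfolding \<sigma>u[symmetric] power_mult_distrib ..
  have "snd (fst (h t)) = s" unfolding h_eq(2) \<sigma>u using half_angle(3)[OF s] by (simp add: v_def)
  moreover have "fst (fst (h t)) = r"
    unfolding h_eq(1) r \<rho> ut half_angle(1)[OF s, folded v_def]
    using \<sigma> by (simp add: field_simps power2_eq_square)
  ultimately have h: "fst (h t) = (r, s)" by (simp add: prod_eq_iff)
  from z[OF h] have "z = snd (h t) \<or> z = snd (h (- t))" unfolding h_uminus power2_eq_iff .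
  then have "((r, s), z) = h t \<or> ((r, s), z) = h (- t)" using h h_uminus(1)[of t] by (simp add: prod_eq_iff)
  then show ?thesis by blast
qed

lemma range_start:
  assumes "\<kappa> = 0" "\<epsilon> = 4 * \<sigma>\<^sup>2 * (1 - \<sigma>\<^sup>2)" "\<sigma>\<^sup>2 < 1/2"
  shows "range h = {((cos (2 * pi * s), s), of_real x) | s x.
    m - 1/4 < s \<and> s < m + 1/4 \<and> x\<^sup>2 + (cos (2 * pi * s))\<^sup>2 = \<epsilon>}"
proof -
  have r: "fst (fst (h t)) = cos (2 * pi * snd (fst (h t)))" for t
  proof -
    define u' R d where "u' = u t" and "R = \<rho> t" and "d = 1 - \<sigma>\<^sup>2"
    have "d \<noteq> 0" "\<sigma> \<noteq> 0" using \<sigma> by (auto simp: d_def)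
    then show ?thesis unfolding angle(1) h_eq(1) R_def[symmetric]
      unfolding u'_def[symmetric] assms(2) d_def[symmetric]
      by (simp add: field_simps power2_eq_square)
  qed
  have im: "Im (snd (h t)) = 0" for t using h_eq(4)[of t] assms(1) by simp
  then have z: "snd (h t) = of_real (Re (snd (h t)))" for t by (simp add: complex_eq_iff)
  have re: "(Re (snd (h t)))\<^sup>2 + (fst (fst (h t)))\<^sup>2 = \<epsilon>" for t
    using Re_model[of t] unfolding model_eq complex.sel im r[symmetric] by (simp add: power2_eq_square)
  show ?thesis
  proof (intro equalityI subsetI)
    fix q assume "q \<in> range h"
    then obtain t where t: "q = h t" by blast
    have "q = ((cos (2 * pi * snd (fst (h t))), snd (fst (h t))), of_real (Re (snd (h t))))"
      using r z t by (simp add: prod_eq_iff)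
    moreover have "m - 1/4 < snd (fst (h t)) \<and> snd (fst (h t)) < m + 1/4"
      using h_angle_bound(2)[OF assms(3), of t] unfolding abs_less_iff by linarith
    moreover have "(Re (snd (h t)))\<^sup>2 + (cos (2 * pi * snd (fst (h t))))\<^sup>2 = \<epsilon>" using re[of t] r by simp
    ultimately show "q \<in> {((cos (2 * pi * s), s), of_real x) | s x.
      m - 1/4 < s \<and> s < m + 1/4 \<and> x\<^sup>2 + (cos (2 * pi * s))\<^sup>2 = \<epsilon>}" by blast
  next
    fix q :: plane_pt assume "q \<in> {((cos (2 * pi * s), s), of_real x) | s x.
      m - 1/4 < s \<and> s < m + 1/4 \<and> x\<^sup>2 + (cos (2 * pi * s))\<^sup>2 = \<epsilon>}"
    then obtain s x where q: "q = ((cos (2 * pi * s), s), of_real x)" and s: "m - 1/4 < s" "s < m + 1/4"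
      and x: "x\<^sup>2 + (cos (2 * pi * s))\<^sup>2 = \<epsilon>" by blast
    have s': "\<bar>s - m\<bar> \<le> 1/4" using s unfolding abs_le_iff by linarith
    define V S where "V = (sin (pi * (s - m)))\<^sup>2" and "S = \<sigma>\<^sup>2"
    have "(cos (2 * pi * s))\<^sup>2 = 4 * e\<^sup>2 * V * (sqrt (1 - V))\<^sup>2"
      unfolding half_angle(1)[OF s'] V_def by (simp add: power_mult_distrib)
    then have "(cos (2 * pi * s))\<^sup>2 = 4 * V * (1 - V)" using half_angle(2)[OF s'] e_sq V_def by simp
    then have "V * (1 - V) \<le> S * (1 - S)" using x assms(2) zero_le_power2[of x] unfolding S_def by linarith
    then have le: "(V - S) * (1 - V - S) \<le> 0" by (simp add: algebra_simps)
    \<comment> \<open>The function \<open>x * (1 - x)\<close> increases on \<open>[0, 1/2]\<close>,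
      which contains both \<open>V\<close> and \<open>S\<close>.\<close>
    have "V \<le> S"
    proof (rule ccontr)
      assume "\<not> V \<le> S"
      moreover have "1 - V - S > 0" using half_angle(2)[OF s'] assms(3) by (simp add: V_def S_def)
      ultimately have "(V - S) * (1 - V - S) > 0" by (intro mult_pos_pos) auto
      then show False using le by simp
    qed
    then show "q \<in> range h" unfolding q
    proof (intro reach s')
      show "cos (2 * pi * s) = cos (2 * pi * s) * (\<epsilon> / (4 * \<sigma>\<^sup>2 * (1 - \<sigma>\<^sup>2)))"
        unfolding assms(2) using \<sigma> by simp
      fix t assume "fst (h t) = (cos (2 * pi * s), s)"
      then have "(Re (snd (h t)))\<^sup>2 = x\<^sup>2" using re[of t] x by simp
      then have "(of_real (Re (snd (h t))))\<^sup>2 = (of_real x :: complex)\<^sup>2" by (simp flip: of_real_power)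
      then show "(of_real x)\<^sup>2 = (snd (h t))\<^sup>2" using z[of t] by metis
    qed (simp add: V_def S_def)
  qed
qed

lemma range_end:
  assumes "\<kappa> = \<sigma>" "\<sigma>\<^sup>2 = 1/2"
  shows "range h = {((\<epsilon> * cos (2 * pi * s), s), z) | s z.
    m - 1/4 \<le> s \<and> s \<le> m + 1/4 \<and> model ((\<epsilon> * cos (2 * pi * s), s), z) = of_real \<epsilon>}"
proof -
  have m: "model (h t) = of_real \<epsilon>" for t
    using Re_model Im_model_end(1)[OF assms] by (simp add: complex_eq_iff)
  have r: "fst (fst (h t)) = \<epsilon> * cos (2 * pi * snd (fst (h t)))" for t
  proof -
    define u' R where "u' = u t" and "R = \<rho> t"
    have "u' * R * e * \<epsilon> / \<sigma> = u' * R * e * \<epsilon> * (2 * \<sigma>)"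
      using \<sigma> assms(2) by (simp add: field_simps power2_eq_square)
    then show ?thesis unfolding angle(1) h_eq(1) R_def[symmetric] unfolding u'_def[symmetric] assms(2)
      by (simp add: mult_ac)
  qed
  show ?thesis
  proof (intro equalityI subsetI)
    fix q assume "q \<in> range h"
    then obtain t where t: "q = h t" by blast
    have q: "q = ((\<epsilon> * cos (2 * pi * snd (fst (h t))), snd (fst (h t))), snd (h t))"
      using r t by (simp add: prod_eq_iff)
    moreover have "m - 1/4 \<le> snd (fst (h t)) \<and> snd (fst (h t)) \<le> m + 1/4"
      using h_angle_bound(1)[of t] unfolding abs_le_iff by linarith
    moreover have "model q = of_real \<epsilon>" using m t by simp
    ultimately show "q \<in> {((\<epsilon> * cos (2 * pi * s), s), z) | s z.
      m - 1/4 \<le> s \<and> s \<le> m + 1/4 \<and> model ((\<epsilon> * cos (2 * pi * s), s), z) = of_real \<epsilon>}" by force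
  next
    fix q assume "q \<in> {((\<epsilon> * cos (2 * pi * s), s), z) | s z.
      m - 1/4 \<le> s \<and> s \<le> m + 1/4 \<and> model ((\<epsilon> * cos (2 * pi * s), s), z) = of_real \<epsilon>}"
    then obtain s z where q: "q = ((\<epsilon> * cos (2 * pi * s), s), z)" and s: "m - 1/4 \<le> s" "s \<le> m + 1/4"
      and mq: "model q = of_real \<epsilon>" by blast
    have s': "\<bar>s - m\<bar> \<le> 1/4" using s unfolding abs_le_iff by linarith
    show "q \<in> range h" unfolding q
    proof (intro reach s')
      show "(sin (pi * (s - m)))\<^sup>2 \<le> \<sigma>\<^sup>2" using half_angle(2)[OF s'] assms by simp
      show "\<epsilon> * cos (2 * pi * s) = cos (2 * pi * s) * (\<epsilon> / (4 * \<sigma>\<^sup>2 * (1 - \<sigma>\<^sup>2)))"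
        unfolding assms(2) by simp
      fix t assume "fst (h t) = (\<epsilon> * cos (2 * pi * s), s)"
      then have "model (h t) - (snd (h t))\<^sup>2 = model q - z\<^sup>2" by (simp add: model_def q)
      then show "z\<^sup>2 = (snd (h t))\<^sup>2" using mq m[of t] by simp
    qed
  qed
qed

end

lemma smooth_at_circ:
  assumes fam: "circle_family e m \<epsilon> (\<Sigma> x) (K x)"
    and sm: "smooth_at \<Sigma> x" "smooth_at K x" "smooth_at T x"
  shows "smooth_at (\<lambda>x. circ e m \<epsilon> (\<Sigma> x) (K x) (T x)) x"
proof -
  interpret circle_family e m \<epsilon> "\<Sigma> x" "K x" by (rule fam)
  have nz: "\<Sigma> x \<noteq> 0" "1 - (\<Sigma> x)\<^sup>2 \<noteq> 0" using \<sigma> by auto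
  show ?thesis unfolding circ_def Let_def
    by (intro smooth_at_intros sm) (use nz rho_arg p_arg abs_\<sigma>u in simp_all)
qed

lemma smooth_at_frames:
  assumes fam: "circle_family e m \<epsilon> (\<Sigma> x) (K x)"
    and sm: "smooth_at \<Sigma> x" "smooth_at K x" "smooth_at T x"
  shows "smooth_at (\<lambda>x. frame1 e \<epsilon> (\<Sigma> x) (K x) (T x)) x"
    "smooth_at (\<lambda>x. frame2 e \<epsilon> (\<Sigma> x) (T x)) x"
    "smooth_at (\<lambda>x. circ_velocity e \<epsilon> (\<Sigma> x) (K x) (T x)) x"
proof -
  interpret circle_family e m \<epsilon> "\<Sigma> x" "K x" by (rule fam)
  have nz: "\<Sigma> x \<noteq> 0" "1 - (\<Sigma> x)\<^sup>2 \<noteq> 0" using \<sigma> by auto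
  have nz': "\<rho> t \<noteq> 0" "p t \<noteq> 0" for t
    by (rule less_imp_neq[OF rho_pos, symmetric], rule less_imp_neq[OF p_pos, symmetric])
  show "smooth_at (\<lambda>x. frame1 e \<epsilon> (\<Sigma> x) (K x) (T x)) x"
    "smooth_at (\<lambda>x. frame2 e \<epsilon> (\<Sigma> x) (T x)) x"
    "smooth_at (\<lambda>x. circ_velocity e \<epsilon> (\<Sigma> x) (K x) (T x)) x"
    unfolding frame1_def frame2_def circ_velocity_def Let_def
    by (intro smooth_at_intros sm rho_arg p_arg nz nz' no_zero_divisors zero_neq_numeral[symmetric]
        pi_neq_zero power_not_zero)+
qed

section \<open>The isotopy and the framing\<close>

text \<open>\<open>\<omega>\<close> may lie on the boundary circle, where \<open>\<phi>\<close> is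
  known to vanish on one side only. Segments from \<open>\<omega>\<close> to points of the disk show
  that the derivative kills their differences from \<open>\<omega>\<close>, and these span the
  plane.\<close>

lemma frechet_derivative_vanish_on_disk:
  fixes \<phi> :: "complex \<Rightarrow> complex"
  assumes \<phi>: "\<phi> differentiable at \<omega>" and \<omega>: "\<omega> \<in> cball 0 R" and R: "R > 0"
    and 0: "\<And>\<omega>. \<omega> \<in> cball 0 R \<Longrightarrow> \<phi> \<omega> = 0"
  shows "frechet_derivative \<phi> (at \<omega>) v = 0"
proof -
  let ?D = "frechet_derivative \<phi> (at \<omega>)"
  have D: "(\<phi> has_derivative ?D) (at \<omega>)" using \<phi> frechet_derivative_works by blast
  then have lin: "linear ?D" by (rule has_derivative_linear)
  have 1: "?D (\<omega>' - \<omega>) = 0" if \<omega>': "\<omega>' \<in> cball 0 R" for \<omega>'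
  proof -
    let ?l = "\<lambda>s. \<omega> + s *\<^sub>R (\<omega>' - \<omega>)"
    have l: "(?l has_vector_derivative (\<omega>' - \<omega>)) (at 0 within {0..1})"
      by (auto intro!: derivative_eq_intros)
    have "(\<phi> has_derivative ?D) (at (?l 0) within ?l ` {0..1})"
      using has_derivative_at_withinI[OF D] by simp
    from vector_derivative_diff_chain_within[OF l this]
    have "((\<phi> \<circ> ?l) has_vector_derivative ?D (\<omega>' - \<omega>)) (at 0 within {0..1})" .
    moreover have "((\<phi> \<circ> ?l) has_vector_derivative 0) (at 0 within {0..1})"
    proof (rule has_vector_derivative_transform[OF _ _ has_vector_derivative_const])
      fix s :: real assume s: "s \<in> {0..1}"
      have "?l s = (1 - s) *\<^sub>R \<omega> + s *\<^sub>R \<omega>'" by (simp add: algebra_simps)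
      also have "\<dots> \<in> cball 0 R"
        using convexD[OF convex_cball, of \<omega> 0 R \<omega>' "1 - s" s] \<omega> \<omega>' s by simp
      finally show "(\<phi> \<circ> ?l) s = 0" using 0 by simp
    qed simp
    ultimately show ?thesis
      using vector_derivative_unique_within[of 0 "{0..1::real}"] by (simp add: trivial_limit_within islimpt_Icc)
  qed
  have "?D \<omega> = 0" using 1[of 0] R linear_neg[OF lin] by simp
  then have 2: "?D \<omega>' = 0" if "\<omega>' \<in> cball 0 R" for \<omega>' using 1[OF that] linear_diff[OF lin] by simp
  show ?thesis
  proof (cases "v = 0")
    case False
    have "?D ((R / cmod v) *\<^sub>R v) = 0" by (rule 2) (use False R in simp)
    then show ?thesis using False R linear_cmul[OF lin] by simp
  qed (use linear_0[OF lin] in simp)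
qed

lemma parallel_in_kernel:
  fixes a b a' b' \<alpha> \<beta> :: real
  assumes "\<alpha> * a + \<beta> * b = 0" "\<alpha> * a' + \<beta> * b' = 0" "\<alpha> \<noteq> 0 \<or> \<beta> \<noteq> 0" "a' \<noteq> 0 \<or> b' \<noteq> 0"
  shows "\<exists>k. a = k * a' \<and> b = k * b'"
proof -
  have "\<alpha> * (a * b' - a' * b) = b' * (\<alpha> * a + \<beta> * b) - b * (\<alpha> * a' + \<beta> * b')" by (simp add: algebra_simps)
  then have 1: "\<alpha> * (a * b' - a' * b) = 0" using assms(1,2) by simp
  have "\<beta> * (a * b' - a' * b) = a * (\<alpha> * a' + \<beta> * b') - a' * (\<alpha> * a + \<beta> * b)" by (simp add: algebra_simps)
  then have "\<beta> * (a * b' - a' * b) = 0" using assms(1,2) by simp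
  with 1 have det: "a * b' = a' * b" using assms(3) by auto
  show ?thesis
  proof (cases "a' = 0")
    case True
    then show ?thesis using det assms(4) by (intro exI[of _ "b / b'"]) auto
  next
    case False
    then show ?thesis using det by (intro exI[of _ "a / a'"]) (auto simp: field_simps)
  qed
qed

lemma carr_prod_mfd: "carr (prod_mfd X Y) = carr X \<times> carr Y"
proof (intro equalityI subsetI)
  fix q assume "q \<in> carr X \<times> carr Y"
  then obtain c d where c: "c \<in> X" "d \<in> Y" "q \<in> fst c \<times> fst d" by (auto simp: carr_def)
  then show "q \<in> carr (prod_mfd X Y)" unfolding carr_def by (intro UN_I[OF prod_mfdI[OF c(1,2)]]) simp
qed (auto simp: carr_def prod_mfd_def)

lemma diffeo_ident:
  assumes inj: "\<And>c. c \<in> X \<Longrightarrow> inj_on (snd c) (fst c)" and "smooth_transitions X"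
  shows "diffeo (sub X F) (sub X F) (\<lambda>x. x)"
proof -
  \<comment> \<open>\<open>g\<close> is the identity on the carrier only, so that
    \<open>inv_into\<close> of the identity is covered too.\<close>
  have sm: "smooth_map (sub X F) (sub X F) g" if g: "\<And>x. x \<in> carr (sub X F) \<Longrightarrow> g x = x" for g
    unfolding smooth_map_def
  proof (intro conjI ballI)
    have "{x \<in> carr (sub X F). g x \<in> W} = W" if "openin (mtop (sub X F)) W" for W
      using that g by (auto simp: openin_mtop_iff)
    then show "continuous_map (mtop (sub X F)) (mtop (sub X F)) g"
      unfolding continuous_map topspace_mtop using g by auto
    fix c' d' assume c': "c' \<in> sub X F" and "d' \<in> sub X F"
    then obtain c d where c: "c \<in> X" "d \<in> X" "c' = (fst c \<inter> F, snd c)" "d' = (fst d \<inter> F, snd d)"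
      by (auto simp: sub_def)
    have gc: "g x = x" if "x \<in> fst c'" for x using g c' that by (auto simp: carr_def)
    have inj': "inj_on (snd c') (fst c')" using inj_on_subset[OF inj[OF c(1)], of "fst c \<inter> F"] c(3) by simp
    have "smooth_on (snd c ` (fst c \<inter> fst d)) (in_chart c (snd d))"
      using assms(2) c unfolding smooth_transitions_def by blast
    then show "smooth_on (snd c' ` (fst c' \<inter> g -` fst d')) (in_chart c' (snd d' \<circ> g))"
    proof (rule smooth_on_subset_cong)
      show "snd c' ` (fst c' \<inter> g -` fst d') \<subseteq> snd c ` (fst c \<inter> fst d)"
        using gc c(3,4) by force
      fix y assume "y \<in> snd c' ` (fst c' \<inter> g -` fst d')"
      then obtain x where x: "x \<in> fst c'" "y = snd c' x" by blast
      have "in_chart c' (snd d' \<circ> g) y = (snd d' \<circ> g) x" unfolding x(2) by (rule in_chart_apply[OF inj' x(1)])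
      moreover have "in_chart c (snd d) (snd c x) = snd d x"
        by (rule in_chart_apply[OF inj[OF c(1)]]) (use x c in auto)
      ultimately show "in_chart c (snd d) y = in_chart c' (snd d' \<circ> g) y" using x gc c by simp
    qed
  qed
  have "smooth_map (sub X F) (sub X F) (inv_into (carr (sub X F)) (\<lambda>x. x))"
    by (rule sm) (simp add: inv_into_f_eq)
  then show ?thesis unfolding diffeo_def using sm by (simp add: bij_betw_def)
qed

lemma ambient_isotopy_const:
  assumes inj: "\<And>c. c \<in> X \<Longrightarrow> inj_on (snd c) (fst c)" and "smooth_transitions X"
  shows "ambient_isotopy X F (\<lambda>\<tau> x. x)"
  unfolding ambient_isotopy_def
proof (intro conjI ballI)
  show "diffeo (sub X F) (sub X F) (\<lambda>x. x)" by (rule diffeo_ident) fact+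
  let ?P = "prod_mfd (euclid {0..1::real}) (sub X F)" and ?g = "\<lambda>(\<tau>, x). x :: 'a"
  have P: "\<exists>c\<in>X. c' = ({0..1} \<times> (fst c \<inter> F), map_prod id (snd c))" if "c' \<in> ?P" for c'
    using that by (auto simp: prod_mfd_def euclid_def sub_def)
  have carrP: "carr ?P = {0..1} \<times> carr (sub X F)"
    by (simp add: carr_prod_mfd)
  show "smooth_map ?P (sub X F) ?g"
    unfolding smooth_map_def
  proof (intro conjI ballI)
    show "continuous_map (mtop ?P) (mtop (sub X F)) ?g"
      unfolding continuous_map topspace_mtop carrP
    proof (intro conjI allI impI)
      fix W assume W: "openin (mtop (sub X F)) W"
      then have eq: "{q \<in> {0..1} \<times> carr (sub X F). ?g q \<in> W} = {0..1} \<times> W"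
        by (auto simp: openin_mtop_iff)
      show "openin (mtop ?P) {q \<in> {0..1} \<times> carr (sub X F). ?g q \<in> W}"
        unfolding eq unfolding openin_mtop_iff carrP
      proof (intro conjI ballI)
        show "{0..1} \<times> W \<subseteq> {0..1} \<times> carr (sub X F)" using W by (auto simp: openin_mtop_iff)
        fix c' p assume "c' \<in> ?P" and p: "p \<in> {0..1} \<times> W \<inter> fst c'"
        then obtain c where c: "c \<in> X" "c' = ({0..1} \<times> (fst c \<inter> F), map_prod id (snd c))" using P by blast
        then have cF: "(fst c \<inter> F, snd c) \<in> sub X F" by (auto simp: sub_def)
        obtain \<tau> x where \<tau>x: "p = (\<tau>, x)" by (metis surj_pair)
        from bspec[OF conjunct2[OF W[unfolded openin_mtop_iff]] cF]
        have "\<forall>\<^sub>F y in nhds (snd c x). \<forall>p'\<in>fst c \<inter> F. snd c p' = y \<longrightarrow> p' \<in> W"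
          using p c(2) \<tau>x by auto
        then have "\<forall>\<^sub>F q in nhds (\<tau>, snd c x). \<forall>p'\<in>fst c \<inter> F. snd c p' = snd q \<longrightarrow> p' \<in> W"
          by (intro eventually_isCont_compose[where f = snd and x = "(\<tau>, snd c x)"
                and P = "\<lambda>y. \<forall>p'\<in>fst c \<inter> F. snd c p' = y \<longrightarrow> p' \<in> W"]) (simp_all add: isCont_snd)
        then show "\<forall>\<^sub>F q in nhds (snd c' p). \<forall>p'\<in>fst c'. snd c' p' = q \<longrightarrow> p' \<in> {0..1} \<times> W"
          using c(2) \<tau>x by (auto elim!: eventually_mono)
      qed
    qed auto
    fix c' d' assume c': "c' \<in> ?P" and "d' \<in> sub X F"
    then obtain d where d: "d \<in> X" "d' = (fst d \<inter> F, snd d)" by (auto simp: sub_def)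
    obtain c where "c \<in> X" "c' = ({0..1} \<times> (fst c \<inter> F), map_prod id (snd c))" using P[OF c'] by blast
    note c = this(1) d(1) this(2) d(2)
    have inj': "inj_on (snd c') (fst c')"
      using inj[OF c(1)] unfolding c(3) by (auto simp: inj_on_def)
    show "smooth_on (snd c' ` (fst c' \<inter> ?g -` fst d')) (in_chart c' (snd d' \<circ> ?g))"
      unfolding smooth_on_iff
    proof
      fix y assume "y \<in> snd c' ` (fst c' \<inter> ?g -` fst d')"
      then have y: "snd y \<in> snd c ` (fst c \<inter> fst d)" using c by auto
      have "smooth_on (snd c ` (fst c \<inter> fst d)) (in_chart c (snd d))"
        using assms(2) c unfolding smooth_transitions_def by blast
      then obtain g where g: "smooth_at g (snd y)"
        "\<forall>\<^sub>F x in nhds (snd y). x \<in> snd c ` (fst c \<inter> fst d) \<longrightarrow> g x = in_chart c (snd d) x"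
        using y unfolding smooth_on_iff by blast
      have "smooth_at (\<lambda>q. g (snd q)) y"
        by (rule smooth_at_compose[OF smooth_at_linear[OF bounded_linear_snd] g(1)])
      moreover have "isCont snd y" by (intro continuous_intros)
      from eventually_isCont_compose[OF this g(2)]
      have "\<forall>\<^sub>F q in nhds y. q \<in> snd c' ` (fst c' \<inter> ?g -` fst d') \<longrightarrow> g (snd q) = in_chart c' (snd d' \<circ> ?g) q"
      proof eventually_elim
        case (elim q)
        show ?case
        proof
          assume "q \<in> snd c' ` (fst c' \<inter> ?g -` fst d')"
          then obtain z where z: "z \<in> fst c'" "?g z \<in> fst d'" "q = snd c' z" by auto
          have "in_chart c' (snd d' \<circ> ?g) q = (snd d' \<circ> ?g) z"
            unfolding z(3) by (rule in_chart_apply[OF inj' z(1)])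
          moreover have "in_chart c (snd d) (snd c (snd z)) = snd d (snd z)"
            by (rule in_chart_apply[OF inj[OF c(1)]]) (use z c in auto)
          moreover have "snd q = snd c (snd z)" "snd z \<in> fst c \<inter> fst d" using z c by (auto simp: case_prod_beta)
          ultimately show "g (snd q) = in_chart c' (snd d' \<circ> ?g) q" using elim c by (auto simp: case_prod_beta)
        qed
      qed
      ultimately show "\<exists>h. smooth_at h y \<and> (\<forall>\<^sub>F q in nhds y. q \<in> snd c' ` (fst c' \<inter> ?g -` fst d') \<longrightarrow>
          h q = in_chart c' (snd d' \<circ> ?g) q)" by blast
    qed
  qed
qed simp

text \<open>The last equation makes the factor between \<open>r\<close> and
  \<open>cos (2 * pi * s)\<close> equal to 1 at \<open>\<sigma>0\<close>, as the attaching circle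
  requires. The bound by \<open>\<delta>\<^sup>2\<close> confines the isotopy to the tube.\<close>

locale attaching_setup = annulus_param X \<delta> J N \<Phi> f \<theta>
  for X :: "('x, 'e::euclidean_space) atlas" and \<delta> J N \<Phi> f \<theta> +
  fixes e m \<epsilon> \<sigma>0 :: real
  assumes cos_m: "cos (2 * pi * m) = 0" and sin_m: "sin (2 * pi * m) = e"
    and eps: "\<epsilon> > 0" "8 * \<epsilon> < \<delta>\<^sup>2" and \<sigma>0: "\<sigma>0 > 0" "\<sigma>0\<^sup>2 < 1/2" and \<epsilon>_eq: "\<epsilon> = 4 * \<sigma>0\<^sup>2 * (1 - \<sigma>0\<^sup>2)"
begin

definition \<Sigma> :: "real \<Rightarrow> real" where "\<Sigma> \<tau> = \<sigma>0 + \<tau> * (sqrt (1/2) - \<sigma>0)"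
definition K :: "real \<Rightarrow> real" where "K \<tau> = \<tau> * sqrt (1/2)"
definition hh :: "real \<Rightarrow> real \<Rightarrow> plane_pt" where "hh \<tau> = circ e m \<epsilon> (\<Sigma> \<tau>) (K \<tau>)"
definition H :: "real \<Rightarrow> real \<Rightarrow> 'x" where "H \<tau> t = J (hh \<tau> t)"

lemma \<sigma>0_le: "\<sigma>0 \<le> sqrt (1/2)"
  using real_le_rsqrt[of \<sigma>0 "1/2"] \<sigma>0 by simp

lemma \<Sigma>_ge: assumes "\<tau> \<in> {0..1}" shows "\<sigma>0 \<le> \<Sigma> \<tau>"
  unfolding \<Sigma>_def using assms \<sigma>0_le by simp

text \<open>Both parameters move linearly and at the same time: the alternative in
  \<open>circle_family\<close> holds at the start by \<open>\<sigma>0\<^sup>2 < 1/2\<close> and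
  afterwards because \<open>K \<tau> \<noteq> 0\<close>.\<close>

lemma family: assumes \<tau>: "\<tau> \<in> {0..1}" shows "circle_family e m \<epsilon> (\<Sigma> \<tau>) (K \<tau>)"
proof
  show pos: "\<Sigma> \<tau> > 0" using \<Sigma>_ge[OF \<tau>] \<sigma>0 by simp
  have "\<tau> * (sqrt (1/2) - \<sigma>0) \<le> 1 * (sqrt (1/2) - \<sigma>0)" using \<tau> \<sigma>0_le by (intro mult_right_mono) auto
  then have "\<Sigma> \<tau> \<le> sqrt (1/2)" unfolding \<Sigma>_def by simp
  then have "(\<Sigma> \<tau>)\<^sup>2 \<le> (sqrt (1/2))\<^sup>2" using pos by (intro power_mono) auto
  then show "(\<Sigma> \<tau>)\<^sup>2 \<le> 1/2" by (simp add: power_divide)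
  have "\<tau>\<^sup>2 \<le> 1" using \<tau> by (simp add: power_le_one)
  then show "(K \<tau>)\<^sup>2 \<le> 1/2" unfolding K_def by (simp add: power_mult_distrib power_divide)
  show "(\<Sigma> \<tau>)\<^sup>2 < 1/2 \<or> K \<tau> \<noteq> 0"
    using \<sigma>0(2) by (cases "\<tau> = 0") (simp_all add: \<Sigma>_def K_def)
qed (use cos_m sin_m eps in auto)

lemma start: "\<Sigma> 0 = \<sigma>0" "K 0 = 0" and finish: "\<Sigma> 1 = sqrt (1/2)" "K 1 = sqrt (1/2)"
  by (simp_all add: \<Sigma>_def K_def)

lemma family0: "circle_family e m \<epsilon> \<sigma>0 0" and family1: "circle_family e m \<epsilon> (sqrt (1/2)) (sqrt (1/2))"
  using family[of 0] family[of 1] unfolding start finish by simp_all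

lemma sqrt_\<epsilon>_less: "sqrt \<epsilon> < \<delta>" "\<epsilon> < \<delta>\<^sup>2"
proof -
  show 1: "\<epsilon> < \<delta>\<^sup>2" using eps by simp
  show "sqrt \<epsilon> < \<delta>" using real_sqrt_less_mono[OF 1] \<delta>_pos by simp
qed

text \<open>The bound \<open>\<epsilon> / \<Sigma> \<tau>\<close> for \<open>\<bar>r\<bar>\<close>
  is largest at the start, where it is at most \<open>4 * \<sigma>0\<close>. Since
  \<open>\<epsilon> \<ge> 2 * \<sigma>0\<^sup>2\<close>, the square of this is at most
  \<open>8 * \<epsilon>\<close>; this is where the constant 8 comes from. The estimate of
  \<open>z\<close> by \<open>2 * \<epsilon>\<close> is weaker.\<close>

lemma hh_tube: assumes \<tau>: "\<tau> \<in> {0..1}" shows "hh \<tau> t \<in> tube \<delta>"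
proof -
  interpret circle_family e m \<epsilon> "\<Sigma> \<tau>" "K \<tau>" by (rule family[OF \<tau>])
  have "\<epsilon> / \<Sigma> \<tau> \<le> \<epsilon> / \<sigma>0" by (intro divide_left_mono) (use \<Sigma>_ge[OF \<tau>] \<sigma>0 \<sigma> eps in auto)
  also have "\<dots> = 4 * \<sigma>0 * (1 - \<sigma>0\<^sup>2)" unfolding \<epsilon>_eq using \<sigma>0 by (simp add: field_simps power2_eq_square)
  also have "\<dots> \<le> 4 * \<sigma>0 * 1" using \<sigma>0 by (intro mult_left_mono) auto
  finally have le: "\<bar>fst (fst (hh \<tau> t))\<bar> \<le> 4 * \<sigma>0" using h_bounds(1)[of t] unfolding hh_def by simp
  have "\<sigma>0\<^sup>2 * 2 * 1 \<le> \<sigma>0\<^sup>2 * 2 * (2 * (1 - \<sigma>0\<^sup>2))" using \<sigma>0 by (intro mult_left_mono) auto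
  then have "(4 * \<sigma>0)\<^sup>2 \<le> 8 * \<epsilon>" unfolding \<epsilon>_eq by (simp add: power_mult_distrib algebra_simps)
  then have "(4 * \<sigma>0)\<^sup>2 < \<delta>\<^sup>2" using eps(2) by linarith
  then have "4 * \<sigma>0 < \<delta>" by (rule power2_less_imp_less) (use \<delta>_pos in auto)
  moreover have "(cmod (snd (hh \<tau> t)))\<^sup>2 < \<delta>\<^sup>2" using h_bounds(2)[of t] eps unfolding hh_def by simp
  then have "cmod (snd (hh \<tau> t)) < \<delta>" by (rule power2_less_imp_less) (use \<delta>_pos in auto)
  ultimately show ?thesis using le by (simp add: mem_tube)
qed

lemma smooth_\<Sigma>K:
  "smooth_at (\<lambda>p. \<Sigma> (fst p)) (p :: real \<times> real)" "smooth_at (\<lambda>p. K (fst p)) (p :: real \<times> real)"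
  "smooth_at (\<lambda>p. snd p) (p :: real \<times> real)"
  unfolding \<Sigma>_def K_def by (intro smooth_at_intros)+

lemma smooth_hh: assumes "fst p \<in> {0..1}" shows "smooth_at (\<lambda>p. hh (fst p) (snd p)) p"
  unfolding hh_def by (rule smooth_at_circ[OF family[OF assms] smooth_\<Sigma>K])

lemma smooth_hh_t: assumes "\<tau> \<in> {0..1}" shows "smooth_at (hh \<tau>) t"
  unfolding hh_def by (rule smooth_at_circ[OF family[OF assms] smooth_at_const smooth_at_const smooth_at_id])

lemma smooth_H: assumes "S \<subseteq> {0..1} \<times> UNIV" shows "smooth_map (euclid S) X (\<lambda>(\<tau>, t). H \<tau> t)"
  by (rule smooth_map_param[of _ "\<lambda>p. hh (fst p) (snd p)"])
    (use assms smooth_hh hh_tube in \<open>auto simp: H_def case_prod_beta subset_iff\<close>)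

lemma embedded_H: assumes \<tau>: "\<tau> \<in> {0..1}" shows "embedded_circle X (H \<tau>)"
  unfolding embedded_circle_def
proof (intro conjI allI ballI impI)
  interpret circle_family e m \<epsilon> "\<Sigma> \<tau>" "K \<tau>" by (rule family[OF \<tau>])
  show "smooth_map (euclid UNIV) X (H \<tau>)"
    by (rule smooth_map_param[of _ "hh \<tau>"]) (use smooth_hh_t[OF \<tau>] hh_tube[OF \<tau>] in \<open>auto simp: H_def\<close>)
  show "H \<tau> (t + 1) = H \<tau> t" for t unfolding H_def hh_def h_periodic ..
  show "inj_on (H \<tau>) {0..<1}"
  proof (rule inj_onI)
    fix t t' assume t: "t \<in> {0..<1}" "t' \<in> {0..<1}" and "H \<tau> t = H \<tau> t'"
    then have "QA (hh \<tau> t) = QA (hh \<tau> t')" using \<Phi>_J[OF hh_tube[OF \<tau>]] unfolding H_def by metis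
    then show "t = t'" using h_inj[OF t] unfolding hh_def by blast
  qed
  fix t c assume c: "c \<in> X" "H \<tau> t \<in> fst c"
  have Jc: "J (hh \<tau> t) \<in> fst c" using c by (simp add: H_def)
  have "vector_derivative (snd c \<circ> H \<tau>) (at t) = push (hh \<tau> t) (h' t) c"
    using vector_derivative_at[OF push_has_vector_derivative[OF c(1) hh_tube[OF \<tau>] Jc h_velocity[folded hh_def]]]
    by (simp add: H_def[abs_def])
  then show "vector_derivative (snd c \<circ> H \<tau>) (at t) \<noteq> 0"
    using push_eq_0[OF c(1) hh_tube[OF \<tau>] Jc] h'_neq_0 by metis
qed

lemma isotopy: "circle_isotopy X {x \<in> carr X. cmod (f x) = 1/2 - \<epsilon>} H"
  unfolding circle_isotopy_def
proof (intro conjI ballI)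
  fix \<tau> :: real assume \<tau>: "\<tau> \<in> {0..1}"
  interpret circle_family e m \<epsilon> "\<Sigma> \<tau>" "K \<tau>" by (rule family[OF \<tau>])
  show "embedded_circle X (H \<tau>)" by (rule embedded_H[OF \<tau>])
  show "range (H \<tau>) \<subseteq> {x \<in> carr X. cmod (f x) = 1/2 - \<epsilon>}"
    using J_carr[OF hh_tube[OF \<tau>]] cmod_f_J[OF hh_tube[OF \<tau>]] Re_model
    by (auto simp: H_def hh_def)
qed (rule smooth_H, simp)

text \<open>\<open>P\<close> stands for being equal to \<open>\<epsilon>\<close> or at most
  \<open>\<epsilon>\<close>, so that attaching circle and core disk are treated together; its bound
  puts all points in question into the tube, where \<open>J_unique\<close> applies.\<close>

lemma core_image:
  assumes P: "\<And>y. P y \<Longrightarrow> y \<le> \<epsilon>"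
  shows "{p \<in> N. \<exists>x s :: real. m - 1/4 < s \<and> s < m + 1/4 \<and> P (x\<^sup>2 + (cos (2 * pi * s))\<^sup>2) \<and>
      \<Phi> p = (A_class (cos (2 * pi * s)) s, of_real x)}
    = J ` {((cos (2 * pi * s), s), of_real x) | s x. m - 1/4 < s \<and> s < m + 1/4 \<and>
      P (x\<^sup>2 + (cos (2 * pi * s))\<^sup>2)}" (is "?L = J ` ?R")
proof -
  have tube: "((cos (2 * pi * s), s), of_real x) \<in> tube \<delta>" if "P (x\<^sup>2 + (cos (2 * pi * s))\<^sup>2)" for x s
  proof -
    have "(cos (2 * pi * s))\<^sup>2 < \<delta>\<^sup>2" "x\<^sup>2 < \<delta>\<^sup>2"
      using P[OF that] sqrt_\<epsilon>_less zero_le_power2[of x] zero_le_power2[of "cos (2 * pi * s)"] by linarith+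
    then have "\<bar>cos (2 * pi * s)\<bar>\<^sup>2 < \<delta>\<^sup>2" "\<bar>x\<bar>\<^sup>2 < \<delta>\<^sup>2" by simp_all
    from power2_less_imp_less[OF this(1)] power2_less_imp_less[OF this(2)]
    show ?thesis using \<delta>_pos by (simp add: mem_tube)
  qed
  show ?thesis
  proof (intro equalityI subsetI)
    fix p assume "p \<in> ?L"
    then obtain x s where p: "p \<in> N" "m - 1/4 < s" "s < m + 1/4" "P (x\<^sup>2 + (cos (2 * pi * s))\<^sup>2)"
      "\<Phi> p = QA ((cos (2 * pi * s), s), of_real x)" by (auto simp: QA_def)
    then have "p = J ((cos (2 * pi * s), s), of_real x)" using J_unique[OF tube] by blast
    then show "p \<in> J ` ?R" using p by blast
  next
    fix p assume "p \<in> J ` ?R"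
    then obtain x s where s: "m - 1/4 < s" "s < m + 1/4" "P (x\<^sup>2 + (cos (2 * pi * s))\<^sup>2)"
      and p: "p = J ((cos (2 * pi * s), s), of_real x)" by blast
    have "p \<in> N" "\<Phi> p = (A_class (cos (2 * pi * s)) s, of_real x)"
      unfolding p using J_N[OF tube[OF s(3)]] \<Phi>_J[OF tube[OF s(3)]] by (simp_all add: QA_def)
    then show "p \<in> ?L" using s by blast
  qed
qed

lemma range_H_start: "range (H 0) = attaching_circle N \<Phi> \<epsilon> (m - 1/4) (m + 1/4)"
proof -
  interpret circle_family e m \<epsilon> \<sigma>0 0 by (rule family0)
  have "range (H 0) = J ` range (hh 0)" by (auto simp: H_def)
  also have "\<dots> = attaching_circle N \<Phi> \<epsilon> (m - 1/4) (m + 1/4)"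
    unfolding attaching_circle_def hh_def start range_start[OF refl \<epsilon>_eq \<sigma>0(2)]
    by (rule core_image[symmetric]) simp
  finally show ?thesis .
qed

lemma range_H_end: "range (H 1) = standard_curve N \<Phi> \<epsilon> (m - 1/4) (m + 1/4)"
  and f_H_end: "f (H 1 t) = \<theta> (of_real \<epsilon>)"
proof -
  interpret circle_family e m \<epsilon> "sqrt (1/2)" "sqrt (1/2)" by (rule family1)
  have half: "(sqrt (1/2))\<^sup>2 = (1/2 :: real)" by (simp add: power_divide)
  have model: "model (hh 1 t) = of_real \<epsilon>" for t
    unfolding hh_def finish using Re_model Im_model_end(1)[OF refl half] by (simp add: complex_eq_iff)
  show "f (H 1 t) = \<theta> (of_real \<epsilon>)"
    unfolding H_def using f_J[OF hh_tube, of 1] model by simp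
  \<comment> \<open>The fiber equation alone gives
    \<open>(cmod z)\<^sup>2 \<le> \<epsilon> + \<epsilon>\<close>, hence the standard curve lies in
    the tube completely and no point of it in \<open>N\<close> is missed by
    \<open>J\<close>.\<close>
  have tube: "((\<epsilon> * cos (2 * pi * s), s), z) \<in> tube \<delta>"
    if mz: "model ((\<epsilon> * cos (2 * pi * s), s), z) = of_real \<epsilon>" for s z
  proof -
    \<comment> \<open>Here \<open>1 - \<epsilon>\<close> is the square of
      \<open>1 - 2 * \<sigma>0\<^sup>2\<close>, which is nonzero.\<close>
    have "\<epsilon> < 1" using \<epsilon>_eq \<sigma>0 sum_squares_gt_zero_iff[of "1 - 2 * \<sigma>0\<^sup>2" 0]
      by (simp add: algebra_simps power2_eq_square)
    then have "\<epsilon>\<^sup>2 \<le> \<epsilon> * 1" unfolding power2_eq_square using eps by (intro mult_left_mono) auto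
    then have "\<epsilon>\<^sup>2 < \<delta>\<^sup>2" using sqrt_\<epsilon>_less by simp
    then have "\<epsilon> < \<delta>" by (rule power2_less_imp_less) (use \<delta>_pos in auto)
    moreover have "\<bar>\<epsilon> * cos (2 * pi * s)\<bar> \<le> \<epsilon> * 1" unfolding abs_mult using eps by (intro mult_mono) auto
    ultimately have 1: "\<bar>\<epsilon> * cos (2 * pi * s)\<bar> < \<delta>" by simp
    let ?E = "of_real (\<epsilon> * cos (2 * pi * s)) * exp (of_real (2 * pi * s) * \<i>)"
    have "z\<^sup>2 = of_real \<epsilon> - ?E" using mz unfolding model_def by (simp add: algebra_simps)
    then have "cmod (z\<^sup>2) \<le> cmod (of_real \<epsilon>) + cmod ?E" using norm_triangle_ineq4 by metis
    also have "cmod ?E = \<bar>\<epsilon> * cos (2 * pi * s)\<bar>"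
      unfolding norm_mult norm_of_real by (simp add: norm_exp_eq_Re)
    finally have "(cmod z)\<^sup>2 \<le> 2 * \<epsilon>"
      using \<open>\<bar>\<epsilon> * cos (2 * pi * s)\<bar> \<le> \<epsilon> * 1\<close> eps by (simp add: norm_power)
    then have "(cmod z)\<^sup>2 < \<delta>\<^sup>2" using eps by simp
    then have "cmod z < \<delta>" by (rule power2_less_imp_less) (use \<delta>_pos in auto)
    then show ?thesis using 1 by (simp add: mem_tube)
  qed
  have "range (H 1) = J ` range (hh 1)" by (auto simp: H_def)
  also have "range (hh 1) = {((\<epsilon> * cos (2 * pi * s), s), z) | s z.
    m - 1/4 \<le> s \<and> s \<le> m + 1/4 \<and> model ((\<epsilon> * cos (2 * pi * s), s), z) = of_real \<epsilon>}" (is "_ = ?R")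
    unfolding hh_def finish by (rule range_end[OF refl half])
  also have "J ` ?R = standard_curve N \<Phi> \<epsilon> (m - 1/4) (m + 1/4)"
  proof (intro equalityI subsetI)
    fix p assume "p \<in> J ` ?R"
    then obtain s z where s: "m - 1/4 \<le> s" "s \<le> m + 1/4"
      "model ((\<epsilon> * cos (2 * pi * s), s), z) = of_real \<epsilon>" "p = J ((\<epsilon> * cos (2 * pi * s), s), z)" by blast
    then have "p \<in> N" "\<Phi> p = QA ((\<epsilon> * cos (2 * pi * s), s), z)" using J_N[OF tube] \<Phi>_J[OF tube] by auto
    then show "p \<in> standard_curve N \<Phi> \<epsilon> (m - 1/4) (m + 1/4)"
      unfolding standard_curve_def arc_def using s F_a_QA by (auto simp: QA_def)
  next
    fix p assume "p \<in> standard_curve N \<Phi> \<epsilon> (m - 1/4) (m + 1/4)"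
    then obtain s where p: "p \<in> N" "F_a (\<Phi> p) = of_real \<epsilon>" "m - 1/4 \<le> s" "s \<le> m + 1/4"
      "fst (\<Phi> p) = A_class (\<epsilon> * cos (2 * pi * s)) s" unfolding standard_curve_def arc_def by auto
    let ?q = "((\<epsilon> * cos (2 * pi * s), s), snd (\<Phi> p))"
    have \<Phi>p: "\<Phi> p = QA ?q" using p(5) by (simp add: QA_def prod_eq_iff)
    then have "model ?q = of_real \<epsilon>" using p(2) F_a_QA by metis
    moreover from this have "p = J ?q" using J_unique[OF tube p(1) \<Phi>p] by blast
    ultimately show "p \<in> J ` ?R" using p by blast
  qed
  finally show "range (H 1) = standard_curve N \<Phi> \<epsilon> (m - 1/4) (m + 1/4)" .
qed

end

text \<open>The components normal to the core disk \<open>r = cos (2 \<pi> s)\<close>, \<open>Im z = 0\<close>.\<close>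

definition normal_part :: "plane_pt \<Rightarrow> plane_pt \<Rightarrow> complex" where
  "normal_part q v = Complex (fst (fst v) + sin (2 * pi * snd (fst q)) * (2 * pi * snd (fst v))) (Im (snd v))"

lemma linear_normal_part: "linear (normal_part q)"
  by (rule linearI) (simp_all add: normal_part_def complex_eq_iff algebra_simps)

section \<open>The core disk and its Morse chart\<close>

context attaching_setup
begin

lemma e_sq: "e\<^sup>2 = 1"
  using sin_cos_squared_add[of "2 * pi * m"] cos_m sin_m by simp

lemma e_mult: "e * (e * x) = x"
  using e_sq by (simp add: power2_eq_square flip: mult.assoc)

lemma sin_shift: "sin (2 * pi * (s - m)) = - e * cos (2 * pi * s)"
  using cos_m sin_m by (simp add: right_diff_distrib sin_diff)

text \<open>On this part of the tube \<open>s\<close> is recovered from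
  \<open>cos (2 * pi * s)\<close> by \<open>arcsin\<close>, so the Morse coordinates are invertible;
  it is also narrower than a period, so \<open>J\<close> is injective.\<close>

definition W :: "plane_pt set" where
  "W = {q \<in> tube \<delta>. \<bar>snd (fst q) - m\<bar> < 1/4}"

lemma open_W: "open W"
proof -
  have "W = tube \<delta> \<inter> {q. \<bar>snd (fst q) - m\<bar> < 1/4}" by (auto simp: W_def)
  moreover have "open {q :: plane_pt. \<bar>snd (fst q) - m\<bar> < 1/4}"
    by (intro open_Collect_less continuous_intros)
  ultimately show ?thesis using open_tube by auto
qed

lemma W_tube: "W \<subseteq> tube \<delta>"
  by (auto simp: W_def)

lemma inj_W: "inj_on J W"
proof (rule inj_onI)
  fix q q' assume q: "q \<in> W" "q' \<in> W" and "J q = J q'"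
  then have eq: "QA q = QA q'" using \<Phi>_J W_tube by (metis subsetD)
  obtain n :: int where n: "snd (fst q') = snd (fst q) + of_int n" using QA_eqD(2)[OF eq] by blast
  have "\<bar>of_int n :: real\<bar> < 1" using q n unfolding W_def mem_Collect_eq by linarith
  then have "n = 0" by (rule abs_of_int_less_1)
  then show "q = q'" using n QA_eqD[OF eq] by (simp add: prod_eq_iff)
qed

lemma W_arcsin:
  assumes "\<bar>s - m\<bar> < 1/4"
  shows "arcsin (- e * cos (2 * pi * s)) = 2 * pi * (s - m)" "\<bar>cos (2 * pi * s)\<bar> < 1"
proof -
  define x where "x = 2 * pi * (s - m)"
  have "2 * pi * \<bar>s - m\<bar> < 2 * pi * (1/4)" using assms by (intro mult_strict_left_mono) auto
  then have x: "\<bar>x\<bar> < pi / 2" by (simp add: abs_mult x_def)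
  have sx: "sin x = - e * cos (2 * pi * s)" unfolding x_def by (rule sin_shift)
  show "arcsin (- e * cos (2 * pi * s)) = 2 * pi * (s - m)"
    unfolding sx[symmetric] x_def[symmetric] by (rule arcsin_sin) (use x in \<open>auto simp: abs_less_iff\<close>)
  have "cos x > 0" by (rule cos_gt_zero_pi) (use x in \<open>auto simp: abs_less_iff\<close>)
  then have "(sin x)\<^sup>2 < 1" by (simp add: sin_squared_eq)
  then have "\<bar>sin x\<bar> < 1" by (simp add: abs_square_less_1)
  moreover have "\<bar>e\<bar> = 1" using e_sq by (simp add: abs_square_eq_1)
  ultimately show "\<bar>cos (2 * pi * s)\<bar> < 1" unfolding sx by (simp add: abs_mult)
qed

text \<open>The core disk parametrized by \<open>r\<close> and the real coordinate \<open>x\<close>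
  as real and imaginary part of \<open>\<omega>\<close>: it is the zero section of the Morse chart
  defined below, and the circles about 0 are its level curves.\<close>

definition disk :: "complex \<Rightarrow> plane_pt" where
  "disk \<omega> = ((Re \<omega>, m + arcsin (- e * Re \<omega>) / (2 * pi)), of_real (Im \<omega>))"

lemma disk_angle:
  assumes "\<bar>Re \<omega>\<bar> < 1"
  shows "cos (2 * pi * snd (fst (disk \<omega>))) = Re \<omega>"
    "sin (2 * pi * snd (fst (disk \<omega>))) = e * sqrt (1 - (Re \<omega>)\<^sup>2)"
    "\<bar>snd (fst (disk \<omega>)) - m\<bar> < 1/4"
proof -
  define \<alpha> where "\<alpha> = arcsin (- e * Re \<omega>)"
  have abs: "\<bar>e * Re \<omega>\<bar> < 1" using assms e_sq by (simp add: abs_mult abs_square_eq_1)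
  have eq: "2 * pi * snd (fst (disk \<omega>)) = 2 * pi * m + \<alpha>" unfolding disk_def \<alpha>_def by (simp add: field_simps)
  have s: "sin \<alpha> = - e * Re \<omega>" unfolding \<alpha>_def by (rule sin_arcsin) (use abs in \<open>auto simp: abs_less_iff\<close>)
  have c: "cos \<alpha> = sqrt (1 - (- e * Re \<omega>)\<^sup>2)" unfolding \<alpha>_def
    by (rule cos_arcsin) (use abs in \<open>auto simp: abs_less_iff\<close>)
  show "cos (2 * pi * snd (fst (disk \<omega>))) = Re \<omega>"
    unfolding eq cos_add cos_m sin_m s by (simp add: e_mult)
  show "sin (2 * pi * snd (fst (disk \<omega>))) = e * sqrt (1 - (Re \<omega>)\<^sup>2)"
    unfolding eq sin_add cos_m sin_m c by (simp add: power_mult_distrib e_sq)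
  have "- (pi / 2) < \<alpha> \<and> \<alpha> < pi / 2"
    unfolding \<alpha>_def using arcsin_lt_bounded[of "- e * Re \<omega>"] abs by (auto simp: abs_less_iff)
  then have "\<bar>\<alpha>\<bar> < pi / 2" by linarith
  then show "\<bar>snd (fst (disk \<omega>)) - m\<bar> < 1/4"
    unfolding disk_def \<alpha>_def[symmetric] by (simp add: field_simps)
qed

lemma \<epsilon>_less_1: "\<epsilon> < 1"
proof -
  have "1 - \<epsilon> = (1 - 2 * \<sigma>0\<^sup>2)\<^sup>2" unfolding \<epsilon>_eq by (simp add: algebra_simps power2_eq_square)
  also have "\<dots> > 0" using \<sigma>0 by simp
  finally show ?thesis by simp
qed

lemma disk_bounds:
  assumes "(cmod \<omega>)\<^sup>2 \<le> \<epsilon>"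
  shows "\<bar>Re \<omega>\<bar> < 1" "\<bar>Re \<omega>\<bar> < \<delta>" "\<bar>Im \<omega>\<bar> < \<delta>" "disk \<omega> \<in> W"
proof -
  have "\<bar>Re \<omega>\<bar>\<^sup>2 \<le> \<epsilon>" "\<bar>Im \<omega>\<bar>\<^sup>2 \<le> \<epsilon>"
    using assms zero_le_power2[of "Re \<omega>"] zero_le_power2[of "Im \<omega>"] unfolding cmod_power2 power2_abs
    by linarith+
  then have "\<bar>Re \<omega>\<bar>\<^sup>2 < 1\<^sup>2" "\<bar>Re \<omega>\<bar>\<^sup>2 < \<delta>\<^sup>2" "\<bar>Im \<omega>\<bar>\<^sup>2 < \<delta>\<^sup>2" using \<epsilon>_less_1 sqrt_\<epsilon>_less by auto
  then show 1: "\<bar>Re \<omega>\<bar> < 1" "\<bar>Re \<omega>\<bar> < \<delta>" "\<bar>Im \<omega>\<bar> < \<delta>"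
    using power2_less_imp_less \<delta>_pos by (metis less_imp_le zero_le_one)+
  then show "disk \<omega> \<in> W" using disk_angle(3)[OF 1(1)] unfolding W_def
    by (simp add: mem_tube) (simp add: disk_def)
qed

lemma disk_eq:
  assumes "\<bar>s - m\<bar> < 1/4"
  shows "disk (Complex (cos (2 * pi * s)) x) = ((cos (2 * pi * s), s), of_real x)"
  using W_arcsin(1)[OF assms] by (simp add: disk_def)

lemma core_eq_disk:
  assumes P: "\<And>y. P y \<Longrightarrow> y \<le> \<epsilon>"
  shows "{p \<in> N. \<exists>x s :: real. m - 1/4 < s \<and> s < m + 1/4 \<and> P (x\<^sup>2 + (cos (2 * pi * s))\<^sup>2) \<and>
      \<Phi> p = (A_class (cos (2 * pi * s)) s, of_real x)} = J ` disk ` {\<omega>. P ((cmod \<omega>)\<^sup>2)}"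
proof -
  have "{((cos (2 * pi * s), s), of_real x) | s x. m - 1/4 < s \<and> s < m + 1/4 \<and>
      P (x\<^sup>2 + (cos (2 * pi * s))\<^sup>2)} = disk ` {\<omega>. P ((cmod \<omega>)\<^sup>2)}" (is "?L = ?R")
  proof (intro equalityI subsetI)
    fix q :: plane_pt assume "q \<in> ?L"
    then obtain s x where s: "m - 1/4 < s" "s < m + 1/4" "P (x\<^sup>2 + (cos (2 * pi * s))\<^sup>2)"
      and q: "q = ((cos (2 * pi * s), s), of_real x)" by blast
    have "\<bar>s - m\<bar> < 1/4" using s unfolding abs_less_iff by linarith
    then have "q = disk (Complex (cos (2 * pi * s)) x)" unfolding q by (rule disk_eq[symmetric])
    moreover have "P ((cmod (Complex (cos (2 * pi * s)) x))\<^sup>2)"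
      unfolding cmod_power2 complex.sel using s(3) by (simp add: add.commute)
    ultimately show "q \<in> ?R" by blast
  next
    fix q assume "q \<in> ?R"
    then obtain \<omega> where \<omega>: "P ((cmod \<omega>)\<^sup>2)" "q = disk \<omega>" by blast
    note b = disk_bounds[OF P[OF \<omega>(1)]]
    let ?s = "snd (fst (disk \<omega>))"
    have "q = ((cos (2 * pi * ?s), ?s), of_real (Im \<omega>))"
      unfolding disk_angle(1)[OF b(1)] \<omega>(2) by (simp add: disk_def)
    moreover have "m - 1/4 < ?s \<and> ?s < m + 1/4"
      using disk_angle(3)[OF b(1)] unfolding abs_less_iff by linarith
    moreover have "P ((Im \<omega>)\<^sup>2 + (cos (2 * pi * ?s))\<^sup>2)"
      unfolding disk_angle(1)[OF b(1)] using \<omega>(1) unfolding cmod_power2 by (simp add: add.commute)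
    ultimately show "q \<in> ?L" by blast
  qed
  then show ?thesis using core_image[of P] P by simp
qed

lemma core_disk_eq: "core_disk N \<Phi> \<epsilon> (m - 1/4) (m + 1/4) = J ` disk ` {\<omega>. (cmod \<omega>)\<^sup>2 \<le> \<epsilon>}"
  unfolding core_disk_def by (rule core_eq_disk)

lemma attaching_circle_eq:
  "attaching_circle N \<Phi> \<epsilon> (m - 1/4) (m + 1/4) = J ` disk ` {\<omega>. (cmod \<omega>)\<^sup>2 = \<epsilon>}"
  unfolding attaching_circle_def by (rule core_eq_disk) simp

lemma handle_centre_eq: "handle_centre N \<Phi> (m - 1/4) (m + 1/4) = J (disk 0)"
proof -
  have d0: "disk 0 \<in> tube \<delta>" using disk_bounds(4)[of 0] eps W_tube by auto
  have "QA (disk 0) = (A_class 0 ((m - 1/4 + (m + 1/4)) / 2), 0)" by (simp add: QA_def disk_def)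
  then have hc: "handle_centre N \<Phi> (m - 1/4) (m + 1/4) = inv_into N \<Phi> (QA (disk 0))"
    unfolding handle_centre_def by simp
  have "QA (disk 0) \<in> \<Phi> ` N" using J_N[OF d0] \<Phi>_J[OF d0] by (metis imageI)
  then have "inv_into N \<Phi> (QA (disk 0)) \<in> N" "\<Phi> (inv_into N \<Phi> (QA (disk 0))) = QA (disk 0)"
    by (rule inv_into_into, rule f_inv_into_f)
  then show ?thesis unfolding hc by (rule J_unique[OF d0])
qed

lemma model_disk_0: "model (disk 0) = 0"
  by (simp add: model_def disk_def)

text \<open>The Morse chart comes from \<open>r c = ((r + c)/2)\<^sup>2 - ((r - c)/2)\<^sup>2\<close>.\<close>

definition morse :: "plane_pt \<Rightarrow> complex \<times> complex" where
  "morse q = (let r = fst (fst q); c = cos (2 * pi * snd (fst q)) in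
     (Complex ((r + c) / 2) (Re (snd q)), Complex ((r - c) / 2) (Im (snd q))))"

definition morse_inv :: "complex \<times> complex \<Rightarrow> plane_pt" where
  "morse_inv y = ((Re (fst y) + Re (snd y), m + arcsin (- e * (Re (fst y) - Re (snd y))) / (2 * pi)),
     Complex (Im (fst y)) (Im (snd y)))"

lemma morse_inv_morse: assumes "q \<in> W" shows "morse_inv (morse q) = q"
proof -
  have s: "\<bar>snd (fst q) - m\<bar> < 1/4" using assms by (simp add: W_def)
  have "Re (fst (morse q)) + Re (snd (morse q)) = fst (fst q)"
    "Re (fst (morse q)) - Re (snd (morse q)) = cos (2 * pi * snd (fst q))"
    by (simp_all add: morse_def Let_def field_simps)
  then show ?thesis using W_arcsin(1)[OF s]
    by (simp add: morse_inv_def prod_eq_iff complex_eq_iff) (simp add: morse_def Let_def)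
qed

lemma smooth_morse: "smooth_at morse q"
  unfolding morse_def Let_def by (intro smooth_at_intros) simp_all

lemma smooth_morse_inv: assumes "q \<in> W" shows "smooth_at morse_inv (morse q)"
proof -
  have "\<bar>cos (2 * pi * snd (fst q))\<bar> < 1" using assms W_arcsin(2) by (simp add: W_def)
  moreover have "\<bar>e\<bar> = 1" using e_sq by (simp add: abs_square_eq_1)
  moreover have "Re (fst (morse q)) - Re (snd (morse q)) = cos (2 * pi * snd (fst q))"
    by (simp add: morse_def Let_def field_simps)
  ultimately have "\<bar>- e * (Re (fst (morse q)) - Re (snd (morse q)))\<bar> < 1" by (simp add: abs_mult)
  then show ?thesis unfolding morse_inv_def by (intro smooth_at_intros) simp_all
qed

lemma open_morse: "open (morse ` W)"
proof (rule invariance_of_domain_gen[OF open_W])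
  show "continuous_on W morse"
    using smooth_at_continuous[OF smooth_morse] by (simp add: continuous_at_imp_continuous_on)
  show "inj_on morse W" by (metis inj_onI morse_inv_morse)
qed simp

lemma morse_disk: assumes "\<bar>Re \<omega>\<bar> < 1" shows "morse (disk \<omega>) = (\<omega>, 0)"
  using disk_angle(1)[OF assms] unfolding morse_def Let_def
  by (simp add: complex_eq_iff) (simp add: disk_def)

lemma disk_morse:
  assumes "q \<in> W" "snd (morse q) = 0" shows "q = disk (fst (morse q))"
proof -
  have "q = morse_inv (fst (morse q), 0)" using morse_inv_morse[OF assms(1)] assms(2) by (metis prod.collapse)
  then show ?thesis by (simp add: morse_inv_def disk_def complex_of_real_def)
qed

lemma Re_model_morse: "Re (model q) = (cmod (fst (morse q)))\<^sup>2 - (cmod (snd (morse q)))\<^sup>2"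
  unfolding model_eq cmod_power2 morse_def Let_def by (simp add: power2_eq_square field_simps)

lemma handle_chart_exists:
  "\<exists>Q \<kappa>. handle_chart X (\<lambda>x. cmod (f x)) (J (disk 0)) \<epsilon> (J ` disk ` {\<omega>. (cmod \<omega>)\<^sup>2 \<le> \<epsilon>})
     (J ` disk ` {\<omega>. (cmod \<omega>)\<^sup>2 = \<epsilon>}) Q \<kappa>"
proof (intro exI)
  let ?\<kappa> = "\<lambda>x. morse (inv_into W J x)"
  have \<kappa>J: "?\<kappa> (J q) = morse q" if "q \<in> W" for q using inj_W that by simp
  have im: "?\<kappa> ` J ` W = morse ` W" using \<kappa>J by (force simp: image_image)
  have disk: "disk \<omega> \<in> W" "morse (disk \<omega>) = (\<omega>, 0)" if "(cmod \<omega>)\<^sup>2 \<le> \<epsilon>" for \<omega>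
    using disk_bounds[OF that] morse_disk by auto
  have core: "J ` disk ` {\<omega>. P ((cmod \<omega>)\<^sup>2)} = {x \<in> J ` W. snd (?\<kappa> x) = 0 \<and> P ((cmod (fst (?\<kappa> x)))\<^sup>2)}"
    if P: "\<And>y. P y \<Longrightarrow> y \<le> \<epsilon>" for P
  proof (intro equalityI subsetI)
    fix x assume "x \<in> J ` disk ` {\<omega>. P ((cmod \<omega>)\<^sup>2)}"
    then obtain \<omega> where \<omega>: "P ((cmod \<omega>)\<^sup>2)" "x = J (disk \<omega>)" by blast
    note d = disk[OF P[OF \<omega>(1)]]
    show "x \<in> {x \<in> J ` W. snd (?\<kappa> x) = 0 \<and> P ((cmod (fst (?\<kappa> x)))\<^sup>2)}"
      using \<omega> d \<kappa>J[OF d(1)] by simp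
  next
    fix x assume "x \<in> {x \<in> J ` W. snd (?\<kappa> x) = 0 \<and> P ((cmod (fst (?\<kappa> x)))\<^sup>2)}"
    then obtain q where q: "q \<in> W" "x = J q" "snd (morse q) = 0" "P ((cmod (fst (morse q)))\<^sup>2)"
      using \<kappa>J by auto
    then show "x \<in> J ` disk ` {\<omega>. P ((cmod \<omega>)\<^sup>2)}" using disk_morse[OF q(1,3)] by blast
  qed
  have d0: "disk 0 \<in> W" "morse (disk 0) = (0, 0)" using disk[of 0] eps by auto
  show "handle_chart X (\<lambda>x. cmod (f x)) (J (disk 0)) \<epsilon> (J ` disk ` {\<omega>. (cmod \<omega>)\<^sup>2 \<le> \<epsilon>})
     (J ` disk ` {\<omega>. (cmod \<omega>)\<^sup>2 = \<epsilon>}) (J ` W) ?\<kappa>"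
    unfolding handle_chart_def im
  proof (intro conjI ballI)
    show "openin (mtop X) (J ` W)" by (rule openin_param[OF open_W W_tube])
    show "J (disk 0) \<in> J ` W" using d0 by blast
    show "?\<kappa> (J (disk 0)) = 0" using \<kappa>J d0 by (simp add: zero_prod_def)
    show "open (morse ` W)" by (rule open_morse)
    show "diffeo (sub X (J ` W)) (euclid (morse ` W)) ?\<kappa>"
      by (rule diffeo_param[OF open_W W_tube inj_W smooth_morse morse_inv_morse])
        (use smooth_morse_inv \<kappa>J in auto)
    show "{(u, 0) | u. (cmod u)\<^sup>2 \<le> \<epsilon>} \<subseteq> morse ` W"
    proof clarify
      fix u assume "(cmod u)\<^sup>2 \<le> \<epsilon>"
      then show "(u, 0) \<in> morse ` W" using disk[of u] by (metis imageI)
    qed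
    show "J ` disk ` {\<omega>. (cmod \<omega>)\<^sup>2 \<le> \<epsilon>} = {x \<in> J ` W. snd (?\<kappa> x) = 0 \<and> (cmod (fst (?\<kappa> x)))\<^sup>2 \<le> \<epsilon>}"
      by (rule core)
    show "J ` disk ` {\<omega>. (cmod \<omega>)\<^sup>2 = \<epsilon>} = {x \<in> J ` W. snd (?\<kappa> x) = 0 \<and> (cmod (fst (?\<kappa> x)))\<^sup>2 = \<epsilon>}"
      by (rule core) simp
    fix x assume "x \<in> J ` W"
    then obtain q where q: "q \<in> W" "x = J q" by blast
    have "cmod (f (J q)) = 1/2 - Re (model q)" "cmod (f (J (disk 0))) = 1/2"
      using cmod_f_J[of q] cmod_f_J[of "disk 0"] q(1) d0(1) W_tube model_disk_0 by auto
    then show "cmod (f x) = cmod (f (J (disk 0))) - (cmod (fst (?\<kappa> x)))\<^sup>2 + (cmod (snd (?\<kappa> x)))\<^sup>2"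
      unfolding q(2) \<kappa>J[OF q(1)] Re_model_morse by simp
  qed
qed

end

section \<open>Disk and frames along the attaching circle\<close>

context attaching_setup
begin

lemma smooth_disk: "\<bar>Re \<omega>\<bar> < 1 \<Longrightarrow> smooth_at disk \<omega>"
proof -
  assume "\<bar>Re \<omega>\<bar> < 1"
  moreover have "\<bar>e\<bar> = 1" using e_sq by (simp add: abs_square_eq_1)
  ultimately have "\<bar>- e * Re \<omega>\<bar> < 1" by (simp add: abs_mult)
  then show ?thesis unfolding disk_def by (intro smooth_at_intros) simp_all
qed

lemma disk_derivative:
  assumes "\<bar>Re \<omega>\<bar> < 1"
  shows "frechet_derivative disk (at \<omega>) \<beta> =
    ((Re \<beta>, - (e * Re \<beta> / (2 * pi * sqrt (1 - (Re \<omega>)\<^sup>2)))), of_real (Im \<beta>))"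
proof -
  have abs: "\<bar>- e * Re \<omega>\<bar> < 1" using assms e_sq by (simp add: abs_mult abs_square_eq_1)
  have "((\<lambda>\<omega>. - e * Re \<omega>) has_derivative (\<lambda>\<beta>. - e * Re \<beta>)) (at \<omega>)"
    by (auto intro!: derivative_eq_intros)
  moreover have "(arcsin has_real_derivative inverse (sqrt (1 - (- e * Re \<omega>)\<^sup>2))) (at (- e * Re \<omega>))"
    by (rule DERIV_arcsin) (use abs in \<open>auto simp: abs_less_iff\<close>)
  ultimately have "((\<lambda>\<omega>. arcsin (- e * Re \<omega>)) has_derivative
      (\<lambda>\<beta>. inverse (sqrt (1 - (- e * Re \<omega>)\<^sup>2)) * (- e * Re \<beta>))) (at \<omega>)"
    unfolding has_field_derivative_def by (rule has_derivative_compose)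
  note * = has_derivative_Pair[OF has_derivative_Pair[OF bounded_linear_imp_has_derivative[OF bounded_linear_Re]
      has_derivative_add_const[OF bounded_linear.has_derivative[OF bounded_linear_divide[of "2 * pi"] this], of m]]
      bounded_linear_imp_has_derivative[OF bounded_linear_compose[OF bounded_linear_of_real[where ?'a = complex] bounded_linear_Im]]]
  have eq: "(\<lambda>\<omega>. ((Re \<omega>, arcsin (- e * Re \<omega>) / (2 * pi) + m), of_real (Im \<omega>))) = disk"
    by (simp add: disk_def fun_eq_iff)
  have "(disk has_derivative (\<lambda>\<beta>. ((Re \<beta>, inverse (sqrt (1 - (- e * Re \<omega>)\<^sup>2)) * (- e * Re \<beta>) / (2 * pi)),
      of_real (Im \<beta>)))) (at \<omega>)"
    using * unfolding eq .
  from fun_cong[OF frechet_derivative_at[OF this], of \<beta>, symmetric]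
  show ?thesis by (simp add: power_mult_distrib e_sq field_simps)
qed

text \<open>At the start \<open>z\<close> is real, so \<open>hh 0 t\<close> lies on the core disk
  and \<open>r\<close> and \<open>Re z\<close> are its disk coordinates.\<close>

definition boundary_point :: "real \<Rightarrow> complex" where
  "boundary_point t = Complex (fst (fst (hh 0 t))) (Re (snd (hh 0 t)))"

lemma boundary_point:
  "disk (boundary_point t) = hh 0 t" "(cmod (boundary_point t))\<^sup>2 = \<epsilon>"
proof -
  interpret circle_family e m \<epsilon> \<sigma>0 0 by (rule family0)
  have "hh 0 t \<in> range (circ e m \<epsilon> \<sigma>0 0)" unfolding hh_def start by blast
  then obtain s x where s: "m - 1/4 < s" "s < m + 1/4" "x\<^sup>2 + (cos (2 * pi * s))\<^sup>2 = \<epsilon>"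
    and h: "hh 0 t = ((cos (2 * pi * s), s), of_real x)"
    unfolding range_start[OF refl \<epsilon>_eq \<sigma>0(2)] by blast
  have "\<bar>s - m\<bar> < 1/4" using s by linarith
  then show "disk (boundary_point t) = hh 0 t" using disk_eq[of s x] by (simp add: boundary_point_def h)
  show "(cmod (boundary_point t))\<^sup>2 = \<epsilon>" using s(3) by (simp add: boundary_point_def h cmod_power2)
qed

definition E1 :: "real \<Rightarrow> real \<Rightarrow> plane_pt" where "E1 \<tau> t = frame1 e \<epsilon> (\<Sigma> \<tau>) (K \<tau>) t"
definition E2 :: "real \<Rightarrow> real \<Rightarrow> plane_pt" where "E2 \<tau> t = frame2 e \<epsilon> (\<Sigma> \<tau>) t"
definition V :: "real \<Rightarrow> real \<Rightarrow> plane_pt" where "V \<tau> t = circ_velocity e \<epsilon> (\<Sigma> \<tau>) (K \<tau>) t"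

lemma continuous_frames:
  "continuous_on ({0..1} \<times> UNIV) (\<lambda>p. hh (fst p) (snd p))"
  "continuous_on ({0..1} \<times> UNIV) (\<lambda>p. E1 (fst p) (snd p))"
  "continuous_on ({0..1} \<times> UNIV) (\<lambda>p. E2 (fst p) (snd p))"
  "continuous_on ({0..1} \<times> UNIV) (\<lambda>p. V (fst p) (snd p))"
proof -
  have c: "continuous_on ({0..1} \<times> UNIV) g" if "\<And>p. fst p \<in> {0..1} \<Longrightarrow> smooth_at g p"
    for g :: "real \<times> real \<Rightarrow> plane_pt"
    by (rule continuous_at_imp_continuous_on) (intro ballI smooth_at_continuous that, auto)
  show "continuous_on ({0..1} \<times> UNIV) (\<lambda>p. hh (fst p) (snd p))" by (rule c) (rule smooth_hh)
  show "continuous_on ({0..1} \<times> UNIV) (\<lambda>p. E1 (fst p) (snd p))"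
    "continuous_on ({0..1} \<times> UNIV) (\<lambda>p. E2 (fst p) (snd p))"
    "continuous_on ({0..1} \<times> UNIV) (\<lambda>p. V (fst p) (snd p))"
    unfolding E1_def E2_def V_def by (rule c, rule smooth_at_frames[OF family smooth_\<Sigma>K], assumption)+
qed

lemma periodic_frames:
  "hh \<tau> (t + 1) = hh \<tau> t" "E1 \<tau> (t + 1) = E1 \<tau> t" "E2 \<tau> (t + 1) = E2 \<tau> t" "V \<tau> (t + 1) = V \<tau> t"
proof -
  have "2 * pi * (t + 1) = 2 * pi * t + 2 * pi" by (simp add: algebra_simps)
  then show "hh \<tau> (t + 1) = hh \<tau> t" "E1 \<tau> (t + 1) = E1 \<tau> t" "E2 \<tau> (t + 1) = E2 \<tau> t" "V \<tau> (t + 1) = V \<tau> t"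
    by (simp_all add: hh_def E1_def E2_def V_def circ_def frame1_def frame2_def circ_velocity_def)
qed

text \<open>\<open>height\<close> and \<open>slope\<close> are the nonzero entries of the normal
  parts of \<open>E1\<close> and \<open>E2\<close> at the start (see
  \<open>normal_part_start\<close>). Division by them turns normal components into coordinates in
  the frame.\<close>

definition height :: "real \<Rightarrow> real" where
  "height t = sqrt (1 - \<sigma>0\<^sup>2 / (1 - \<sigma>0\<^sup>2) * (cos (2 * pi * t))\<^sup>2)"
definition slope :: "real \<Rightarrow> real" where
  "slope t = 2 * e * (1 - 2 * \<sigma>0\<^sup>2 * (cos (2 * pi * t))\<^sup>2)"

lemma slope_neq_0: "slope t \<noteq> 0" and height_neq_0: "height t \<noteq> 0"
proof -
  interpret circle_family e m \<epsilon> \<sigma>0 0 by (rule family0)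
  have "(2 * \<sigma>0\<^sup>2) * (cos (2 * pi * t))\<^sup>2 < 1"
    using one_minus_mult_pos[of "2 * \<sigma>0\<^sup>2" "(cos (2 * pi * t))\<^sup>2"] \<sigma>0 u_le[of t] by simp
  then show "slope t \<noteq> 0" using e_sq by (auto simp: slope_def)
  have "height t = p t" by (simp add: height_def)
  then show "height t \<noteq> 0" using p_pos[of t] by linarith
qed

lemma normal_part_start:
  "normal_part (hh 0 t) (E1 0 t) = Complex 0 (height t)"
  "normal_part (hh 0 t) (E2 0 t) = Complex (slope t) 0"
  "normal_part (hh 0 t) (V 0 t) = 0"
proof -
  interpret circle_family e m \<epsilon> \<sigma>0 0 by (rule family0)
  define u' w' \<rho>' d where "u' = u t" and "w' = w t" and "\<rho>' = \<rho> t" and "d = 1 - \<sigma>0\<^sup>2"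
  have nz: "\<rho>' \<noteq> 0" "d \<noteq> 0" "\<sigma>0 \<noteq> 0"
    using rho_pos[of t] \<sigma>0 unfolding \<rho>'_def d_def by auto
  show "normal_part (hh 0 t) (E1 0 t) = Complex 0 (height t)"
    unfolding normal_part_def E1_def start frame1_eq height_def by simp
  show "normal_part (hh 0 t) (E2 0 t) = Complex (slope t) 0"
    unfolding normal_part_def hh_def E2_def start frame2_eq angle(2) slope_def fst_conv snd_conv
    unfolding \<epsilon>_eq unfolding d_def[symmetric] using nz by (simp add: field_simps)
  show "normal_part (hh 0 t) (V 0 t) = 0"
    unfolding normal_part_def hh_def V_def start h'_eq angle(2) fst_conv snd_conv complex.sel complex_eq_iff
    unfolding \<rho>'_def[symmetric] unfolding u'_def[symmetric] w'_def[symmetric] \<epsilon>_eq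
    unfolding d_def[symmetric] using nz by (simp add: field_simps power2_eq_square)
qed

text \<open>A vector without normal part is tangent to the core disk, in which the level set is just
  the circle. Concretely, \<open>R\<close> and the velocity have \<open>(s, Re z)\<close> components
  in the kernel of one linear functional, which is nonzero because \<open>u\<close> and
  \<open>w\<close> have no common zero.\<close>

lemma tangential_start:
  assumes n: "normal_part (hh 0 t) R = 0" and m: "Re (model_derivative (hh 0 t) R) = 0"
  shows "\<exists>k. R = k *\<^sub>R V 0 t"
proof -
  interpret circle_family e m \<epsilon> \<sigma>0 0 by (rule family0)
  let ?c = "1 - 2 * \<sigma>0\<^sup>2 * (u t)\<^sup>2"
  let ?\<alpha> = "8 * pi * \<sigma>0 * u t * \<rho> t * ?c" and ?\<beta> = "2 * sqrt \<epsilon> * w t * p t"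
  have s: "1 - \<sigma>0\<^sup>2 \<noteq> 0" "\<sigma>0 \<noteq> 0" using \<sigma>0 by auto
  have c: "?c \<noteq> 0" using slope_neq_0[of t] by (auto simp: slope_def)
  have part: "fst (fst v) = - (e * ?c * (2 * pi * snd (fst v)))" "Im (snd v) = 0"
    if "normal_part (hh 0 t) v = 0" for v
    using that unfolding normal_part_def hh_def start angle(2) by (simp_all add: complex_eq_iff)
  have quot: "\<epsilon> * u t * \<rho> t / (2 * \<sigma>0 * (1 - \<sigma>0\<^sup>2)) = 2 * \<sigma>0 * u t * \<rho> t"
  proof -
    define d where "d = 1 - \<sigma>0\<^sup>2"
    have "d \<noteq> 0" using s by (simp add: d_def)
    then show ?thesis unfolding \<epsilon>_eq d_def[symmetric] using s by (simp add: power2_eq_square)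
  qed
  have ker: "?\<alpha> * snd (fst v) + ?\<beta> * Re (snd v) = 0"
    if "normal_part (hh 0 t) v = 0" "Re (model_derivative (hh 0 t) v) = 0" for v
  proof -
    define u' \<rho>' p' where "u' = u t" and "\<rho>' = \<rho> t" and "p' = p t"
    show ?thesis
      using that(2) unfolding hh_def start model_derivative_h(1) quot part[OF that(1)]
      unfolding \<rho>'_def[symmetric] p'_def[symmetric] unfolding u'_def[symmetric]
      by (simp add: algebra_simps e_mult)
  qed
  have V: "normal_part (hh 0 t) (V 0 t) = 0" by (rule normal_part_start)
  have V': "Re (model_derivative (hh 0 t) (V 0 t)) = 0"
    unfolding hh_def V_def start by (rule frame_tangent)
  have "u t \<noteq> 0 \<or> w t \<noteq> 0" using w_eq[of t] by auto
  then have "?\<alpha> \<noteq> 0 \<or> ?\<beta> \<noteq> 0" using c s eps rho_pos[of t] p_pos[of t] by auto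
  moreover have "snd (fst (V 0 t)) \<noteq> 0 \<or> Re (snd (V 0 t)) \<noteq> 0"
  proof (rule ccontr)
    assume A: "\<not> ?thesis"
    then have "V 0 t = 0" using part[OF V] by (simp add: prod_eq_iff complex_eq_iff)
    then show False using h'_neq_0[of t] unfolding V_def start by simp
  qed
  ultimately obtain k where k: "snd (fst R) = k * snd (fst (V 0 t))" "Re (snd R) = k * Re (snd (V 0 t))"
    using parallel_in_kernel[OF ker[OF n m] ker[OF V V']] by blast
  have "R = k *\<^sub>R V 0 t"
    using k part[OF n] part[OF V] by (simp add: prod_eq_iff complex_eq_iff)
  then show ?thesis by blast
qed

lemma g_derivative:
  assumes q: "q \<in> tube \<delta>"
  shows "(\<lambda>q. cmod (f (J q))) differentiable at q"
    "frechet_derivative (\<lambda>q. cmod (f (J q))) (at q) v = - Re (model_derivative q v)"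
proof -
  have "((\<lambda>q. 1/2 - Re (model q)) has_derivative (\<lambda>v. 0 - Re (model_derivative q v))) (at q)"
    by (intro has_derivative_diff has_derivative_const bounded_linear.has_derivative[OF bounded_linear_Re]
        model_has_derivative)
  moreover have "\<forall>\<^sub>F q' in nhds q. 1/2 - Re (model q') = cmod (f (J q'))"
    using eventually_B[OF q] by eventually_elim (simp add: cmod_f_J)
  ultimately have "((\<lambda>q. cmod (f (J q))) has_derivative (\<lambda>v. 0 - Re (model_derivative q v))) (at q)"
    by (rule has_derivative_cong_nhds)
  then show "(\<lambda>q. cmod (f (J q))) differentiable at q"
    "frechet_derivative (\<lambda>q. cmod (f (J q))) (at q) v = - Re (model_derivative q v)"
    by (auto simp: differentiable_def dest: frechet_derivative_at[symmetric])
qed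

lemma f_derivative:
  assumes q: "q \<in> tube \<delta>" and v: "model_derivative q v = 0"
  shows "(\<lambda>q. f (J q)) differentiable at q" "frechet_derivative (\<lambda>q. f (J q)) (at q) v = 0"
proof -
  let ?D = "frechet_derivative \<theta> (at (model q))"
  have \<theta>: "(\<theta> has_derivative ?D) (at (model q))" by (rule smooth_at_has_derivative[OF smooth_\<theta>[OF q]])
  have "((\<lambda>q. \<theta> (model q)) has_derivative (\<lambda>v. ?D (model_derivative q v))) (at q)"
    by (rule has_derivative_compose[OF model_has_derivative \<theta>])
  moreover have "\<forall>\<^sub>F q' in nhds q. \<theta> (model q') = f (J q')"
    using eventually_B[OF q] by eventually_elim (simp add: f_J)
  ultimately have D: "((\<lambda>q. f (J q)) has_derivative (\<lambda>v. ?D (model_derivative q v))) (at q)"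
    by (rule has_derivative_cong_nhds)
  then show "(\<lambda>q. f (J q)) differentiable at q" by (auto simp: differentiable_def)
  show "frechet_derivative (\<lambda>q. f (J q)) (at q) v = 0"
    using fun_cong[OF frechet_derivative_at[OF D], of v] v linear_0[OF has_derivative_linear[OF \<theta>]] by simp
qed

end

text \<open>The normal field given by an arbitrary handle chart extends over the core disk, without zeros.\<close>

locale handle_chart_setup = attaching_setup +
  fixes p D C Q and \<kappa> :: "'a \<Rightarrow> complex \<times> complex"
  assumes chart: "handle_chart X (\<lambda>x. cmod (f x)) p \<epsilon> D C Q \<kappa>"
    and D: "D = J ` disk ` {\<omega>. (cmod \<omega>)\<^sup>2 \<le> \<epsilon>}"
begin

definition \<Theta> :: "complex \<times> complex \<Rightarrow> plane_pt" where
  "\<Theta> y = inv_into W J (inv_into Q \<kappa> y)"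

text \<open>The cocore vector of the handle chart in the coordinates of the tube. It is defined over
  the entire core disk, although the framing only concerns the boundary.\<close>

definition nu :: "complex \<Rightarrow> plane_pt" where
  "nu \<omega> = frechet_derivative \<Theta> (at (\<kappa> (J (disk \<omega>)))) (0, 1)"

lemma Q: "openin (mtop X) Q" "open (\<kappa> ` Q)" "diffeo (sub X Q) (euclid (\<kappa> ` Q)) \<kappa>"
    "\<And>x. x \<in> Q \<Longrightarrow> cmod (f x) = cmod (f p) - (cmod (fst (\<kappa> x)))\<^sup>2 + (cmod (snd (\<kappa> x)))\<^sup>2"
  using chart unfolding handle_chart_def by blast+

lemma disk_Q: assumes "(cmod \<omega>)\<^sup>2 \<le> \<epsilon>" shows "J (disk \<omega>) \<in> Q" "snd (\<kappa> (J (disk \<omega>))) = 0"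
proof -
  have "J (disk \<omega>) \<in> D" unfolding D using assms by blast
  moreover have "D = {x \<in> Q. snd (\<kappa> x) = 0 \<and> (cmod (fst (\<kappa> x)))\<^sup>2 \<le> \<epsilon>}"
    using chart unfolding handle_chart_def by blast
  ultimately show "J (disk \<omega>) \<in> Q" "snd (\<kappa> (J (disk \<omega>))) = 0" by auto
qed

lemma chart_disk:
  assumes \<omega>: "(cmod \<omega>)\<^sup>2 \<le> \<epsilon>"
  shows "smooth_at (\<lambda>q. \<kappa> (J q)) (disk \<omega>)" "smooth_at \<Theta> (\<kappa> (J (disk \<omega>)))" "\<Theta> (\<kappa> (J (disk \<omega>))) = disk \<omega>"
    "\<forall>\<^sub>F y in nhds (\<kappa> (J (disk \<omega>))). inv_into Q \<kappa> y = J (\<Theta> y) \<and> \<kappa> (J (\<Theta> y)) = y"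
proof -
  interpret W: local_param X W J by (rule local_param_restrict[OF open_W W_tube])
  have "DIM(complex \<times> complex) \<le> DIM((real \<times> real) \<times> complex)" by simp
  note * = W.chart_of_diffeo[OF inj_W Q(1,3) this disk_bounds(4)[OF \<omega>] disk_Q(1)[OF \<omega>], folded \<Theta>_def]
  show "smooth_at (\<lambda>q. \<kappa> (J q)) (disk \<omega>)" "smooth_at \<Theta> (\<kappa> (J (disk \<omega>)))" "\<Theta> (\<kappa> (J (disk \<omega>))) = disk \<omega>"
    "\<forall>\<^sub>F y in nhds (\<kappa> (J (disk \<omega>))). inv_into Q \<kappa> y = J (\<Theta> y) \<and> \<kappa> (J (\<Theta> y)) = y"
    using * by (simp_all add: \<Theta>_def[abs_def])
qed

lemma continuous_nu: "continuous_on {\<omega>. (cmod \<omega>)\<^sup>2 \<le> \<epsilon>} nu"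
  unfolding continuous_on_eq_continuous_within
proof
  fix \<omega> assume "\<omega> \<in> {\<omega>. (cmod \<omega>)\<^sup>2 \<le> \<epsilon>}"
  then have \<omega>: "(cmod \<omega>)\<^sup>2 \<le> \<epsilon>" by simp
  have "smooth_at (\<lambda>\<omega>. \<kappa> (J (disk \<omega>))) \<omega>"
    by (rule smooth_at_compose[OF smooth_disk[OF disk_bounds(1)[OF \<omega>]] chart_disk(1)[OF \<omega>]])
  then have "isCont (\<lambda>\<omega>. \<kappa> (J (disk \<omega>))) \<omega>" by (rule smooth_at_continuous)
  then have c: "continuous (at \<omega> within {\<omega>. (cmod \<omega>)\<^sup>2 \<le> \<epsilon>}) (\<lambda>\<omega>. \<kappa> (J (disk \<omega>)))"
    by (rule continuous_at_imp_continuous_at_within)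
  show "continuous (at \<omega> within {\<omega>. (cmod \<omega>)\<^sup>2 \<le> \<epsilon>}) nu"
    unfolding nu_def using smooth_at_continuous_derivative[OF chart_disk(2)[OF \<omega>] c continuous_const] .
qed

lemma handle_framing_nu:
  assumes \<omega>: "(cmod \<omega>)\<^sup>2 \<le> \<epsilon>" and c: "c \<in> X" "J (disk \<omega>) \<in> fst c"
  shows "handle_framing Q \<kappa> (J (disk \<omega>)) c = push (disk \<omega>) (nu \<omega>) c"
proof -
  let ?y = "\<kappa> (J (disk \<omega>))"
  have q: "disk \<omega> \<in> tube \<delta>" using disk_bounds(4)[OF \<omega>] W_tube by blast
  note \<Theta> = chart_disk[OF \<omega>]
  have dJ: "(\<lambda>q. snd c (J q)) differentiable at (\<Theta> ?y)"
    unfolding \<Theta>(3) by (rule smooth_at_differentiable[OF smooth_J[OF c(1) q c(2)]])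
  have d\<Theta>: "\<Theta> differentiable at ?y" by (rule smooth_at_differentiable[OF \<Theta>(2)])
  have "(\<lambda>y. snd c (J (\<Theta> y))) differentiable at ?y"
    using differentiable_chain_at[OF d\<Theta> dJ] by (simp add: o_def)
  moreover have "\<forall>\<^sub>F y in nhds ?y. snd c (J (\<Theta> y)) = (snd c \<circ> inv_into Q \<kappa>) y"
    using \<Theta>(4) by eventually_elim simp
  ultimately have "frechet_derivative (snd c \<circ> inv_into Q \<kappa>) (at ?y) = frechet_derivative (\<lambda>y. snd c (J (\<Theta> y))) (at ?y)"
    by (rule frechet_derivative_cong_nhds)
  then show ?thesis
    using frechet_derivative_chain[OF d\<Theta> dJ, of "(0, 1)"] unfolding \<Theta>(3) handle_framing_def push_def nu_def by simp
qed

lemma derivative_nu: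
  assumes \<omega>: "(cmod \<omega>)\<^sup>2 \<le> \<epsilon>"
  shows "frechet_derivative (\<lambda>q. \<kappa> (J q)) (at (disk \<omega>)) (nu \<omega>) = (0, 1)"
proof -
  note \<Theta> = chart_disk[OF \<omega>]
  have "(\<lambda>q. \<kappa> (J q)) differentiable at (\<Theta> (\<kappa> (J (disk \<omega>))))"
    unfolding \<Theta>(3) by (rule smooth_at_differentiable[OF \<Theta>(1)])
  moreover have "\<forall>\<^sub>F y in nhds (\<kappa> (J (disk \<omega>))). \<kappa> (J (\<Theta> y)) = y"
    using \<Theta>(4) by eventually_elim simp
  ultimately show ?thesis
    using frechet_derivative_inverse_id[OF smooth_at_differentiable[OF \<Theta>(2)], of "\<lambda>q. \<kappa> (J q)" "(0, 1)"]
    unfolding \<Theta>(3) nu_def by blast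
qed

text \<open>Otherwise \<open>nu \<omega>\<close> would be tangent to the disk. Since the second
  component of \<open>\<kappa>\<close> vanishes on the disk, its derivative kills tangent vectors of
  the disk, also at boundary points; but it maps \<open>nu \<omega>\<close> to 1.\<close>

lemma normal_nu_neq_0:
  assumes \<omega>: "(cmod \<omega>)\<^sup>2 \<le> \<epsilon>" shows "normal_part (disk \<omega>) (nu \<omega>) \<noteq> 0"
proof
  assume A: "normal_part (disk \<omega>) (nu \<omega>) = 0"
  note b = disk_bounds[OF \<omega>]
  define r where "r = sqrt (1 - (Re \<omega>)\<^sup>2)"
  have r: "r > 0" using b(1) unfolding r_def by (simp add: abs_square_less_1)
  define \<beta> where "\<beta> = Complex (fst (fst (nu \<omega>))) (Re (snd (nu \<omega>)))"
  have 1: "fst (fst (nu \<omega>)) = - (e * r * (2 * pi * snd (fst (nu \<omega>))))" and 2: "Im (snd (nu \<omega>)) = 0"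
    using A unfolding normal_part_def disk_angle(2)[OF b(1)] r_def by (simp_all add: complex_eq_iff)
  have "snd (fst (nu \<omega>)) = - (e * fst (fst (nu \<omega>)) / (2 * pi * r))"
    unfolding 1 using r by (simp add: field_simps e_mult)
  then have \<beta>: "nu \<omega> = frechet_derivative disk (at \<omega>) \<beta>"
    unfolding disk_derivative[OF b(1)] using 2 by (simp add: \<beta>_def r_def prod_eq_iff complex_eq_iff)
  let ?\<phi> = "\<lambda>\<omega>. \<kappa> (J (disk \<omega>))"
  have sm: "smooth_at ?\<phi> \<omega>" by (rule smooth_at_compose[OF smooth_disk[OF b(1)] chart_disk(1)[OF \<omega>]])
  have "frechet_derivative ?\<phi> (at \<omega>) \<beta> = (0, 1)"
    using frechet_derivative_chain[OF smooth_at_differentiable[OF smooth_disk[OF b(1)]]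
        smooth_at_differentiable[OF chart_disk(1)[OF \<omega>]], of \<beta>] \<beta> derivative_nu[OF \<omega>] by simp
  then have "snd (frechet_derivative ?\<phi> (at \<omega>) \<beta>) = 1" by simp
  moreover have D: "((\<lambda>\<omega>. snd (?\<phi> \<omega>)) has_derivative (\<lambda>\<beta>. snd (frechet_derivative ?\<phi> (at \<omega>) \<beta>))) (at \<omega>)"
    by (rule bounded_linear.has_derivative[OF bounded_linear_snd smooth_at_has_derivative[OF sm]])
  then have "frechet_derivative (\<lambda>\<omega>. snd (?\<phi> \<omega>)) (at \<omega>) = (\<lambda>\<beta>. snd (frechet_derivative ?\<phi> (at \<omega>) \<beta>))"
    by (rule frechet_derivative_at[symmetric])
  moreover have ball: "\<omega>' \<in> cball 0 (sqrt \<epsilon>) \<longleftrightarrow> (cmod \<omega>')\<^sup>2 \<le> \<epsilon>" for \<omega>' :: complex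
    using sqrt_le_D real_le_rsqrt by (auto simp: eps less_imp_le) (metis eps(1) less_imp_le norm_ge_zero power2_le_imp_le real_sqrt_pow2 power_mono)
  have "frechet_derivative (\<lambda>\<omega>. snd (?\<phi> \<omega>)) (at \<omega>) \<beta> = 0"
  proof (rule frechet_derivative_vanish_on_disk)
    show "(\<lambda>\<omega>. snd (?\<phi> \<omega>)) differentiable at \<omega>" using D by (auto simp: differentiable_def)
    show "\<omega> \<in> cball 0 (sqrt \<epsilon>)" unfolding ball by (rule \<omega>)
    show "sqrt \<epsilon> > 0" using eps by simp
    show "snd (?\<phi> \<omega>') = 0" if "\<omega>' \<in> cball 0 (sqrt \<epsilon>)" for \<omega>' by (rule disk_Q(2)) (use that ball in blast)
  qed
  ultimately show False by simp
qed

text \<open>In the handle chart \<open>nu \<omega>\<close> is the velocity of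
  \<open>s \<mapsto> (u, s)\<close>, along which the function is a constant plus
  \<open>s\<^sup>2\<close>. This is the place where the quadratic normal form of a handle chart
  enters.\<close>

lemma tangent_nu:
  assumes \<omega>: "(cmod \<omega>)\<^sup>2 \<le> \<epsilon>" shows "Re (model_derivative (disk \<omega>) (nu \<omega>)) = 0"
proof -
  let ?y = "\<kappa> (J (disk \<omega>))"
  define u where "u = fst ?y"
  have y: "?y = (u, 0)" using disk_Q(2)[OF \<omega>] by (simp add: u_def prod_eq_iff)
  note \<Theta> = chart_disk[OF \<omega>, unfolded y]
  have q: "disk \<omega> \<in> tube \<delta>" using disk_bounds(4)[OF \<omega>] W_tube by blast
  let ?c = "\<lambda>s. (u, of_real s :: complex)"
  have c: "(?c has_vector_derivative (0, 1)) (at 0)"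
    unfolding has_vector_derivative_def
    by (auto intro!: derivative_eq_intros simp: fun_eq_iff scaleR_conv_of_real)
  have d\<Theta>: "(\<Theta> has_derivative frechet_derivative \<Theta> (at (u, 0))) (at (?c 0))"
    using smooth_at_has_derivative[OF \<Theta>(2)] by simp
  have "((\<Theta> \<circ> ?c) has_vector_derivative nu \<omega>) (at 0)"
    using vector_derivative_diff_chain_within[OF c has_derivative_at_withinI[OF d\<Theta>]]
    by (simp add: nu_def y)
  from vector_derivative_diff_chain_within[OF this, of model "model_derivative (disk \<omega>)"]
  have "((model \<circ> (\<Theta> \<circ> ?c)) has_vector_derivative model_derivative (disk \<omega>) (nu \<omega>)) (at 0)"
    using has_derivative_at_withinI[OF model_has_derivative] \<Theta>(3) by simp
  from bounded_linear.has_vector_derivative[OF bounded_linear_Re this]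
  have 1: "((\<lambda>s. Re (model (\<Theta> (?c s)))) has_vector_derivative Re (model_derivative (disk \<omega>) (nu \<omega>))) (at 0)"
    by simp
  have "\<forall>\<^sub>F y in nhds (u, 0). Re (model (\<Theta> y)) = 1/2 - (cmod (f p) - (cmod (fst y))\<^sup>2 + (cmod (snd y))\<^sup>2)"
  proof -
    have "\<forall>\<^sub>F y in nhds (u, 0). y \<in> \<kappa> ` Q"
      using Q(2) disk_Q(1)[OF \<omega>] y by (metis eventually_nhds_in_open imageI)
    moreover have "\<forall>\<^sub>F y in nhds (u, 0). \<Theta> y \<in> tube \<delta>"
      by (rule eventually_isCont_compose[OF smooth_at_continuous[OF \<Theta>(2)]]) (use \<Theta>(3) eventually_B[OF q] in simp)
    ultimately show ?thesis using \<Theta>(4)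
    proof eventually_elim
      case (elim y)
      then have "J (\<Theta> y) \<in> Q" by (metis inv_into_into)
      then show ?case using Q(4)[of "J (\<Theta> y)"] cmod_f_J[OF elim(2)] elim(3) by simp
    qed
  qed
  then have "\<forall>\<^sub>F y in nhds (?c 0). Re (model (\<Theta> y)) = 1/2 - (cmod (f p) - (cmod (fst y))\<^sup>2 + (cmod (snd y))\<^sup>2)"
    by simp
  moreover have "isCont ?c 0" by (intro continuous_intros)
  ultimately have "\<forall>\<^sub>F s in nhds 0. Re (model (\<Theta> (?c s))) =
      1/2 - (cmod (f p) - (cmod (fst (?c s)))\<^sup>2 + (cmod (snd (?c s)))\<^sup>2)"
    by (intro eventually_isCont_compose[of 0 ?c "\<lambda>y. Re (model (\<Theta> y)) =
      1/2 - (cmod (f p) - (cmod (fst y))\<^sup>2 + (cmod (snd y))\<^sup>2)"])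
  then have "\<forall>\<^sub>F s in nhds 0. 1/2 - (cmod (f p) - (cmod u)\<^sup>2 + s\<^sup>2) = Re (model (\<Theta> (?c s)))"
    by eventually_elim simp
  moreover have "((\<lambda>s. 1/2 - (cmod (f p) - (cmod u)\<^sup>2 + s\<^sup>2)) has_vector_derivative 0) (at (0::real))"
    unfolding has_real_derivative_iff_has_vector_derivative[symmetric] by (auto intro!: derivative_eq_intros)
  ultimately have "((\<lambda>s. Re (model (\<Theta> (?c s)))) has_vector_derivative 0) (at 0)"
    unfolding has_vector_derivative_def by (rule has_derivative_cong_nhds[rotated])
  with 1 show ?thesis by (rule vector_derivative_unique_at)
qed

end

context handle_chart_setup
begin

text \<open>The coordinates of the handle framing in the normal frame over the core disk, restricted to
  the circle of relative radius \<open>1 - \<tau>\<close> and rotated so that at the centre they are imaginary.\<close>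

definition turn :: "real \<Rightarrow> real \<Rightarrow> complex" where
  "turn \<tau> t = cis (\<tau> * (pi / 2 - Arg (normal_part (disk 0) (nu 0)))) *
     normal_part (disk ((1 - \<tau>) *\<^sub>R boundary_point t)) (nu ((1 - \<tau>) *\<^sub>R boundary_point t))"

definition coeff1 :: "real \<Rightarrow> real \<Rightarrow> real" where "coeff1 \<tau> t = Im (turn \<tau> t) / height t"
definition coeff2 :: "real \<Rightarrow> real \<Rightarrow> real" where "coeff2 \<tau> t = Re (turn \<tau> t) / slope t"
definition residue :: "real \<Rightarrow> plane_pt" where
  "residue t = nu (boundary_point t) - coeff1 0 t *\<^sub>R E1 0 t - coeff2 0 t *\<^sub>R E2 0 t"
definition coeff3 :: "real \<Rightarrow> real" where
  "coeff3 t = (residue t \<bullet> V 0 t) / (V 0 t \<bullet> V 0 t)"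
text \<open>The last term makes \<open>field 0\<close> equal to the handle framing itself, not
  merely modulo the velocity. Its factor \<open>1 - \<tau>\<close> leaves only the frame fields at
  the end.\<close>

definition field :: "real \<Rightarrow> real \<Rightarrow> plane_pt" where
  "field \<tau> t = coeff1 \<tau> t *\<^sub>R E1 \<tau> t + coeff2 \<tau> t *\<^sub>R E2 \<tau> t + ((1 - \<tau>) * coeff3 t) *\<^sub>R V \<tau> t"

lemma scaled_in_disk:
  assumes "\<tau> \<in> {0..1}" shows "(cmod ((1 - \<tau>) *\<^sub>R boundary_point t))\<^sup>2 \<le> \<epsilon>"
proof -
  have "(1 - \<tau>)\<^sup>2 \<le> 1" using assms by (simp add: power_le_one)
  then have "(1 - \<tau>)\<^sup>2 * \<epsilon> \<le> 1 * \<epsilon>" using eps by (intro mult_right_mono) auto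
  then show ?thesis by (simp add: power_mult_distrib boundary_point(2))
qed

lemma turn_neq_0: "\<tau> \<in> {0..1} \<Longrightarrow> turn \<tau> t \<noteq> 0"
  unfolding turn_def using normal_nu_neq_0[OF scaled_in_disk] by simp

lemma Re_turn_1: "Re (turn 1 t) = 0"
proof -
  let ?n = "normal_part (disk 0) (nu 0)"
  have "turn 1 t = cis (pi / 2 - Arg ?n) * rcis (cmod ?n) (Arg ?n)"
    unfolding rcis_cmod_Arg by (simp add: turn_def)
  also have "\<dots> = of_real (cmod ?n) * \<i>"
    unfolding rcis_def by (simp add: cis_mult mult.left_commute)
  finally show ?thesis by simp
qed

lemma continuous_turn: "continuous_on ({0..1} \<times> UNIV) (\<lambda>p. turn (fst p) (snd p))"
proof -
  let ?A = "{0..1} \<times> UNIV :: (real \<times> real) set" and ?\<omega> = "\<lambda>p. (1 - fst p) *\<^sub>R boundary_point (snd p)"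
  have "continuous_on UNIV (hh 0)"
    using smooth_at_continuous[OF smooth_hh_t] by (simp add: continuous_at_imp_continuous_on)
  then have "continuous_on UNIV boundary_point"
    unfolding boundary_point_def Complex_eq by (intro continuous_intros)
  then have "continuous_on ?A (\<lambda>p. boundary_point (snd p))"
    by (rule continuous_on_compose2) (auto intro: continuous_intros)
  then have \<omega>: "continuous_on ?A ?\<omega>" by (intro continuous_intros)
  have im: "?\<omega> ` ?A \<subseteq> {\<omega>. (cmod \<omega>)\<^sup>2 \<le> \<epsilon>}" using scaled_in_disk by auto
  have nu: "continuous_on ?A (\<lambda>p. nu (?\<omega> p))" by (rule continuous_on_compose2[OF continuous_nu \<omega> im])
  have "continuous_on {\<omega>. (cmod \<omega>)\<^sup>2 \<le> \<epsilon>} disk"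
    by (rule continuous_at_imp_continuous_on) (intro ballI smooth_at_continuous smooth_disk disk_bounds, simp)
  then have disk: "continuous_on ?A (\<lambda>p. disk (?\<omega> p))" by (rule continuous_on_compose2[OF _ \<omega> im])
  show ?thesis unfolding turn_def cis_conv_exp normal_part_def Complex_eq
    by (intro continuous_intros nu disk)
qed

lemma continuous_field: "continuous_on ({0..1} \<times> UNIV) (\<lambda>p. field (fst p) (snd p))"
proof -
  let ?A = "{0..1} \<times> UNIV :: (real \<times> real) set"
  have hs: "continuous_on ?A (\<lambda>p. height (snd p))" "continuous_on ?A (\<lambda>p. slope (snd p))"
    unfolding height_def slope_def by (intro continuous_intros)+
  have c: "continuous_on ?A (\<lambda>p. coeff1 (fst p) (snd p))" "continuous_on ?A (\<lambda>p. coeff2 (fst p) (snd p))"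
    unfolding coeff1_def coeff2_def
    by (intro continuous_intros continuous_turn hs; simp add: height_neq_0 slope_neq_0)+
  have 0: "continuous_on ?A (\<lambda>p. g 0 (snd p))" if "continuous_on ?A (\<lambda>p. g (fst p) (snd p))"
    for g :: "real \<Rightarrow> real \<Rightarrow> 'c::topological_space"
  proof -
    have 1: "continuous_on ?A (\<lambda>p. (0 :: real, snd p))" by (intro continuous_intros)
    have 2: "(\<lambda>p. (0, snd p)) ` ?A \<subseteq> ?A" by auto
    show ?thesis using continuous_on_compose2[OF that 1 2] by simp
  qed
  have "continuous_on ?A (\<lambda>p. boundary_point (snd p))"
    using 0[OF continuous_frames(1)] unfolding boundary_point_def Complex_eq by (intro continuous_intros)
  then have "continuous_on ?A (\<lambda>p. nu (boundary_point (snd p)))"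
    by (rule continuous_on_compose2[OF continuous_nu]) (auto simp: boundary_point(2))
  then have r: "continuous_on ?A (\<lambda>p. residue (snd p))"
    unfolding residue_def by (intro continuous_intros 0[OF c(1)] 0[OF c(2)] 0[OF continuous_frames(2)] 0[OF continuous_frames(3)])
  interpret circle_family e m \<epsilon> \<sigma>0 0 by (rule family0)
  have "V 0 t \<noteq> 0" for t unfolding V_def start by (rule h'_neq_0)
  then have "continuous_on ?A (\<lambda>p. coeff3 (snd p))"
    unfolding coeff3_def by (intro continuous_intros r 0[OF continuous_frames(4)]) simp
  then show ?thesis unfolding field_def by (intro continuous_intros c continuous_frames)
qed

lemma field_periodic: "field \<tau> (t + 1) = field \<tau> t"
proof -
  have b: "boundary_point (t + 1) = boundary_point t" by (simp add: boundary_point_def periodic_frames)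
  have "2 * pi * (t + 1) = 2 * pi * t + 2 * pi" by (simp add: algebra_simps)
  then have "height (t + 1) = height t" "slope (t + 1) = slope t" by (simp_all add: height_def slope_def)
  then show ?thesis
    by (simp add: field_def coeff1_def coeff2_def coeff3_def residue_def turn_def b periodic_frames)
qed

lemma model_derivative_frames:
  assumes "\<tau> \<in> {0..1}"
  shows "Re (model_derivative (hh \<tau> t) (a *\<^sub>R E1 \<tau> t + b *\<^sub>R E2 \<tau> t + c *\<^sub>R V \<tau> t)) = 0"
proof -
  interpret circle_family e m \<epsilon> "\<Sigma> \<tau>" "K \<tau>" by (rule family[OF assms])
  note lin = model_derivative_linear[of "h t"]
  show ?thesis unfolding hh_def E1_def E2_def V_def linear_add[OF lin] linear_cmul[OF lin]
    by (simp add: frame_tangent)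
qed

text \<open>The first two coefficients match the normal part, so the residue has none; it is also
  tangent to the level set, hence a multiple of the velocity by \<open>tangential_start\<close>. The
  projection in \<open>coeff3\<close> returns this multiple.\<close>

lemma field_start: "field 0 t = nu (boundary_point t)"
proof -
  have \<omega>: "(cmod (boundary_point t))\<^sup>2 \<le> \<epsilon>" using boundary_point(2) by simp
  note lin = linear_normal_part[of "hh 0 t"] and lin' = model_derivative_linear[of "hh 0 t"]
  have turn: "turn 0 t = normal_part (hh 0 t) (nu (boundary_point t))"
    by (simp add: turn_def boundary_point(1))
  have "normal_part (hh 0 t) (residue t) = turn 0 t - coeff1 0 t *\<^sub>R Complex 0 (height t) - coeff2 0 t *\<^sub>R Complex (slope t) 0"
    unfolding residue_def linear_diff[OF lin] linear_cmul[OF lin] normal_part_start turn ..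
  also have "\<dots> = 0"
    using height_neq_0[of t] slope_neq_0[of t] by (simp add: complex_eq_iff coeff1_def coeff2_def)
  finally have 1: "normal_part (hh 0 t) (residue t) = 0" .
  have "Re (model_derivative (hh 0 t) (coeff1 0 t *\<^sub>R E1 0 t + coeff2 0 t *\<^sub>R E2 0 t + 0 *\<^sub>R V 0 t)) = 0"
    by (rule model_derivative_frames) simp
  moreover have "residue t = nu (boundary_point t) - (coeff1 0 t *\<^sub>R E1 0 t + coeff2 0 t *\<^sub>R E2 0 t + 0 *\<^sub>R V 0 t)"
    by (simp add: residue_def)
  ultimately have 2: "Re (model_derivative (hh 0 t) (residue t)) = 0"
    using tangent_nu[OF \<omega>] by (simp only: linear_diff[OF lin'] minus_complex.sel boundary_point(1))
  obtain k where k: "residue t = k *\<^sub>R V 0 t" using tangential_start[OF 1 2] by blast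
  interpret circle_family e m \<epsilon> \<sigma>0 0 by (rule family0)
  have "V 0 t \<noteq> 0" unfolding V_def start by (rule h'_neq_0)
  then have "coeff3 t = k" unfolding coeff3_def k by simp
  then have "residue t = coeff3 t *\<^sub>R V 0 t" using k by simp
  then show ?thesis unfolding residue_def field_def by (simp add: algebra_simps)
qed

lemma transports: "transports_to_fiber_framing X (\<lambda>x. cmod (f x)) f H (handle_framing Q \<kappa>)"
  unfolding transports_to_fiber_framing_def
proof (intro exI conjI ballI allI impI)
  let ?W = "\<lambda>\<tau> t. push (hh \<tau> t) (field \<tau> t)"
  fix c assume c: "c \<in> X"
  have "continuous_on {p \<in> {0..1} \<times> UNIV. J (hh (fst p) (snd p)) \<in> fst c}
      (\<lambda>p. push (hh (fst p) (snd p)) (field (fst p) (snd p)) c)"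
    by (rule continuous_on_push[OF continuous_frames(1) continuous_field _ c]) (use hh_tube in auto)
  moreover have "{p \<in> {0..1} \<times> UNIV. J (hh (fst p) (snd p)) \<in> fst c} = {(\<tau>, t). \<tau> \<in> {0..1} \<and> H \<tau> t \<in> fst c}"
    by (auto simp: H_def)
  ultimately show "continuous_on {(\<tau>, t). \<tau> \<in> {0..1} \<and> H \<tau> t \<in> fst c} (\<lambda>(\<tau>, t). ?W \<tau> t c)"
    by (simp add: case_prod_beta')
next
  fix \<tau> :: real and t assume \<tau>: "\<tau> \<in> {0..1}"
  interpret circle_family e m \<epsilon> "\<Sigma> \<tau>" "K \<tau>" by (rule family[OF \<tau>])
  show "normal_vec X (\<lambda>x. cmod (f x)) (H \<tau>) t (push (hh \<tau> t) (field \<tau> t))"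
    unfolding H_def[abs_def]
  proof (rule normal_vec_push[OF hh_tube[OF \<tau>] h_velocity[folded hh_def]])
    show "(\<lambda>q. cmod (f (J q))) differentiable at (hh \<tau> t)" by (rule g_derivative(1)[OF hh_tube[OF \<tau>]])
    show "frechet_derivative (\<lambda>q. cmod (f (J q))) (at (hh \<tau> t)) (field \<tau> t) = 0"
      unfolding g_derivative(2)[OF hh_tube[OF \<tau>]] field_def model_derivative_frames[OF \<tau>] by simp
    \<comment> \<open>A field parallel to the velocity would have both frame coefficients zero by
      \<open>frames_independent\<close>, whereas together they encode the nonzero number
      \<open>turn \<tau> t\<close>.\<close>
    show "field \<tau> t \<notin> span {h' t}"
    proof
      assume "field \<tau> t \<in> span {h' t}"
      then obtain d where "field \<tau> t = d *\<^sub>R h' t" unfolding span_singleton by auto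
      then have "coeff1 \<tau> t *\<^sub>R frame1 e \<epsilon> (\<Sigma> \<tau>) (K \<tau>) t + coeff2 \<tau> t *\<^sub>R frame2 e \<epsilon> (\<Sigma> \<tau>) t
          = (d - (1 - \<tau>) * coeff3 t) *\<^sub>R h' t"
        unfolding field_def E1_def E2_def V_def by (simp add: algebra_simps)
      from frames_independent[OF this] have "turn \<tau> t = 0"
        using height_neq_0[of t] slope_neq_0[of t] by (simp add: coeff1_def coeff2_def complex_eq_iff)
      then show False using turn_neq_0[OF \<tau>] by simp
    qed
  qed
next
  fix \<tau> t c show "push (hh \<tau> (t + 1)) (field \<tau> (t + 1)) c = push (hh \<tau> t) (field \<tau> t) c"
    by (simp only: periodic_frames field_periodic)
next
  fix t c assume c: "c \<in> X" "H 0 t \<in> fst c"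
  have \<omega>: "(cmod (boundary_point t))\<^sup>2 \<le> \<epsilon>" using boundary_point(2) by simp
  show "push (hh 0 t) (field 0 t) c = handle_framing Q \<kappa> (H 0 t) c"
    using handle_framing_nu[OF \<omega> c(1)] c(2) unfolding boundary_point(1) H_def field_start by simp
next
  fix t
  interpret circle_family e m \<epsilon> "sqrt (1/2)" "sqrt (1/2)" by (rule family1)
  have t1: "hh 1 t \<in> tube \<delta>" by (rule hh_tube) simp
  have half: "(sqrt (1/2))\<^sup>2 = (1/2 :: real)" by (simp add: power_divide)
  \<comment> \<open>The rotation in \<open>turn\<close> has removed the \<open>E2\<close>
    coefficient and the tangential term has faded out; what remains is a multiple of the field
    tangent to the fiber.\<close>
  have "field 1 t = coeff1 1 t *\<^sub>R E1 1 t" by (simp add: field_def coeff2_def Re_turn_1)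
  moreover have "model_derivative (hh 1 t) (E1 1 t) = 0"
    using frame_tangent(1) Im_model_end(2)[OF refl half] unfolding hh_def E1_def finish
    by (simp add: complex_eq_iff)
  ultimately have "model_derivative (hh 1 t) (field 1 t) = 0"
    using linear_cmul[OF model_derivative_linear] by simp
  from in_ker_push[OF t1 f_derivative[OF t1 this]]
  show "in_ker X f (H 1 t) (push (hh 1 t) (field 1 t))" unfolding H_def .
qed

end

context attaching_setup
begin

lemma framing:
  "handle_framing_is_fiber_framing X f (handle_centre N \<Phi> (m - 1/4) (m + 1/4)) \<epsilon>
     (core_disk N \<Phi> \<epsilon> (m - 1/4) (m + 1/4)) (attaching_circle N \<Phi> \<epsilon> (m - 1/4) (m + 1/4)) H"
  unfolding handle_framing_is_fiber_framing_def Let_def handle_centre_eq core_disk_eq attaching_circle_eq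
proof (intro conjI allI impI)
  show "\<exists>Q \<kappa>. handle_chart X (\<lambda>x. cmod (f x)) (J (disk 0)) \<epsilon> (J ` disk ` {\<omega>. (cmod \<omega>)\<^sup>2 \<le> \<epsilon>})
     (J ` disk ` {\<omega>. (cmod \<omega>)\<^sup>2 = \<epsilon>}) Q \<kappa>" by (rule handle_chart_exists)
  fix Q and \<kappa> :: "'x \<Rightarrow> complex \<times> complex"
  assume "handle_chart X (\<lambda>x. cmod (f x)) (J (disk 0)) \<epsilon> (J ` disk ` {\<omega>. (cmod \<omega>)\<^sup>2 \<le> \<epsilon>})
     (J ` disk ` {\<omega>. (cmod \<omega>)\<^sup>2 = \<epsilon>}) Q \<kappa>"
  then interpret handle_chart_setup X \<delta> J N \<Phi> f \<theta> e m \<epsilon> \<sigma>0 "J (disk 0)"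
    "J ` disk ` {\<omega>. (cmod \<omega>)\<^sup>2 \<le> \<epsilon>}" "J ` disk ` {\<omega>. (cmod \<omega>)\<^sup>2 = \<epsilon>}" Q \<kappa>
    by unfold_locales auto
  show "transports_to_fiber_framing X (\<lambda>x. cmod (f x)) f H (handle_framing Q \<kappa>)" by (rule transports)
qed

end

section \<open>Both handles\<close>

context annulus_param
begin

text \<open>The two values of \<open>m\<close> are the positions of the two critical points; they
  give the intervals from 0 to 1/2 and from 1/2 to 1.\<close>

lemma attaching_isotopy:
  assumes eps: "0 < \<epsilon>" "\<epsilon> < min 1 (\<delta>\<^sup>2 / 8)" and m: "m = 1/4 \<or> m = 3/4"
  obtains H where "circle_isotopy X {x \<in> carr X. cmod (f x) = 1/2 - \<epsilon>} H"
    "range (H 0) = attaching_circle N \<Phi> \<epsilon> (m - 1/4) (m + 1/4)"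
    "range (H 1) = standard_curve N \<Phi> \<epsilon> (m - 1/4) (m + 1/4)"
    "range (H 1) \<subseteq> {x \<in> carr X. f x = \<theta> (of_real \<epsilon>)}"
    "handle_framing_is_fiber_framing X f (handle_centre N \<Phi> (m - 1/4) (m + 1/4)) \<epsilon>
       (core_disk N \<Phi> \<epsilon> (m - 1/4) (m + 1/4)) (attaching_circle N \<Phi> \<epsilon> (m - 1/4) (m + 1/4)) H"
proof -
  \<comment> \<open>\<open>\<sigma>\<^sup>2\<close> is the smaller root of
    \<open>4 * x * (1 - x) = \<epsilon>\<close>, the one below 1/2; \<open>\<epsilon> < 1\<close>
    makes the roots real and distinct.\<close>
  define \<sigma> where "\<sigma> = sqrt ((1 - sqrt (1 - \<epsilon>)) / 2)"
  have s: "sqrt (1 - \<epsilon>) < 1" "0 < sqrt (1 - \<epsilon>)" "(sqrt (1 - \<epsilon>))\<^sup>2 = 1 - \<epsilon>" using eps by simp_all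
  have \<sigma>2: "\<sigma>\<^sup>2 = (1 - sqrt (1 - \<epsilon>)) / 2" using s by (simp add: \<sigma>_def)
  have c: "cos (2 * pi * m) = 0"
  proof -
    have "2 * pi * m = pi / 2 \<or> 2 * pi * m = 3 / 2 * pi" using m by auto
    then show ?thesis by (elim disjE) (simp only: cos_pi_half, simp only: cos_3over2_pi)
  qed
  interpret attaching_setup X \<delta> J N \<Phi> f \<theta> "sin (2 * pi * m)" m \<epsilon> \<sigma>
  proof
    show "\<sigma> > 0" "\<sigma>\<^sup>2 < 1/2" using s \<sigma>2 by (simp_all add: \<sigma>_def)
    have "4 * \<sigma>\<^sup>2 * (1 - \<sigma>\<^sup>2) = 1 - (sqrt (1 - \<epsilon>))\<^sup>2"
      unfolding \<sigma>2 by (simp add: field_simps power2_eq_square del: real_sqrt_mult_self)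
    then show "\<epsilon> = 4 * \<sigma>\<^sup>2 * (1 - \<sigma>\<^sup>2)" using s(3) by simp
  qed (use c eps in auto)
  have "range (H 1) \<subseteq> {x \<in> carr X. f x = \<theta> (of_real \<epsilon>)}"
    using f_H_end J_carr[OF hh_tube[of 1]] by (auto simp: H_def)
  then show ?thesis by (rule that[OF isotopy range_H_start range_H_end _ framing])
qed

end

theorem theorem4p6:
  fixes X :: "('a, real^4) atlas" and f :: "'a \<Rightarrow> complex" and n k :: nat
    and S N :: "nat \<Rightarrow> 'a set" and \<Phi> :: "nat \<Rightarrow> 'a \<Rightarrow> model_pt"
    and V :: "nat \<Rightarrow> complex set" and \<psi> :: "nat \<Rightarrow> complex \<Rightarrow> complex"
    and \<Phi>' :: "('a, real^4) opoint \<Rightarrow> model_pt"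
  assumes "M_fibration X f"
    and "normalized X f n S N \<Phi> V \<psi>"
    and "k \<in> {1..n}"
    and "is_lift X (N k) (\<Phi> k) \<Phi>'"
  shows "\<exists>\<epsilon>0>0. \<forall>\<epsilon>. 0 < \<epsilon> \<and> \<epsilon> < \<epsilon>0 \<longrightarrow>
    (let X' = orient_cover X; f' = f \<circ> fst; N' = lift_nbhd X (N k);
         Y = {x \<in> carr X'. cmod (f' x) = 1/2 - \<epsilon>};
         F = {x \<in> carr X'. f' x = inv_into (V k) (\<psi> k) (of_real \<epsilon>)};
         C1 = attaching_circle N' \<Phi>' \<epsilon> 0 (1/2);
         C2 = attaching_circle N' \<Phi>' \<epsilon> (1/2) 1
     in of_real \<epsilon> \<in> \<psi> k ` V k \<and>
        (\<exists>H1 H2.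
           circle_isotopy X' Y H1 \<and> range (H1 0) = C1 \<and> range (H1 1) \<subseteq> F \<and>
           circle_isotopy X' Y H2 \<and> range (H2 0) = C2 \<and> range (H2 1) \<subseteq> F \<and>
           (\<exists>G. ambient_isotopy X' F G \<and>
              G 1 ` range (H1 1) = standard_curve N' \<Phi>' \<epsilon> 0 (1/2) \<and>
              G 1 ` range (H2 1) = standard_curve N' \<Phi>' \<epsilon> (1/2) 1) \<and>
           handle_framing_is_fiber_framing X' f' (handle_centre N' \<Phi>' 0 (1/2)) \<epsilon>
             (core_disk N' \<Phi>' \<epsilon> 0 (1/2)) C1 H1 \<and>
           handle_framing_is_fiber_framing X' f' (handle_centre N' \<Phi>' (1/2) 1) \<epsilon>
             (core_disk N' \<Phi>' \<epsilon> (1/2) 1) C2 H2))"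
proof -
  have "smooth_manifold X" using assms(1) by (simp add: M_fibration_def)
  then obtain \<delta> J where par: "annulus_param (orient_cover X) \<delta> J (lift_nbhd X (N k)) \<Phi>' (f \<circ> fst) (inv_into (V k) (\<psi> k))"
    and V: "\<And>q. q \<in> tube \<delta> \<Longrightarrow> model q \<in> \<psi> k ` V k"
    using annulus_param_exists[OF _ assms(2-4)] by blast
  interpret annulus_param "orient_cover X" \<delta> J "lift_nbhd X (N k)" \<Phi>' "f \<circ> fst" "inv_into (V k) (\<psi> k)"
    by (rule par)
  \<comment> \<open>The bound \<open>\<delta>\<close> puts the point
    \<open>((\<epsilon>, 0), 0)\<close>, where the model has the value \<open>\<epsilon>\<close>,
    into the tube, so that \<open>\<epsilon>\<close> is a value of the base chart. The other two
    bounds are those of \<open>attaching_isotopy\<close>, and all serve both handles at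
    once.\<close>
  let ?\<epsilon>0 = "min \<delta> (min 1 (\<delta>\<^sup>2 / 8))"
  show ?thesis unfolding Let_def
  proof (intro exI[of _ ?\<epsilon>0] conjI allI impI)
    show "?\<epsilon>0 > 0" using \<delta>_pos by simp
    fix \<epsilon> assume \<epsilon>: "0 < \<epsilon> \<and> \<epsilon> < ?\<epsilon>0"
    then have e: "0 < \<epsilon>" "\<epsilon> < min 1 (\<delta>\<^sup>2 / 8)" by simp_all
    have "((\<epsilon>, 0), 0) \<in> tube \<delta>" using \<epsilon> by (simp add: mem_tube)
    from V[OF this] show "of_real \<epsilon> \<in> \<psi> k ` V k" by (simp add: model_def)
    obtain H1 where H1: "circle_isotopy (orient_cover X) {x \<in> carr (orient_cover X). cmod ((f \<circ> fst) x) = 1/2 - \<epsilon>} H1"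
      "range (H1 0) = attaching_circle (lift_nbhd X (N k)) \<Phi>' \<epsilon> 0 (1/2)"
      "range (H1 1) = standard_curve (lift_nbhd X (N k)) \<Phi>' \<epsilon> 0 (1/2)"
      "range (H1 1) \<subseteq> {x \<in> carr (orient_cover X). (f \<circ> fst) x = inv_into (V k) (\<psi> k) (of_real \<epsilon>)}"
      "handle_framing_is_fiber_framing (orient_cover X) (f \<circ> fst) (handle_centre (lift_nbhd X (N k)) \<Phi>' 0 (1/2)) \<epsilon>
        (core_disk (lift_nbhd X (N k)) \<Phi>' \<epsilon> 0 (1/2)) (attaching_circle (lift_nbhd X (N k)) \<Phi>' \<epsilon> 0 (1/2)) H1"
      using attaching_isotopy[OF e, of "1/4"] by auto
    obtain H2 where H2: "circle_isotopy (orient_cover X) {x \<in> carr (orient_cover X). cmod ((f \<circ> fst) x) = 1/2 - \<epsilon>} H2"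
      "range (H2 0) = attaching_circle (lift_nbhd X (N k)) \<Phi>' \<epsilon> (1/2) 1"
      "range (H2 1) = standard_curve (lift_nbhd X (N k)) \<Phi>' \<epsilon> (1/2) 1"
      "range (H2 1) \<subseteq> {x \<in> carr (orient_cover X). (f \<circ> fst) x = inv_into (V k) (\<psi> k) (of_real \<epsilon>)}"
      "handle_framing_is_fiber_framing (orient_cover X) (f \<circ> fst) (handle_centre (lift_nbhd X (N k)) \<Phi>' (1/2) 1) \<epsilon>
        (core_disk (lift_nbhd X (N k)) \<Phi>' \<epsilon> (1/2) 1) (attaching_circle (lift_nbhd X (N k)) \<Phi>' \<epsilon> (1/2) 1) H2"
      using attaching_isotopy[OF e, of "3/4"] by auto
    have "ambient_isotopy (orient_cover X) F (\<lambda>\<tau> x. x)" for F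
      by (rule ambient_isotopy_const[OF chart_inj transitions])
    moreover have "(\<lambda>x. x) ` range (H1 1) = standard_curve (lift_nbhd X (N k)) \<Phi>' \<epsilon> 0 (1/2)"
      "(\<lambda>x. x) ` range (H2 1) = standard_curve (lift_nbhd X (N k)) \<Phi>' \<epsilon> (1/2) 1"
      using H1(3) H2(3) by simp_all
    ultimately show "\<exists>H1 H2.
           circle_isotopy (orient_cover X) {x \<in> carr (orient_cover X). cmod ((f \<circ> fst) x) = 1/2 - \<epsilon>} H1 \<and>
           range (H1 0) = attaching_circle (lift_nbhd X (N k)) \<Phi>' \<epsilon> 0 (1/2) \<and>
           range (H1 1) \<subseteq> {x \<in> carr (orient_cover X). (f \<circ> fst) x = inv_into (V k) (\<psi> k) (of_real \<epsilon>)} \<and>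
           circle_isotopy (orient_cover X) {x \<in> carr (orient_cover X). cmod ((f \<circ> fst) x) = 1/2 - \<epsilon>} H2 \<and>
           range (H2 0) = attaching_circle (lift_nbhd X (N k)) \<Phi>' \<epsilon> (1/2) 1 \<and>
           range (H2 1) \<subseteq> {x \<in> carr (orient_cover X). (f \<circ> fst) x = inv_into (V k) (\<psi> k) (of_real \<epsilon>)} \<and>
           (\<exists>G. ambient_isotopy (orient_cover X)
                {x \<in> carr (orient_cover X). (f \<circ> fst) x = inv_into (V k) (\<psi> k) (of_real \<epsilon>)} G \<and>
              G 1 ` range (H1 1) = standard_curve (lift_nbhd X (N k)) \<Phi>' \<epsilon> 0 (1/2) \<and>
              G 1 ` range (H2 1) = standard_curve (lift_nbhd X (N k)) \<Phi>' \<epsilon> (1/2) 1) \<and>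
           handle_framing_is_fiber_framing (orient_cover X) (f \<circ> fst) (handle_centre (lift_nbhd X (N k)) \<Phi>' 0 (1/2)) \<epsilon>
             (core_disk (lift_nbhd X (N k)) \<Phi>' \<epsilon> 0 (1/2)) (attaching_circle (lift_nbhd X (N k)) \<Phi>' \<epsilon> 0 (1/2)) H1 \<and>
           handle_framing_is_fiber_framing (orient_cover X) (f \<circ> fst) (handle_centre (lift_nbhd X (N k)) \<Phi>' (1/2) 1) \<epsilon>
             (core_disk (lift_nbhd X (N k)) \<Phi>' \<epsilon> (1/2) 1) (attaching_circle (lift_nbhd X (N k)) \<Phi>' \<epsilon> (1/2) 1) H2"
      using H1 H2 by (intro exI[of _ H1] exI[of _ H2] conjI exI[of _ "\<lambda>\<tau> x. x"])
  qed
qed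

end
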